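(* Let $\Bbbk$ be a commutative ring, let $(\mathcal B,\otimes,\mathbb 1)$ be a $\Bbbk$-linear braided monoidal category with a twist $\theta$, let $H$ be a Hopf algebra in $\mathcal B$, and let $(\delta,\sigma)$ be a $\theta$-twisted modular pair in involution for $H$. Then: (a) $\{\mathrm{Hom}_{\mathcal B}(\mathbb 1,\mathbf{CM}_n(H,\delta,\sigma))\}_{n\in\mathbb N}$ is a cocyclic $\Bbbk$-module; (b) $\{\mathrm{Hom}_{\mathcal B}(\mathbf{CM}_n(H,\delta,\sigma),\mathbb 1)\}_{n\in\mathbb N}$ is a cyclic $\Bbbk$-module; where in both cases the structure maps are those induced from $\mathbf{CM}_\bullet(H,\delta,\sigma)$ by the functors $\mathrm{Hom}_{\mathcal B}(\mathbb 1,-)$ and $\mathrm{Hom}_{\mathcal B}(-,\mathbb 1)$.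
   Context: Associativity and unit constraints are suppressed; $H^{\otimes0}=\mathbb 1$; $\mathbb N$ contains $0$. A monoidal category is $\Bbbk$-linear if its Hom sets are $\Bbbk$-modules and composition and monoidal product of morphisms are $\Bbbk$-bilinear. The braiding $c=\{c_{X,Y}\colon X\otimes Y\to Y\otimes X\}$ satisfies $c_{X,Y\otimes Z}=(\mathrm{id}_Y\otimes c_{X,Z})(c_{X,Y}\otimes\mathrm{id}_Z)$ and $c_{X\otimes Y,Z}=(c_{X,Z}\otimes\mathrm{id}_Y)(\mathrm{id}_X\otimes c_{Y,Z})$. A twist is a natural isomorphism $\theta=\{\theta_X\colon X\to X\}$ with $\theta_{X\otimes Y}=(\theta_X\otimes\theta_Y)c_{Y,X}c_{X,Y}$. A Hopf algebra in $\mathcal B$ is $(H,m,u,\Delta,\varepsilon,S)$ where $(H,m,u)$ is an algebra and $(H,\Delta,\varepsilon)$ a coalgebra in $\mathcal B$, $\Delta m=(m\otimes m)(\mathrm{id}_H\otimes c_{H,H}\otimes\mathrm{id}_H)(\Delta\otimes\Delta)$, $\Delta u=u\otimes u$, $\varepsilon m=\varepsilon\otimes\varepsilon$, $\varepsilon u=\mathrm{id}_{\mathbb 1}$, and $S\colon H\to H$ is an isomorphism with $m(S\otimes\mathrm{id}_H)\Delta=u\varepsilon=m(\mathrm{id}_H\otimes S)\Delta$. A modular pair for $H$ is a pair $(\delta,\sigma)$ with $\delta\colon H\to\mathbb 1$ an algebra morphism and $\sigma\colon\mathbb 1\to H$ a coalgebra morphism such that $\delta\sigma=\mathrm{id}_{\mathbb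 1}$. It is a $\theta$-twisted modular pair in involution if $$S^2=m(m\otimes\mathrm{id}_H)(\sigma\otimes\theta_H\otimes S\sigma)\circ(\delta S\otimes\mathrm{id}_H\otimes\delta)(\Delta\otimes\mathrm{id}_H)\Delta .$$ A paracocyclic object in a category is a family $\{Y_n\}_{n\in\mathbb N}$ with cofaces $d_i^n\colon Y_{n-1}\to Y_n$ ($n\ge1$, $0\le i\le n$), codegeneracies $s_j^n\colon Y_{n+1}\to Y_n$ ($0\le j\le n$) satisfying the cosimplicial identities, and isomorphisms $t_n\colon Y_n\to Y_n$ with $t_nd_i=d_{i-1}t_{n-1}$ and $t_ns_i=s_{i-1}t_{n+1}$ for $1\le i\le n$, $t_nd_0=d_n$, $t_ns_0=s_nt_{n+1}^2$. It is cocyclic if moreover $t_n^{n+1}=\mathrm{id}_{Y_n}$ for all $n$. Cyclic objects are defined dually (contravariant version of the same relations). A (co)cyclic $\Bbbk$-module is a (co)cyclic object in the category of $\Bbbk$-modules. The paracocyclic object $\mathbf{CM}_\bullet(H,\delta,\sigma)$: $\mathbf{CM}_n(H,\delta,\sigma)=H^{\otimes n}$; cofaces $d_0^n=u\otimes\mathrm{id}_{H^{\otimes n-1}}$, $d_i^n=\mathrm{id}_{H^{\otimes i-1}}\otimes\Delta\otimes\mathrm{id}_{H^{\otimes n-1-i}}$ for $1\le i\le n-1$, $d_n^n=\mathrm{id}_{H^{\otimes n-1}}\otimes\sigma$; codegeneracies $s_j^n=\mathrm{id}_{H^{\otimes j}}\otimes\varepsilon\otimes\mathrm{id}_{H^{\otimes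 n-j}}$; paracocyclic operators $t_0=\mathrm{id}_{\mathbb 1}$ and $t_n=\lambda_n(\tilde S\otimes\mathrm{id}_{H^{\otimes n-1}}\otimes\sigma)$ for $n\ge1$, where $\tilde S=(\delta\otimes S)\Delta$ and the left diagonal action $\lambda_n\colon H\otimes H^{\otimes n}\to H^{\otimes n}$ is given by $\lambda_0=\varepsilon$, $\lambda_n=(m\otimes\lambda_{n-1})(\mathrm{id}_H\otimes c_{H,H}\otimes\mathrm{id}_{H^{\otimes n-1}})(\Delta\otimes\mathrm{id}_{H^{\otimes n}})$. *)

theory Defs
  imports "HOL-Algebra.Module"
begin

section \<open>Categories\<close>

text \<open>
  \<open>Comp C g f\<close> is the composite "\<open>f\<close> first, then \<open>g\<close>". All operations are only meaningful on
  objects and (composable) arrows; nothing is required of them elsewhere.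
\<close>

record ('o, 'm) category =
  Obj :: "'o set"
  Arr :: "'m set"
  Dom :: "'m \<Rightarrow> 'o"
  Cod :: "'m \<Rightarrow> 'o"
  Ident :: "'o \<Rightarrow> 'm"
  Comp :: "'m \<Rightarrow> 'm \<Rightarrow> 'm"  (infixr "\<cdot>\<index>" 55)

definition hom_set :: "('o, 'm, 'z) category_scheme \<Rightarrow> 'o \<Rightarrow> 'o \<Rightarrow> 'm set" where
  "hom_set C X Y = {f \<in> Arr C. Dom C f = X \<and> Cod C f = Y}"

locale category =
  fixes C :: "('o, 'm, 'z) category_scheme" (structure)
  assumes Dom_in_Obj: "f \<in> Arr C \<Longrightarrow> Dom C f \<in> Obj C"
    and Cod_in_Obj: "f \<in> Arr C \<Longrightarrow> Cod C f \<in> Obj C"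
    and Ident_in_hom: "X \<in> Obj C \<Longrightarrow> Ident C X \<in> hom_set C X X"
    and Comp_in_hom: "\<lbrakk>f \<in> hom_set C X Y; g \<in> hom_set C Y Z\<rbrakk> \<Longrightarrow> g \<cdot> f \<in> hom_set C X Z"
    and Comp_Ident_left: "f \<in> hom_set C X Y \<Longrightarrow> Ident C Y \<cdot> f = f"
    and Comp_Ident_right: "f \<in> hom_set C X Y \<Longrightarrow> f \<cdot> Ident C X = f"
    and Comp_assoc:
      "\<lbrakk>f \<in> hom_set C W X; g \<in> hom_set C X Y; h \<in> hom_set C Y Z\<rbrakk>
        \<Longrightarrow> (h \<cdot> g) \<cdot> f = h \<cdot> (g \<cdot> f)"

context
  fixes C :: "('o, 'm, 'z) category_scheme" (structure)
begin

definition inverse_arrows :: "'m \<Rightarrow> 'm \<Rightarrow> bool" where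
  "inverse_arrows f g \<longleftrightarrow>
     f \<in> Arr C \<and> g \<in> hom_set C (Cod C f) (Dom C f) \<and>
     g \<cdot> f = Ident C (Dom C f) \<and> f \<cdot> g = Ident C (Cod C f)"

definition iso_arrow :: "'m \<Rightarrow> bool" where
  "iso_arrow f \<longleftrightarrow> (\<exists>g. inverse_arrows f g)"

definition inv_arrow :: "'m \<Rightarrow> 'm" where
  "inv_arrow f = (THE g. inverse_arrows f g)"

primrec arrow_pow :: "'m \<Rightarrow> nat \<Rightarrow> 'm" where
  "arrow_pow f 0 = Ident C (Dom C f)"
| "arrow_pow f (Suc n) = f \<cdot> arrow_pow f n"

end

definition opposite_category :: "('o, 'm, 'z) category_scheme \<Rightarrow> ('o, 'm) category" where
  "opposite_category C =
     \<lparr>Obj = Obj C, Arr = Arr C, Dom = Cod C, Cod = Dom C, Ident = Ident C,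
      Comp = (\<lambda>g f. Comp C f g)\<rparr>"

section \<open>Cocyclic and cyclic objects\<close>

text \<open>
  \<open>d n i\<close> is the coface \<open>Y (n - 1) \<rightarrow> Y n\<close> (for \<open>n \<ge> 1\<close>, \<open>i \<le> n\<close>), \<open>s n j\<close> is the codegeneracy
  \<open>Y (n + 1) \<rightarrow> Y n\<close> (for \<open>j \<le> n\<close>), and \<open>t n\<close> is the operator on \<open>Y n\<close>. Values of \<open>d\<close> and \<open>s\<close>
  at other indices are irrelevant.
\<close>

locale cosimplicial_object = category C
  for C :: "('o, 'm, 'z) category_scheme" (structure) +
  fixes Y :: "nat \<Rightarrow> 'o" and d s :: "nat \<Rightarrow> nat \<Rightarrow> 'm"
  assumes Y_in_Obj: "Y n \<in> Obj C"
    and coface_in_hom: "i \<le> Suc n \<Longrightarrow> d (Suc n) i \<in> hom_set C (Y n) (Y (Suc n))"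
    and codegeneracy_in_hom: "j \<le> n \<Longrightarrow> s n j \<in> hom_set C (Y (Suc n)) (Y n)"
    and coface_coface:
      "\<lbrakk>n \<ge> 1; i < j; j \<le> Suc n\<rbrakk> \<Longrightarrow> d (Suc n) j \<cdot> d n i = d (Suc n) i \<cdot> d n (j - 1)"
    and codegeneracy_codegeneracy:
      "\<lbrakk>i \<le> j; j \<le> n\<rbrakk> \<Longrightarrow> s n j \<cdot> s (Suc n) i = s n i \<cdot> s (Suc n) (Suc j)"
    and codegeneracy_coface_less:
      "\<lbrakk>n \<ge> 1; i < j; j \<le> n\<rbrakk> \<Longrightarrow> s n j \<cdot> d (Suc n) i = d n i \<cdot> s (n - 1) (j - 1)"
    and codegeneracy_coface_eq:
      "\<lbrakk>j \<le> n; i = j \<or> i = Suc j\<rbrakk> \<Longrightarrow> s n j \<cdot> d (Suc n) i = Ident C (Y n)"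
    and codegeneracy_coface_greater:
      "\<lbrakk>n \<ge> 1; Suc j < i; i \<le> Suc n\<rbrakk> \<Longrightarrow> s n j \<cdot> d (Suc n) i = d n (i - 1) \<cdot> s (n - 1) j"

locale paracocyclic_object = cosimplicial_object C Y d s
  for C :: "('o, 'm, 'z) category_scheme" (structure) and Y d s +
  fixes t :: "nat \<Rightarrow> 'm"
  assumes paracocyclic_in_hom: "t n \<in> hom_set C (Y n) (Y n)"
    and paracocyclic_iso: "iso_arrow C (t n)"
    and paracocyclic_coface:
      "\<lbrakk>1 \<le> i; i \<le> n\<rbrakk> \<Longrightarrow> t n \<cdot> d n i = d n (i - 1) \<cdot> t (n - 1)"
    and paracocyclic_codegeneracy:
      "\<lbrakk>1 \<le> i; i \<le> n\<rbrakk> \<Longrightarrow> t n \<cdot> s n i = s n (i - 1) \<cdot> t (Suc n)"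
    and paracocyclic_coface_0: "n \<ge> 1 \<Longrightarrow> t n \<cdot> d n 0 = d n n"
    and paracocyclic_codegeneracy_0: "t n \<cdot> s n 0 = s n n \<cdot> arrow_pow C (t (Suc n)) 2"

locale cocyclic_object = paracocyclic_object +
  assumes cocyclic: "arrow_pow C (t n) (Suc n) = Ident C (Y n)"

definition cyclic_object ::
  "('o, 'm, 'z) category_scheme \<Rightarrow> (nat \<Rightarrow> 'o) \<Rightarrow> (nat \<Rightarrow> nat \<Rightarrow> 'm) \<Rightarrow> (nat \<Rightarrow> nat \<Rightarrow> 'm)
    \<Rightarrow> (nat \<Rightarrow> 'm) \<Rightarrow> bool" where
  "cyclic_object C = cocyclic_object (opposite_category C)"

section \<open>The category of modules over a commutative ring\<close>

definition linear_maps ::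
  "('k, 'a) ring_scheme \<Rightarrow> ('k, 'v, 'b) module_scheme \<Rightarrow> ('k, 'w, 'c) module_scheme
    \<Rightarrow> ('v \<Rightarrow> 'w) set" where
  "linear_maps K M N =
     {f \<in> carrier M \<rightarrow>\<^sub>E carrier N.
        (\<forall>x \<in> carrier M. \<forall>y \<in> carrier M. f (x \<oplus>\<^bsub>M\<^esub> y) = f x \<oplus>\<^bsub>N\<^esub> f y) \<and>
        (\<forall>r \<in> carrier K. \<forall>x \<in> carrier M. f (r \<odot>\<^bsub>M\<^esub> x) = r \<odot>\<^bsub>N\<^esub> f x)}"

type_synonym ('k, 'v) module_arrow = "('k, 'v) module \<times> ('k, 'v) module \<times> ('v \<Rightarrow> 'v)"

text \<open>
  Modules whose underlying set consists of elements of the type \<open>'v\<close>. An arrow carries its domain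
  and codomain along with the underlying map.
\<close>

definition module_category ::
  "('k, 'a) ring_scheme \<Rightarrow> (('k, 'v) module, ('k, 'v) module_arrow) category" where
  "module_category K =
     \<lparr>Obj = {M. module K M},
      Arr = {(M, N, f). module K M \<and> module K N \<and> f \<in> linear_maps K M N},
      Dom = (\<lambda>(M, N, f). M),
      Cod = (\<lambda>(M, N, f). N),
      Ident = (\<lambda>M. (M, M, \<lambda>x \<in> carrier M. x)),
      Comp = (\<lambda>(N', P, g) (M, N, f). (M, P, compose (carrier M) g f))\<rparr>"

section \<open>Monoidal categories\<close>

text \<open>
  \<open>Assoc X Y Z\<close> is the associativity constraint \<open>(X \<boxtimes> Y) \<boxtimes> Z \<rightarrow> X \<boxtimes> (Y \<boxtimes> Z)\<close>, and \<open>LUnit X\<close>,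
  \<open>RUnit X\<close> are the unit constraints \<open>\<I> \<boxtimes> X \<rightarrow> X\<close>, \<open>X \<boxtimes> \<I> \<rightarrow> X\<close>. The category is not assumed to
  be strict; the constraints are inserted wherever a formula needs them.
\<close>

record ('o, 'm) monoidal_category = "('o, 'm) category" +
  TensorObj :: "'o \<Rightarrow> 'o \<Rightarrow> 'o"  (infixr "\<boxtimes>\<index>" 75)
  TensorArr :: "'m \<Rightarrow> 'm \<Rightarrow> 'm"  (infixr "\<star>\<index>" 70)
  TensorUnit :: "'o"  ("\<I>\<index>")
  Assoc :: "'o \<Rightarrow> 'o \<Rightarrow> 'o \<Rightarrow> 'm"
  LUnit :: "'o \<Rightarrow> 'm"
  RUnit :: "'o \<Rightarrow> 'm"

locale monoidal_category = category B
  for B :: "('o, 'm, 'z) monoidal_category_scheme" (structure) +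
  assumes TensorObj_closed: "\<lbrakk>X \<in> Obj B; Y \<in> Obj B\<rbrakk> \<Longrightarrow> X \<boxtimes> Y \<in> Obj B"
    and TensorUnit_closed: "\<I> \<in> Obj B"
    and TensorArr_in_hom:
      "\<lbrakk>f \<in> hom_set B X Y; g \<in> hom_set B X' Y'\<rbrakk> \<Longrightarrow> f \<star> g \<in> hom_set B (X \<boxtimes> X') (Y \<boxtimes> Y')"
    and TensorArr_Ident:
      "\<lbrakk>X \<in> Obj B; Y \<in> Obj B\<rbrakk> \<Longrightarrow> Ident B X \<star> Ident B Y = Ident B (X \<boxtimes> Y)"
    and TensorArr_Comp:
      "\<lbrakk>f \<in> hom_set B X Y; g \<in> hom_set B Y Z; f' \<in> hom_set B X' Y'; g' \<in> hom_set B Y' Z'\<rbrakk>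
        \<Longrightarrow> (g \<cdot> f) \<star> (g' \<cdot> f') = (g \<star> g') \<cdot> (f \<star> f')"
    and Assoc_in_hom:
      "\<lbrakk>X \<in> Obj B; Y \<in> Obj B; Z \<in> Obj B\<rbrakk>
        \<Longrightarrow> Assoc B X Y Z \<in> hom_set B ((X \<boxtimes> Y) \<boxtimes> Z) (X \<boxtimes> (Y \<boxtimes> Z))"
    and Assoc_iso:
      "\<lbrakk>X \<in> Obj B; Y \<in> Obj B; Z \<in> Obj B\<rbrakk> \<Longrightarrow> iso_arrow B (Assoc B X Y Z)"
    and Assoc_natural:
      "\<lbrakk>f \<in> hom_set B X X'; g \<in> hom_set B Y Y'; h \<in> hom_set B Z Z'\<rbrakk>
        \<Longrightarrow> Assoc B X' Y' Z' \<cdot> ((f \<star> g) \<star> h) = (f \<star> (g \<star> h)) \<cdot> Assoc B X Y Z"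
    and LUnit_in_hom: "X \<in> Obj B \<Longrightarrow> LUnit B X \<in> hom_set B (\<I> \<boxtimes> X) X"
    and LUnit_iso: "X \<in> Obj B \<Longrightarrow> iso_arrow B (LUnit B X)"
    and LUnit_natural:
      "f \<in> hom_set B X Y \<Longrightarrow> LUnit B Y \<cdot> (Ident B \<I> \<star> f) = f \<cdot> LUnit B X"
    and RUnit_in_hom: "X \<in> Obj B \<Longrightarrow> RUnit B X \<in> hom_set B (X \<boxtimes> \<I>) X"
    and RUnit_iso: "X \<in> Obj B \<Longrightarrow> iso_arrow B (RUnit B X)"
    and RUnit_natural:
      "f \<in> hom_set B X Y \<Longrightarrow> RUnit B Y \<cdot> (f \<star> Ident B \<I>) = f \<cdot> RUnit B X"
    and pentagon:
      "\<lbrakk>W \<in> Obj B; X \<in> Obj B; Y \<in> Obj B; Z \<in> Obj B\<rbrakk>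
        \<Longrightarrow> (Ident B W \<star> Assoc B X Y Z) \<cdot> Assoc B W (X \<boxtimes> Y) Z \<cdot> (Assoc B W X Y \<star> Ident B Z)
          = Assoc B W X (Y \<boxtimes> Z) \<cdot> Assoc B (W \<boxtimes> X) Y Z"
    and triangle:
      "\<lbrakk>X \<in> Obj B; Y \<in> Obj B\<rbrakk>
        \<Longrightarrow> (Ident B X \<star> LUnit B Y) \<cdot> Assoc B X \<I> Y = RUnit B X \<star> Ident B Y"

context
  fixes B :: "('o, 'm, 'z) monoidal_category_scheme" (structure)
begin

text \<open>Tensor powers are bracketed to the right and end with the unit: \<open>X \<boxtimes> (\<dots> \<boxtimes> (X \<boxtimes> \<I>))\<close>.\<close>

primrec tensor_pow :: "'o \<Rightarrow> nat \<Rightarrow> 'o" where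
  "tensor_pow X 0 = \<I>"
| "tensor_pow X (Suc n) = X \<boxtimes> tensor_pow X n"

text \<open>\<open>whisker X k f\<close> is the tensor product of the identity of the \<open>k\<close>-th power of \<open>X\<close> with \<open>f\<close>.\<close>

primrec whisker :: "'o \<Rightarrow> nat \<Rightarrow> 'm \<Rightarrow> 'm" where
  "whisker X 0 f = f"
| "whisker X (Suc k) f = Ident B X \<star> whisker X k f"

end

section \<open>Braidings, twists, linear structures\<close>

record ('o, 'm) braided_category = "('o, 'm) monoidal_category" +
  Braid :: "'o \<Rightarrow> 'o \<Rightarrow> 'm"

locale braided_category = monoidal_category B
  for B :: "('o, 'm, 'z) braided_category_scheme" (structure) +
  assumes Braid_in_hom:
      "\<lbrakk>X \<in> Obj B; Y \<in> Obj B\<rbrakk> \<Longrightarrow> Braid B X Y \<in> hom_set B (X \<boxtimes> Y) (Y \<boxtimes> X)"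
    and Braid_iso: "\<lbrakk>X \<in> Obj B; Y \<in> Obj B\<rbrakk> \<Longrightarrow> iso_arrow B (Braid B X Y)"
    and Braid_natural:
      "\<lbrakk>f \<in> hom_set B X X'; g \<in> hom_set B Y Y'\<rbrakk>
        \<Longrightarrow> Braid B X' Y' \<cdot> (f \<star> g) = (g \<star> f) \<cdot> Braid B X Y"
    and hexagon_right:
      "\<lbrakk>X \<in> Obj B; Y \<in> Obj B; Z \<in> Obj B\<rbrakk>
        \<Longrightarrow> Assoc B Y Z X \<cdot> Braid B X (Y \<boxtimes> Z) \<cdot> Assoc B X Y Z
          = (Ident B Y \<star> Braid B X Z) \<cdot> Assoc B Y X Z \<cdot> (Braid B X Y \<star> Ident B Z)"
    and hexagon_left:
      "\<lbrakk>X \<in> Obj B; Y \<in> Obj B; Z \<in> Obj B\<rbrakk>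
        \<Longrightarrow> inv_arrow B (Assoc B Z X Y) \<cdot> Braid B (X \<boxtimes> Y) Z \<cdot> inv_arrow B (Assoc B X Y Z)
          = (Braid B X Z \<star> Ident B Y) \<cdot> inv_arrow B (Assoc B X Z Y) \<cdot> (Ident B X \<star> Braid B Y Z)"

locale twisted_braided_category = braided_category B
  for B :: "('o, 'm, 'z) braided_category_scheme" (structure) +
  fixes \<theta> :: "'o \<Rightarrow> 'm"
  assumes twist_in_hom: "X \<in> Obj B \<Longrightarrow> \<theta> X \<in> hom_set B X X"
    and twist_iso: "X \<in> Obj B \<Longrightarrow> iso_arrow B (\<theta> X)"
    and twist_natural: "f \<in> hom_set B X Y \<Longrightarrow> \<theta> Y \<cdot> f = f \<cdot> \<theta> X"
    and twist_tensor:
      "\<lbrakk>X \<in> Obj B; Y \<in> Obj B\<rbrakk> \<Longrightarrow> \<theta> (X \<boxtimes> Y) = (\<theta> X \<star> \<theta> Y) \<cdot> Braid B Y X \<cdot> Braid B X Y"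

record ('o, 'm, 'k) linear_braided_category = "('o, 'm) braided_category" +
  HomZero :: "'o \<Rightarrow> 'o \<Rightarrow> 'm"
  HomAdd :: "'m \<Rightarrow> 'm \<Rightarrow> 'm"
  HomSmult :: "'k \<Rightarrow> 'm \<Rightarrow> 'm"

text \<open>The fields \<open>mult\<close> and \<open>one\<close> of a module record play no role.\<close>

definition hom_module ::
  "('o, 'm, 'k, 'z) linear_braided_category_scheme \<Rightarrow> 'o \<Rightarrow> 'o \<Rightarrow> ('k, 'm) module" where
  "hom_module B X Y =
     \<lparr>carrier = hom_set B X Y, mult = undefined, one = undefined,
      zero = HomZero B X Y, add = HomAdd B, smult = HomSmult B\<rparr>"

locale linear_braided_category = braided_category B
  for K :: "('k, 'a) ring_scheme"
    and B :: "('o, 'm, 'k, 'z) linear_braided_category_scheme" (structure) +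
  assumes cring: "cring K"
    and hom_module: "\<lbrakk>X \<in> Obj B; Y \<in> Obj B\<rbrakk> \<Longrightarrow> module K (hom_module B X Y)"
    and Comp_linear_right:
      "\<lbrakk>X \<in> Obj B; g \<in> hom_set B Y Z\<rbrakk>
        \<Longrightarrow> (\<lambda>f \<in> hom_set B X Y. g \<cdot> f) \<in> linear_maps K (hom_module B X Y) (hom_module B X Z)"
    and Comp_linear_left:
      "\<lbrakk>Z \<in> Obj B; f \<in> hom_set B X Y\<rbrakk>
        \<Longrightarrow> (\<lambda>g \<in> hom_set B Y Z. g \<cdot> f) \<in> linear_maps K (hom_module B Y Z) (hom_module B X Z)"
    and TensorArr_linear_right:
      "\<lbrakk>X' \<in> Obj B; Y' \<in> Obj B; f \<in> hom_set B X Y\<rbrakk>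
        \<Longrightarrow> (\<lambda>g \<in> hom_set B X' Y'. f \<star> g)
          \<in> linear_maps K (hom_module B X' Y') (hom_module B (X \<boxtimes> X') (Y \<boxtimes> Y'))"
    and TensorArr_linear_left:
      "\<lbrakk>X \<in> Obj B; Y \<in> Obj B; g \<in> hom_set B X' Y'\<rbrakk>
        \<Longrightarrow> (\<lambda>f \<in> hom_set B X Y. f \<star> g)
          \<in> linear_maps K (hom_module B X Y) (hom_module B (X \<boxtimes> X') (Y \<boxtimes> Y'))"

text \<open>
  The functors \<open>Hom(X, -)\<close> and \<open>Hom(-, X)\<close> on arrows. The latter sends \<open>f\<close> to a linear map from
  \<open>Hom(Cod f, X)\<close> to \<open>Hom(Dom f, X)\<close>.
\<close>

definition hom_functor ::
  "('o, 'm, 'k, 'z) linear_braided_category_scheme \<Rightarrow> 'o \<Rightarrow> 'm \<Rightarrow> ('k, 'm) module_arrow" where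
  "hom_functor B X f =
     (hom_module B X (Dom B f), hom_module B X (Cod B f),
      \<lambda>g \<in> hom_set B X (Dom B f). f \<cdot>\<^bsub>B\<^esub> g)"

definition contra_hom_functor ::
  "('o, 'm, 'k, 'z) linear_braided_category_scheme \<Rightarrow> 'o \<Rightarrow> 'm \<Rightarrow> ('k, 'm) module_arrow" where
  "contra_hom_functor B X f =
     (hom_module B (Cod B f) X, hom_module B (Dom B f) X,
      \<lambda>g \<in> hom_set B (Cod B f) X. g \<cdot>\<^bsub>B\<^esub> f)"

section \<open>Hopf algebras in a braided category\<close>

locale algebra_object = monoidal_category B
  for B :: "('o, 'm, 'z) monoidal_category_scheme" (structure) +
  fixes A :: 'o and m u :: 'm
  assumes algebra_Obj: "A \<in> Obj B"
    and mult_in_hom: "m \<in> hom_set B (A \<boxtimes> A) A"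
    and unit_in_hom: "u \<in> hom_set B \<I> A"
    and mult_assoc: "m \<cdot> (m \<star> Ident B A) = m \<cdot> (Ident B A \<star> m) \<cdot> Assoc B A A A"
    and mult_unit_left: "m \<cdot> (u \<star> Ident B A) = LUnit B A"
    and mult_unit_right: "m \<cdot> (Ident B A \<star> u) = RUnit B A"

locale coalgebra_object = monoidal_category B
  for B :: "('o, 'm, 'z) monoidal_category_scheme" (structure) +
  fixes A :: 'o and \<Delta> \<epsilon> :: 'm
  assumes coalgebra_Obj: "A \<in> Obj B"
    and comult_in_hom: "\<Delta> \<in> hom_set B A (A \<boxtimes> A)"
    and counit_in_hom: "\<epsilon> \<in> hom_set B A \<I>"
    and comult_coassoc: "Assoc B A A A \<cdot> (\<Delta> \<star> Ident B A) \<cdot> \<Delta> = (Ident B A \<star> \<Delta>) \<cdot> \<Delta>"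
    and comult_counit_left: "LUnit B A \<cdot> (\<epsilon> \<star> Ident B A) \<cdot> \<Delta> = Ident B A"
    and comult_counit_right: "RUnit B A \<cdot> (Ident B A \<star> \<epsilon>) \<cdot> \<Delta> = Ident B A"

context
  fixes B :: "('o, 'm, 'z) monoidal_category_scheme" (structure)
begin

definition algebra_morphism ::
  "'o \<Rightarrow> 'm \<Rightarrow> 'm \<Rightarrow> 'o \<Rightarrow> 'm \<Rightarrow> 'm \<Rightarrow> 'm \<Rightarrow> bool" where
  "algebra_morphism A m u A' m' u' f \<longleftrightarrow>
     f \<in> hom_set B A A' \<and> f \<cdot> m = m' \<cdot> (f \<star> f) \<and> f \<cdot> u = u'"

definition coalgebra_morphism ::
  "'o \<Rightarrow> 'm \<Rightarrow> 'm \<Rightarrow> 'o \<Rightarrow> 'm \<Rightarrow> 'm \<Rightarrow> 'm \<Rightarrow> bool" where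
  "coalgebra_morphism A \<Delta> \<epsilon> A' \<Delta>' \<epsilon>' f \<longleftrightarrow>
     f \<in> hom_set B A A' \<and> \<Delta>' \<cdot> f = (f \<star> f) \<cdot> \<Delta> \<and> \<epsilon>' \<cdot> f = \<epsilon>"

end

context
  fixes B :: "('o, 'm, 'z) braided_category_scheme" (structure)
begin

text \<open>
  The arrow \<open>id \<otimes> c \<otimes> id\<close> from \<open>(W \<boxtimes> X) \<boxtimes> (Y \<boxtimes> Z)\<close> to \<open>(W \<boxtimes> Y) \<boxtimes> (X \<boxtimes> Z)\<close>, where \<open>c\<close> is the
  braiding of \<open>X\<close> and \<open>Y\<close>.
\<close>

definition middle_braid :: "'o \<Rightarrow> 'o \<Rightarrow> 'o \<Rightarrow> 'o \<Rightarrow> 'm" where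
  "middle_braid W X Y Z =
     inv_arrow B (Assoc B W Y (X \<boxtimes> Z)) \<cdot>
     (Ident B W \<star>
        (Assoc B Y X Z \<cdot> (Braid B X Y \<star> Ident B Z) \<cdot> inv_arrow B (Assoc B X Y Z))) \<cdot>
     Assoc B W X (Y \<boxtimes> Z)"

end

record ('o, 'm) hopf_data =
  HObj :: 'o
  HMult :: 'm
  HUnit :: 'm
  HComult :: 'm
  HCounit :: 'm
  HAntipode :: 'm

locale hopf_algebra = braided_category B
  for B :: "('o, 'm, 'z) braided_category_scheme" (structure) +
  fixes H :: "('o, 'm) hopf_data"
  assumes algebra: "algebra_object B (HObj H) (HMult H) (HUnit H)"
    and coalgebra: "coalgebra_object B (HObj H) (HComult H) (HCounit H)"
    and comult_mult:
      "HComult H \<cdot> HMult H =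
        (HMult H \<star> HMult H) \<cdot> middle_braid B (HObj H) (HObj H) (HObj H) (HObj H)
          \<cdot> (HComult H \<star> HComult H)"
    and comult_unit: "HComult H \<cdot> HUnit H = (HUnit H \<star> HUnit H) \<cdot> inv_arrow B (LUnit B \<I>)"
    and counit_mult: "HCounit H \<cdot> HMult H = LUnit B \<I> \<cdot> (HCounit H \<star> HCounit H)"
    and counit_unit: "HCounit H \<cdot> HUnit H = Ident B \<I>"
    and antipode_in_hom: "HAntipode H \<in> hom_set B (HObj H) (HObj H)"
    and antipode_iso: "iso_arrow B (HAntipode H)"
    and antipode_left:
      "HMult H \<cdot> (HAntipode H \<star> Ident B (HObj H)) \<cdot> HComult H = HUnit H \<cdot> HCounit H"
    and antipode_right:
      "HMult H \<cdot> (Ident B (HObj H) \<star> HAntipode H) \<cdot> HComult H = HUnit H \<cdot> HCounit H"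

context
  fixes B :: "('o, 'm, 'z) braided_category_scheme" (structure)
    and H :: "('o, 'm) hopf_data"
begin

definition modular_pair :: "'m \<Rightarrow> 'm \<Rightarrow> bool" where
  "modular_pair \<delta> \<sigma> \<longleftrightarrow>
     algebra_morphism B (HObj H) (HMult H) (HUnit H) \<I> (LUnit B \<I>) (Ident B \<I>) \<delta> \<and>
     coalgebra_morphism B \<I> (inv_arrow B (LUnit B \<I>)) (Ident B \<I>)
       (HObj H) (HComult H) (HCounit H) \<sigma> \<and>
     \<delta> \<cdot> \<sigma> = Ident B \<I>"

text \<open>
  No constraints are needed in the following formula: its second factor takes values in
  \<open>(\<I> \<boxtimes> HObj H) \<boxtimes> \<I>\<close>.
\<close>

definition twisted_modular_pair_in_involution :: "('o \<Rightarrow> 'm) \<Rightarrow> 'm \<Rightarrow> 'm \<Rightarrow> bool" where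
  "twisted_modular_pair_in_involution \<theta> \<delta> \<sigma> \<longleftrightarrow>
     modular_pair \<delta> \<sigma> \<and>
     HAntipode H \<cdot> HAntipode H =
       (HMult H \<cdot> (HMult H \<star> Ident B (HObj H)) \<cdot> ((\<sigma> \<star> \<theta> (HObj H)) \<star> (HAntipode H \<cdot> \<sigma>))) \<cdot>
       (((\<delta> \<cdot> HAntipode H) \<star> Ident B (HObj H)) \<star> \<delta>) \<cdot>
       (HComult H \<star> Ident B (HObj H)) \<cdot> HComult H"

section \<open>The object \<open>CM(H, \<delta>, \<sigma>)\<close>\<close>

definition CM :: "nat \<Rightarrow> 'o" where
  "CM n = tensor_pow B (HObj H) n"

text \<open>
  \<open>CM_append \<sigma> n\<close> is \<open>id \<otimes> \<sigma>\<close> from \<open>CM n\<close> to \<open>CM (n + 1)\<close>. The innermost factor of \<open>CM (n + 1)\<close>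
  is \<open>HObj H \<boxtimes> \<I>\<close>, hence the right unit constraint.
\<close>

definition CM_append :: "'m \<Rightarrow> nat \<Rightarrow> 'm" where
  "CM_append \<sigma> n = whisker B (HObj H) n (inv_arrow B (RUnit B (HObj H)) \<cdot> \<sigma>)"

definition CM_coface :: "'m \<Rightarrow> nat \<Rightarrow> nat \<Rightarrow> 'm" where
  "CM_coface \<sigma> n i =
     (if i = 0 then
        (HUnit H \<star> Ident B (CM (n - 1))) \<cdot> inv_arrow B (LUnit B (CM (n - 1)))
      else if i < n then
        whisker B (HObj H) (i - 1)
          (Assoc B (HObj H) (HObj H) (CM (n - 1 - i)) \<cdot> (HComult H \<star> Ident B (CM (n - 1 - i))))
      else CM_append \<sigma> (n - 1))"

definition CM_codegeneracy :: "nat \<Rightarrow> nat \<Rightarrow> 'm" where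
  "CM_codegeneracy n j =
     whisker B (HObj H) j (LUnit B (CM (n - j)) \<cdot> (HCounit H \<star> Ident B (CM (n - j))))"

primrec left_diagonal_action :: "nat \<Rightarrow> 'm" where
  "left_diagonal_action 0 = HCounit H \<cdot> RUnit B (HObj H)"
| "left_diagonal_action (Suc n) =
     (HMult H \<star> left_diagonal_action n) \<cdot>
     middle_braid B (HObj H) (HObj H) (HObj H) (CM n) \<cdot>
     (HComult H \<star> Ident B (CM (Suc n)))"

definition twisted_antipode :: "'m \<Rightarrow> 'm" where
  "twisted_antipode \<delta> = LUnit B (HObj H) \<cdot> (\<delta> \<star> HAntipode H) \<cdot> HComult H"

definition CM_paracocyclic_operator :: "'m \<Rightarrow> 'm \<Rightarrow> nat \<Rightarrow> 'm" where
  "CM_paracocyclic_operator \<delta> \<sigma> n =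
     (if n = 0 then Ident B \<I>
      else left_diagonal_action n \<cdot> (twisted_antipode \<delta> \<star> CM_append \<sigma> (n - 1)))"

end

end

(*
  Write h.y for the diagonal action of H on a power of H, and S' for the twisted antipode. The map
  p_n(x_0, ..., x_n) = S'(x_0).(x_1, ..., x_n) is a split epimorphism, with t_n(x) = p_n(x, sigma).
  It satisfies p_n(h.x) = delta(h) p_n(x), and it intertwines t_n with the operator r_n that moves x_0
  to the end and replaces it by sigma * theta(x_0): this is where the involution condition enters, in
  the form S'(S'(h)) sigma = sigma theta(h). The power r_n^(n+1) is a full twist of n + 1 strands
  followed by the action of sigma. Hence t_n^(n+1) p_n = p_n r_n^(n+1) = p_n theta = theta p_n, so that
  t_n^(n+1) is the twist of H^n. By naturality, and since the twist of the unit object is the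
  identity, it acts trivially on arrows from or to the unit object.

  To compute in a category that is not strict, let arrows between tensor powers of H act on families
  of arrows with values in all powers of H. Coherence isomorphisms then act as the identity, and an
  equation between arrows becomes a rewriting problem for the resulting operators.
*)

theory Submission
  imports Defs
begin

section \<open>Composites without typing judgements\<close>

text \<open>The splitting of \<open>p_n\<close> inserts the unit as \<open>x_0\<close>, which works
  because \<open>S'\<close> fixes the unit. The rule \<open>p_n(h.x) = \<delta>(h) p_n(x)\<close>
  rests on \<open>S'(h_1) h_2 = \<delta>(h)\<close>; it removes the action of
  \<open>\<sigma>\<close> left over in \<open>r_n^(n+1)\<close>, since
  \<open>\<delta>(\<sigma>) = 1\<close>. The antipode occurs in \<open>p_n\<close> but not in
  \<open>r_n\<close>, so powers of \<open>r_n\<close> involve only braidings, twists and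
  \<open>\<sigma>\<close>. No formula for the inverse of \<open>t_n\<close> is needed:
  \<open>t_n^(n+1)\<close> is a twist, hence invertible, and so is \<open>t_n\<close>.

  The obstacle to rewriting operators is that every generator changes the number of factors.
  Families with a member in each power, tied together by the counit, always have enough factors to
  the right of any generator, so operators compose without side conditions. The unit provides enough
  families: appending units to an identity arrow yields one from which an arrow can be recovered
  from its operator. Hence the calculus is set up for an object with a point and a copoint that
  compose to the identity.\<close>

context category
begin

lemma hom_setD:
  assumes "f \<in> hom_set C X Y"
  shows "f \<in> Arr C" "Dom C f = X" "Cod C f = Y" "X \<in> Obj C" "Y \<in> Obj C"
  using assms Dom_in_Obj Cod_in_Obj by (auto simp: hom_set_def)

lemma Ident_simps [simp]:
  assumes "X \<in> Obj C"
  shows "Ident C X \<in> Arr C" "Dom C (Ident C X) = X" "Cod C (Ident C X) = X"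
  using hom_setD[OF Ident_in_hom[OF assms]] by auto

lemma Comp_simps [simp]:
  assumes "f \<in> Arr C" "g \<in> Arr C" "Cod C f = Dom C g"
  shows "g \<cdot> f \<in> Arr C" "Dom C (g \<cdot> f) = Dom C f" "Cod C (g \<cdot> f) = Cod C g"
  using Comp_in_hom[of f "Dom C f" "Cod C f" g "Cod C g"] assms
  by (auto simp: hom_set_def)

lemma Dom_Cod_Obj [simp]: "f \<in> Arr C \<Longrightarrow> Dom C f \<in> Obj C" "f \<in> Arr C \<Longrightarrow> Cod C f \<in> Obj C"
  by (auto intro: Dom_in_Obj Cod_in_Obj)

lemma Comp_Ident [simp]:
  assumes "f \<in> Arr C"
  shows "Cod C f = X \<Longrightarrow> Ident C X \<cdot> f = f" "Dom C f = X \<Longrightarrow> f \<cdot> Ident C X = f"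
  using Comp_Ident_left Comp_Ident_right assms by (auto simp: hom_set_def)

lemma Comp_assoc' [simp]:
  assumes "f \<in> Arr C" "g \<in> Arr C" "h \<in> Arr C" "Cod C f = Dom C g" "Cod C g = Dom C h"
  shows "(h \<cdot> g) \<cdot> f = h \<cdot> (g \<cdot> f)"
  using Comp_assoc[of f "Dom C f" "Cod C f" g "Cod C g" h "Cod C h"] assms
  by (auto simp: hom_set_def)

lemma inverse_arrows_unique:
  assumes "inverse_arrows C f g" "inverse_arrows C f h"
  shows "g = h"
proof -
  have *: "f \<in> Arr C" "g \<in> Arr C" "h \<in> Arr C" "Dom C g = Cod C f" "Dom C h = Cod C f"
    "Cod C g = Dom C f" "Cod C h = Dom C f" "g \<cdot> f = Ident C (Dom C f)" "f \<cdot> h = Ident C (Cod C f)"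
    using assms by (auto simp: inverse_arrows_def hom_set_def)
  then have "g \<cdot> (f \<cdot> h) = (g \<cdot> f) \<cdot> h"
    by (subst Comp_assoc') auto
  with * show ?thesis
    by simp
qed

lemma inv_arrow_eqI: "inverse_arrows C f g \<Longrightarrow> inv_arrow C f = g"
  unfolding inv_arrow_def using inverse_arrows_unique by blast

lemma inverse_arrows_inv_arrow: "iso_arrow C f \<Longrightarrow> inverse_arrows C f (inv_arrow C f)"
  using inv_arrow_eqI by (auto simp: iso_arrow_def)

lemma iso_arrow_Arr: "iso_arrow C f \<Longrightarrow> f \<in> Arr C"
  by (auto simp: iso_arrow_def inverse_arrows_def)

lemma inv_arrow_simps [simp]:
  assumes "iso_arrow C f"
  shows "inv_arrow C f \<in> Arr C" "Dom C (inv_arrow C f) = Cod C f" "Cod C (inv_arrow C f) = Dom C f"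
    "inv_arrow C f \<cdot> f = Ident C (Dom C f)" "f \<cdot> inv_arrow C f = Ident C (Cod C f)"
  using inverse_arrows_inv_arrow[OF assms] by (auto simp: inverse_arrows_def hom_set_def)

lemma inv_arrow_cancel [simp]:
  assumes "iso_arrow C f" "g \<in> Arr C"
  shows "Cod C g = Dom C f \<Longrightarrow> inv_arrow C f \<cdot> f \<cdot> g = g"
    "Cod C g = Cod C f \<Longrightarrow> f \<cdot> inv_arrow C f \<cdot> g = g"
  using assms iso_arrow_Arr[OF assms(1)]
  by (metis Comp_Ident(1) Comp_assoc' inv_arrow_simps)+

lemma iso_arrowI:
  assumes "f \<in> Arr C" "g \<in> Arr C" "Dom C g = Cod C f" "Cod C g = Dom C f"
    "g \<cdot> f = Ident C (Dom C f)" "f \<cdot> g = Ident C (Cod C f)"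
  shows "iso_arrow C f"
  using assms by (auto simp: iso_arrow_def inverse_arrows_def hom_set_def)

lemma iso_arrow_Ident [simp]: "X \<in> Obj C \<Longrightarrow> iso_arrow C (Ident C X)"
  by (rule iso_arrowI[where g = "Ident C X"]) auto

lemma iso_arrow_Comp:
  assumes "iso_arrow C f" "iso_arrow C g" "Cod C f = Dom C g"
  shows "iso_arrow C (g \<cdot> f)"
  using assms iso_arrow_Arr
  by (intro iso_arrowI[where g = "inv_arrow C f \<cdot> inv_arrow C g"]) auto

lemma iso_arrow_cancel_right:
  assumes "iso_arrow C f" "g \<in> Arr C" "h \<in> Arr C" "Dom C g = Cod C f" "Dom C h = Cod C f"
    "g \<cdot> f = h \<cdot> f"
  shows "g = h"
proof -
  note f = iso_arrow_Arr[OF assms(1)]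
  have "(g \<cdot> f) \<cdot> inv_arrow C f = g" "(h \<cdot> f) \<cdot> inv_arrow C f = h"
    using assms(1-5) f by simp_all
  with assms(6) show ?thesis
    by metis
qed

lemma iso_arrow_cancel_left:
  assumes "iso_arrow C f" "g \<in> Arr C" "h \<in> Arr C" "Cod C g = Dom C f" "Cod C h = Dom C f"
    "f \<cdot> g = f \<cdot> h"
  shows "g = h"
  using assms by (metis inv_arrow_cancel(1))

end

section \<open>Monoidal calculus with explicit constraints\<close>

context monoidal_category
begin

abbreviation "\<i> \<equiv> Ident B"

lemma monoidal_Obj [simp]: "X \<in> Obj B \<Longrightarrow> Y \<in> Obj B \<Longrightarrow> X \<boxtimes> Y \<in> Obj B" "\<I> \<in> Obj B"
  by (auto intro: TensorObj_closed TensorUnit_closed)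

lemma TensorArr_simps [simp]:
  assumes "f \<in> Arr B" "g \<in> Arr B"
  shows "f \<star> g \<in> Arr B" "Dom B (f \<star> g) = Dom B f \<boxtimes> Dom B g" "Cod B (f \<star> g) = Cod B f \<boxtimes> Cod B g"
  using TensorArr_in_hom[of f "Dom B f" "Cod B f" g "Dom B g" "Cod B g"] assms
  by (auto simp: hom_set_def)

lemma TensorArr_merge [simp]:
  assumes "f \<in> Arr B" "g \<in> Arr B" "f' \<in> Arr B" "g' \<in> Arr B"
    "Cod B f = Dom B g" "Cod B f' = Dom B g'"
  shows "(g \<star> g') \<cdot> (f \<star> f') = (g \<cdot> f) \<star> (g' \<cdot> f')"
  using TensorArr_Comp[of f "Dom B f" "Cod B f" g "Cod B g" f' "Dom B f'" "Cod B f'" g' "Cod B g'"]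
    assms by (auto simp: hom_set_def)

lemma TensorArr_merge_assoc [simp]:
  assumes "f \<in> Arr B" "g \<in> Arr B" "f' \<in> Arr B" "g' \<in> Arr B"
    "Cod B f = Dom B g" "Cod B f' = Dom B g'" "h \<in> Arr B" "Cod B h = Dom B f \<boxtimes> Dom B f'"
  shows "(g \<star> g') \<cdot> (f \<star> f') \<cdot> h = ((g \<cdot> f) \<star> (g' \<cdot> f')) \<cdot> h"
  using assms by (subst Comp_assoc'[symmetric]) auto

lemma TensorArr_Ident' [simp]: "\<lbrakk>X \<in> Obj B; Y \<in> Obj B\<rbrakk> \<Longrightarrow> \<i> X \<star> \<i> Y = \<i> (X \<boxtimes> Y)"
  by (rule TensorArr_Ident)

lemma Assoc_simps [simp]:
  assumes "X \<in> Obj B" "Y \<in> Obj B" "Z \<in> Obj B"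
  shows "Assoc B X Y Z \<in> Arr B" "Dom B (Assoc B X Y Z) = (X \<boxtimes> Y) \<boxtimes> Z"
    "Cod B (Assoc B X Y Z) = X \<boxtimes> (Y \<boxtimes> Z)" "iso_arrow B (Assoc B X Y Z)"
  using hom_setD[OF Assoc_in_hom[OF assms]] Assoc_iso[OF assms] by auto

lemma LUnit_simps [simp]:
  assumes "X \<in> Obj B"
  shows "LUnit B X \<in> Arr B" "Dom B (LUnit B X) = \<I> \<boxtimes> X" "Cod B (LUnit B X) = X"
    "iso_arrow B (LUnit B X)"
  using hom_setD[OF LUnit_in_hom[OF assms]] LUnit_iso[OF assms] by auto

lemma RUnit_simps [simp]:
  assumes "X \<in> Obj B"
  shows "RUnit B X \<in> Arr B" "Dom B (RUnit B X) = X \<boxtimes> \<I>" "Cod B (RUnit B X) = X"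
    "iso_arrow B (RUnit B X)"
  using hom_setD[OF RUnit_in_hom[OF assms]] RUnit_iso[OF assms] by auto

lemma Assoc_nat:
  assumes "f \<in> Arr B" "g \<in> Arr B" "h \<in> Arr B" "Cod B f = X" "Cod B g = Y" "Cod B h = Z"
  shows "Assoc B X Y Z \<cdot> ((f \<star> g) \<star> h) = (f \<star> (g \<star> h)) \<cdot> Assoc B (Dom B f) (Dom B g) (Dom B h)"
  using Assoc_natural[of f "Dom B f" X g "Dom B g" Y h "Dom B h" Z] assms by (auto simp: hom_set_def)

lemma LUnit_nat:
  "f \<in> Arr B \<Longrightarrow> Cod B f = Y \<Longrightarrow> LUnit B Y \<cdot> (\<i> \<I> \<star> f) = f \<cdot> LUnit B (Dom B f)"
  using LUnit_natural[of f "Dom B f" Y] by (auto simp: hom_set_def)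

lemma RUnit_nat:
  "f \<in> Arr B \<Longrightarrow> Cod B f = Y \<Longrightarrow> RUnit B Y \<cdot> (f \<star> \<i> \<I>) = f \<cdot> RUnit B (Dom B f)"
  using RUnit_natural[of f "Dom B f" Y] by (auto simp: hom_set_def)

lemma iso_arrow_TensorArr:
  assumes "iso_arrow B f" "iso_arrow B g"
  shows "iso_arrow B (f \<star> g)"
  using assms iso_arrow_Arr
  by (intro iso_arrowI[where g = "inv_arrow B f \<star> inv_arrow B g"]) auto

lemma unit_tensor_faithful:
  assumes "f \<in> Arr B" "g \<in> Arr B" "Dom B f = Dom B g" "Cod B f = Cod B g"
    "\<i> \<I> \<star> f = \<i> \<I> \<star> g"
  shows "f = g"
  using assms LUnit_nat[of f] LUnit_nat[of g]
  by (intro iso_arrow_cancel_right[of "LUnit B (Dom B f)" f g]) auto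

lemma tensor_unit_faithful:
  assumes "f \<in> Arr B" "g \<in> Arr B" "Dom B f = Dom B g" "Cod B f = Cod B g"
    "f \<star> \<i> \<I> = g \<star> \<i> \<I>"
  shows "f = g"
  using assms RUnit_nat[of f] RUnit_nat[of g]
  by (intro iso_arrow_cancel_right[of "RUnit B (Dom B f)" f g]) auto

text \<open>
  Kelly's argument: after tensoring with the unit on the left, both sides agree by the pentagon
  and two instances of the triangle.
\<close>

lemma LUnit_TensorObj:
  assumes X: "X \<in> Obj B" and Y: "Y \<in> Obj B"
  shows "LUnit B (X \<boxtimes> Y) \<cdot> Assoc B \<I> X Y = LUnit B X \<star> \<i> Y"
proof -
  let ?a = "Assoc B \<I> (\<I> \<boxtimes> X) Y \<cdot> (Assoc B \<I> \<I> X \<star> \<i> Y)"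
  have "(\<i> \<I> \<star> (LUnit B (X \<boxtimes> Y) \<cdot> Assoc B \<I> X Y)) \<cdot> ?a
      = (\<i> \<I> \<star> LUnit B (X \<boxtimes> Y)) \<cdot> (\<i> \<I> \<star> Assoc B \<I> X Y) \<cdot> ?a"
    using X Y by simp
  also have "\<dots> = (\<i> \<I> \<star> LUnit B (X \<boxtimes> Y)) \<cdot> Assoc B \<I> \<I> (X \<boxtimes> Y) \<cdot> Assoc B (\<I> \<boxtimes> \<I>) X Y"
    using pentagon[of \<I> \<I> X Y] X Y by simp
  also have "\<dots> = ((\<i> \<I> \<star> LUnit B (X \<boxtimes> Y)) \<cdot> Assoc B \<I> \<I> (X \<boxtimes> Y)) \<cdot> Assoc B (\<I> \<boxtimes> \<I>) X Y"
    using X Y by simp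
  also have "\<dots> = (RUnit B \<I> \<star> (\<i> X \<star> \<i> Y)) \<cdot> Assoc B (\<I> \<boxtimes> \<I>) X Y"
    using triangle[of \<I> "X \<boxtimes> Y"] X Y by simp
  also have "\<dots> = Assoc B \<I> X Y \<cdot> ((RUnit B \<I> \<star> \<i> X) \<star> \<i> Y)"
    using X Y by (subst Assoc_nat) auto
  also have "\<dots> = Assoc B \<I> X Y \<cdot> (((\<i> \<I> \<star> LUnit B X) \<star> \<i> Y) \<cdot> (Assoc B \<I> \<I> X \<star> \<i> Y))"
    using triangle[of \<I> X] X Y by simp
  also have "\<dots> = (Assoc B \<I> X Y \<cdot> ((\<i> \<I> \<star> LUnit B X) \<star> \<i> Y)) \<cdot> (Assoc B \<I> \<I> X \<star> \<i> Y)"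
    using X Y by simp
  also have "\<dots> = (\<i> \<I> \<star> (LUnit B X \<star> \<i> Y)) \<cdot> ?a"
    using X Y by (subst Assoc_nat) auto
  finally have "(\<i> \<I> \<star> (LUnit B (X \<boxtimes> Y) \<cdot> Assoc B \<I> X Y)) \<cdot> ?a = (\<i> \<I> \<star> (LUnit B X \<star> \<i> Y)) \<cdot> ?a" .
  moreover have "iso_arrow B ?a"
    using X Y by (intro iso_arrow_Comp iso_arrow_TensorArr) auto
  ultimately have "\<i> \<I> \<star> (LUnit B (X \<boxtimes> Y) \<cdot> Assoc B \<I> X Y) = \<i> \<I> \<star> (LUnit B X \<star> \<i> Y)"
    by (rule iso_arrow_cancel_right[rotated 5]) (use X Y in simp_all)
  then show ?thesis
    by (rule unit_tensor_faithful[rotated 4]) (use X Y in simp_all)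
qed

end

section \<open>Words in a pointed object and operators on families of arrows\<close>

text \<open>Bracketed words in one object and the unit. \<open>One\<close> is a letter because the
  powers in \<open>CM\<close> end in the unit object; their shape is
  \<open>comb n One\<close>.\<close>

datatype tree = Leaf | One | Node tree tree

primrec len :: "tree \<Rightarrow> nat" where
  "len Leaf = 1"
| "len One = 0"
| "len (Node a b) = len a + len b"

primrec comb :: "nat \<Rightarrow> tree \<Rightarrow> tree" where
  "comb 0 w = w"
| "comb (Suc n) w = Node Leaf (comb n w)"

lemma len_comb [simp]: "len (comb n w) = n + len w"
  by (induction n) auto

text \<open>\<open>e\<close> truncates families and \<open>u\<close> extends them;
  \<open>e \<cdot> u = \<i> \<I>\<close> makes the operators below faithful. For \<open>H\<close>
  these are the counit and the unit.\<close>

locale pointed_object = braided_category B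
  for B :: "('o, 'm, 'z) braided_category_scheme" (structure) +
  fixes A :: 'o and e u :: 'm
  assumes A_Obj [simp]: "A \<in> Obj B"
    and e_in_hom: "e \<in> hom_set B A \<I>"
    and u_in_hom: "u \<in> hom_set B \<I> A"
    and e_u [simp]: "e \<cdot> u = \<i> \<I>"
begin

lemma e_u_simps [simp]:
  "e \<in> Arr B" "Dom B e = A" "Cod B e = \<I>" "u \<in> Arr B" "Dom B u = \<I>" "Cod B u = A"
  using e_in_hom u_in_hom by (auto simp: hom_set_def)

abbreviation wh :: "nat \<Rightarrow> 'm \<Rightarrow> 'm" where "wh \<equiv> whisker B A"

text \<open>The tail \<open>Z\<close> stays a parameter: naturality in it expresses that an arrow
  leaves the factors to its right alone.\<close>

primrec tp :: "nat \<Rightarrow> 'o \<Rightarrow> 'o" where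
  "tp 0 Z = Z"
| "tp (Suc n) Z = A \<boxtimes> tp n Z"

lemma tp_Obj [simp]: "Z \<in> Obj B \<Longrightarrow> tp n Z \<in> Obj B"
  by (induction n) auto

lemma tp_add [simp]: "tp (m + n) Z = tp m (tp n Z)"
  by (induction m) auto

lemma wh_add [simp]: "wh (m + n) f = wh m (wh n f)"
  by (induction m) auto

lemma wh_simps [simp]:
  assumes "f \<in> Arr B"
  shows "wh n f \<in> Arr B" "Dom B (wh n f) = tp n (Dom B f)" "Cod B (wh n f) = tp n (Cod B f)"
  using assms by (induction n) auto

lemma wh_merge [simp]:
  assumes "f \<in> Arr B" "g \<in> Arr B" "Cod B f = Dom B g"
  shows "wh n g \<cdot> wh n f = wh n (g \<cdot> f)"
  using assms by (induction n) auto

lemma wh_merge_assoc [simp]: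
  assumes "f \<in> Arr B" "g \<in> Arr B" "h \<in> Arr B" "Cod B f = Dom B g" "Cod B h = tp n (Dom B f)"
  shows "wh n g \<cdot> wh n f \<cdot> h = wh n (g \<cdot> f) \<cdot> h"
  using assms by (subst Comp_assoc'[symmetric]) auto

lemma wh_Ident [simp]: "X \<in> Obj B \<Longrightarrow> wh n (\<i> X) = \<i> (tp n X)"
  by (induction n) auto

primrec eps :: "nat \<Rightarrow> 'm" where
  "eps 0 = \<i> \<I>"
| "eps (Suc j) = LUnit B \<I> \<cdot> (e \<star> eps j)"

primrec unt :: "nat \<Rightarrow> 'm" where
  "unt 0 = \<i> \<I>"
| "unt (Suc j) = (u \<star> unt j) \<cdot> inv_arrow B (LUnit B \<I>)"

lemma eps_simps [simp]: "eps j \<in> Arr B" "Dom B (eps j) = tp j \<I>" "Cod B (eps j) = \<I>"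
  by (induction j) auto

lemma unt_simps [simp]: "unt j \<in> Arr B" "Cod B (unt j) = tp j \<I>" "Dom B (unt j) = \<I>"
  by (induction j) auto

lemma eps_add: "eps (a + b) = eps a \<cdot> wh a (eps b)"
  by (induction a) auto

lemma unt_add: "unt (a + b) = wh a (unt b) \<cdot> unt a"
  by (induction a) auto

lemma eps_unt: "eps j \<cdot> unt j = \<i> \<I>"
  by (induction j) auto

primrec ob :: "tree \<Rightarrow> 'o" where
  "ob Leaf = A"
| "ob One = \<I>"
| "ob (Node a b) = ob a \<boxtimes> ob b"

lemma ob_Obj [simp]: "ob w \<in> Obj B"
  by (induction w) auto

lemma ob_comb [simp]: "ob (comb n w) = tp n (ob w)"
  by (induction n) auto

text \<open>The canonical isomorphism from \<open>ob w \<boxtimes> Z\<close> to \<open>A \<boxtimes> (\<dots> \<boxtimes> (A \<boxtimes> Z))\<close>.\<close>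

primrec nrm :: "tree \<Rightarrow> 'o \<Rightarrow> 'm" where
  "nrm Leaf Z = \<i> (A \<boxtimes> Z)"
| "nrm One Z = LUnit B Z"
| "nrm (Node a b) Z = nrm a (tp (len b) Z) \<cdot> (\<i> (ob a) \<star> nrm b Z) \<cdot> Assoc B (ob a) (ob b) Z"

lemma nrm_simps [simp]:
  assumes "Z \<in> Obj B"
  shows "nrm w Z \<in> Arr B" "Dom B (nrm w Z) = ob w \<boxtimes> Z" "Cod B (nrm w Z) = tp (len w) Z"
    "iso_arrow B (nrm w Z)"
  using assms
proof (induction w arbitrary: Z)
  case (Node a b)
  {
    case 1 then show ?case using Node by simp
  next
    case 2 then show ?case using Node by simp
  next
    case 3 then show ?case using Node by simp
  next
    case 4 then show ?case using Node
      by (auto intro!: iso_arrow_Comp iso_arrow_TensorArr)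
  }
qed auto

lemma nrm_nat:
  assumes "h \<in> Arr B" "Cod B h = Z"
  shows "nrm w Z \<cdot> (\<i> (ob w) \<star> h) = wh (len w) h \<cdot> nrm w (Dom B h)"
  using assms
proof (induction w arbitrary: Z h)
  case (Node a b)
  note h = Node.prems(1)
  have Z: "Z \<in> Obj B"
    using Node.prems by auto
  have "nrm (Node a b) Z \<cdot> (\<i> (ob (Node a b)) \<star> h)
      = nrm a (tp (len b) Z) \<cdot> (\<i> (ob a) \<star> nrm b Z) \<cdot>
          (Assoc B (ob a) (ob b) Z \<cdot> ((\<i> (ob a) \<star> \<i> (ob b)) \<star> h))"
    using h Node.prems Z by simp
  also have "\<dots> = nrm a (tp (len b) Z) \<cdot>
      (\<i> (ob a) \<star> (nrm b Z \<cdot> (\<i> (ob b) \<star> h))) \<cdot> Assoc B (ob a) (ob b) (Dom B h)"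
    using h Node.prems Z by (subst Assoc_nat) auto
  also have "\<dots> = nrm a (tp (len b) Z) \<cdot>
      (\<i> (ob a) \<star> (wh (len b) h \<cdot> nrm b (Dom B h))) \<cdot> Assoc B (ob a) (ob b) (Dom B h)"
    using Node by simp
  also have "\<dots> = (nrm a (tp (len b) Z) \<cdot> (\<i> (ob a) \<star> wh (len b) h)) \<cdot>
      (\<i> (ob a) \<star> nrm b (Dom B h)) \<cdot> Assoc B (ob a) (ob b) (Dom B h)"
    using h Node.prems Z by simp
  also have "\<dots> = (wh (len a) (wh (len b) h) \<cdot> nrm a (tp (len b) (Dom B h))) \<cdot>
      (\<i> (ob a) \<star> nrm b (Dom B h)) \<cdot> Assoc B (ob a) (ob b) (Dom B h)"
    using h Node.prems Z by (subst Node.IH(1)) auto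
  also have "\<dots> = wh (len (Node a b)) h \<cdot> nrm (Node a b) (Dom B h)"
    using h Z by simp
  finally show ?case .
qed (auto simp: LUnit_nat)

section \<open>Arrows between words in normal form, with a tail\<close>

definition typed :: "tree \<Rightarrow> tree \<Rightarrow> 'm \<Rightarrow> bool" where
  "typed w w' f \<longleftrightarrow> f \<in> Arr B \<and> Dom B f = ob w \<and> Cod B f = ob w'"

lemma typed_Comp [simp]: "typed w w' f \<Longrightarrow> typed w' w'' g \<Longrightarrow> typed w w'' (g \<cdot> f)"
  by (auto simp: typed_def)

lemma typed_TensorArr [simp]:
  "typed a a' f \<Longrightarrow> typed b b' g \<Longrightarrow> typed (Node a b) (Node a' b') (f \<star> g)"
  by (auto simp: typed_def)

lemma typed_Ident [simp]: "X = ob w \<Longrightarrow> typed w w (\<i> X)"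
  by (auto simp: typed_def)

lemma typed_coherence [simp]:
  "\<lbrakk>X = ob a; Y = ob b; Z = ob c\<rbrakk> \<Longrightarrow> typed (Node (Node a b) c) (Node a (Node b c)) (Assoc B X Y Z)"
  "X = ob a \<Longrightarrow> typed (Node One a) a (LUnit B X)"
  "X = ob a \<Longrightarrow> typed (Node a One) a (RUnit B X)"
  by (auto simp: typed_def)

lemma typedD [simp]: "typed w w' f \<Longrightarrow> f \<in> Arr B" "typed w w' f \<Longrightarrow> Dom B f = ob w"
  "typed w w' f \<Longrightarrow> Cod B f = ob w'"
  by (auto simp: typed_def)

text \<open>Conjugation into right-bracketed form: source and target depend only on the lengths of
  the words, and constraints become identities.\<close>

definition pad :: "tree \<Rightarrow> tree \<Rightarrow> 'm \<Rightarrow> 'o \<Rightarrow> 'm" where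
  "pad w w' f Z = nrm w' Z \<cdot> (f \<star> \<i> Z) \<cdot> inv_arrow B (nrm w Z)"

lemma pad_simps [simp]:
  assumes "typed w w' f" "Z \<in> Obj B"
  shows "pad w w' f Z \<in> Arr B" "Dom B (pad w w' f Z) = tp (len w) Z"
    "Cod B (pad w w' f Z) = tp (len w') Z"
  using assms by (auto simp: pad_def)

lemma pad_nrm:
  assumes "typed w w' f" "Z \<in> Obj B"
  shows "pad w w' f Z \<cdot> nrm w Z = nrm w' Z \<cdot> (f \<star> \<i> Z)"
  using assms by (auto simp: pad_def)

lemma pad_eqI:
  assumes "typed w w' f" "Z \<in> Obj B" "g \<in> Arr B" "Dom B g = tp (len w) Z"
    "g \<cdot> nrm w Z = nrm w' Z \<cdot> (f \<star> \<i> Z)"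
  shows "pad w w' f Z = g"
proof -
  have "pad w w' f Z = (g \<cdot> nrm w Z) \<cdot> inv_arrow B (nrm w Z)"
    unfolding assms(5) using assms(1,2) by (simp add: pad_def)
  also have "\<dots> = g"
    using assms(1-4) by simp
  finally show ?thesis .
qed

text \<open>Interchange of \<open>f\<close> with an arrow of the tail.\<close>

lemma pad_nat:
  assumes f: "typed w w' f" and h: "h \<in> Arr B" "Cod B h = Z"
  shows "pad w w' f Z \<cdot> wh (len w) h = wh (len w') h \<cdot> pad w w' f (Dom B h)"
proof (rule iso_arrow_cancel_right[of "nrm w (Dom B h)"])
  have Z: "Z \<in> Obj B"
    using h by auto
  have "(pad w w' f Z \<cdot> wh (len w) h) \<cdot> nrm w (Dom B h)
      = pad w w' f Z \<cdot> nrm w Z \<cdot> (\<i> (ob w) \<star> h)"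
    using f h Z by (simp add: nrm_nat)
  also have "\<dots> = (pad w w' f Z \<cdot> nrm w Z) \<cdot> (\<i> (ob w) \<star> h)"
    using f h Z by simp
  also have "\<dots> = nrm w' Z \<cdot> (f \<star> \<i> Z) \<cdot> (\<i> (ob w) \<star> h)"
    unfolding pad_nrm[OF f Z] using f h Z by simp
  also have "\<dots> = (nrm w' Z \<cdot> (\<i> (ob w') \<star> h)) \<cdot> (f \<star> \<i> (Dom B h))"
    using f h Z by simp
  also have "\<dots> = wh (len w') h \<cdot> nrm w' (Dom B h) \<cdot> (f \<star> \<i> (Dom B h))"
    using f h Z by (subst nrm_nat) auto
  also have "\<dots> = wh (len w') h \<cdot> pad w w' f (Dom B h) \<cdot> nrm w (Dom B h)"
    using f h by (simp add: pad_nrm)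
  also have "\<dots> = (wh (len w') h \<cdot> pad w w' f (Dom B h)) \<cdot> nrm w (Dom B h)"
    using f h by simp
  finally show "(pad w w' f Z \<cdot> wh (len w) h) \<cdot> nrm w (Dom B h)
    = (wh (len w') h \<cdot> pad w w' f (Dom B h)) \<cdot> nrm w (Dom B h)" .
qed (use assms in auto)

lemma pad_Ident: "Z \<in> Obj B \<Longrightarrow> pad w w (\<i> (ob w)) Z = \<i> (tp (len w) Z)"
  by (rule pad_eqI) auto

lemma pad_Comp:
  assumes "typed w w' f" "typed w' w'' g" "Z \<in> Obj B"
  shows "pad w w'' (g \<cdot> f) Z = pad w' w'' g Z \<cdot> pad w w' f Z"
  using assms by (auto simp: pad_def)

lemma pad_TensorArr:
  assumes f: "typed a a' f" and g: "typed b b' g" and Z: "Z \<in> Obj B"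
  shows "pad (Node a b) (Node a' b') (f \<star> g) Z
    = wh (len a') (pad b b' g Z) \<cdot> pad a a' f (tp (len b) Z)"
proof (rule pad_eqI)
  let ?as = "Assoc B (ob a) (ob b) Z"
  have "(wh (len a') (pad b b' g Z) \<cdot> pad a a' f (tp (len b) Z)) \<cdot> nrm (Node a b) Z
      = wh (len a') (pad b b' g Z) \<cdot> (pad a a' f (tp (len b) Z) \<cdot> nrm a (tp (len b) Z)) \<cdot>
          (\<i> (ob a) \<star> nrm b Z) \<cdot> ?as"
    using assms by simp
  also have "\<dots> = (wh (len a') (pad b b' g Z) \<cdot> nrm a' (tp (len b) Z)) \<cdot> (f \<star> nrm b Z) \<cdot> ?as"
    using assms by (subst pad_nrm) auto
  also have "\<dots> = (nrm a' (tp (len b') Z) \<cdot> (\<i> (ob a') \<star> pad b b' g Z)) \<cdot> (f \<star> nrm b Z) \<cdot> ?as"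
    using assms by (subst nrm_nat) auto
  also have "\<dots> = nrm a' (tp (len b') Z) \<cdot> (f \<star> (pad b b' g Z \<cdot> nrm b Z)) \<cdot> ?as"
    using assms by simp
  also have "\<dots> = nrm a' (tp (len b') Z) \<cdot> (\<i> (ob a') \<star> nrm b' Z) \<cdot> ((f \<star> (g \<star> \<i> Z)) \<cdot> ?as)"
    using assms by (simp add: pad_nrm)
  also have "\<dots> = nrm a' (tp (len b') Z) \<cdot> (\<i> (ob a') \<star> nrm b' Z) \<cdot>
      (Assoc B (ob a') (ob b') Z \<cdot> ((f \<star> g) \<star> \<i> Z))"
    using assms by (subst Assoc_nat) auto
  also have "\<dots> = nrm (Node a' b') Z \<cdot> ((f \<star> g) \<star> \<i> Z)"
    using assms by simp
  finally show "(wh (len a') (pad b b' g Z) \<cdot> pad a a' f (tp (len b) Z)) \<cdot> nrm (Node a b) Z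
    = nrm (Node a' b') Z \<cdot> ((f \<star> g) \<star> \<i> Z)" .
qed (use assms in auto)

text \<open>The normalisations of the two bracketings agree by the pentagon.\<close>

lemma pad_Assoc:
  assumes "Z \<in> Obj B"
  shows "pad (Node (Node a b) c) (Node a (Node b c)) (Assoc B (ob a) (ob b) (ob c)) Z
    = \<i> (tp (len a + len b + len c) Z)"
proof (rule pad_eqI)
  let ?c = "tp (len c) Z" and ?bc = "tp (len b) (tp (len c) Z)"
  have "nrm (Node a (Node b c)) Z \<cdot> (Assoc B (ob a) (ob b) (ob c) \<star> \<i> Z)
     = nrm a ?bc \<cdot> (\<i> (ob a) \<star> (nrm b ?c \<cdot> (\<i> (ob b) \<star> nrm c Z))) \<cdot>
      ((\<i> (ob a) \<star> Assoc B (ob b) (ob c) Z) \<cdot> Assoc B (ob a) (ob b \<boxtimes> ob c) Z \<cdot>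
        (Assoc B (ob a) (ob b) (ob c) \<star> \<i> Z))"
    using assms by simp
  also have "\<dots> = nrm a ?bc \<cdot> (\<i> (ob a) \<star> nrm b ?c) \<cdot>
      ((\<i> (ob a) \<star> (\<i> (ob b) \<star> nrm c Z)) \<cdot> Assoc B (ob a) (ob b) (ob c \<boxtimes> Z)) \<cdot>
        Assoc B (ob a \<boxtimes> ob b) (ob c) Z"
    using assms by (subst pentagon) auto
  also have "\<dots> = nrm a ?bc \<cdot> (\<i> (ob a) \<star> nrm b ?c) \<cdot>
      (Assoc B (ob a) (ob b) ?c \<cdot> ((\<i> (ob a) \<star> \<i> (ob b)) \<star> nrm c Z)) \<cdot>
        Assoc B (ob a \<boxtimes> ob b) (ob c) Z"
    using assms by (subst Assoc_nat) (auto simp del: TensorArr_Ident')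
  also have "\<dots> = nrm (Node (Node a b) c) Z"
    using assms by simp
  finally show "\<i> (tp (len a + len b + len c) Z) \<cdot> nrm (Node (Node a b) c) Z
      = nrm (Node a (Node b c)) Z \<cdot> (Assoc B (ob a) (ob b) (ob c) \<star> \<i> Z)"
    using assms by simp
qed (use assms in auto)

lemma pad_LUnit:
  assumes "Z \<in> Obj B"
  shows "pad (Node One a) a (LUnit B (ob a)) Z = \<i> (tp (len a) Z)"
proof (rule pad_eqI)
  have "nrm a Z \<cdot> (LUnit B (ob a) \<star> \<i> Z)
      = (nrm a Z \<cdot> LUnit B (ob a \<boxtimes> Z)) \<cdot> Assoc B \<I> (ob a) Z"
    using assms by (simp add: LUnit_TensorObj)
  also have "nrm a Z \<cdot> LUnit B (ob a \<boxtimes> Z) = LUnit B (tp (len a) Z) \<cdot> (\<i> \<I> \<star> nrm a Z)"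
    using assms LUnit_nat[of "nrm a Z" "tp (len a) Z"] by simp
  also have "\<dots> \<cdot> Assoc B \<I> (ob a) Z = nrm (Node One a) Z"
    using assms by simp
  finally show "\<i> (tp (len a) Z) \<cdot> nrm (Node One a) Z = nrm a Z \<cdot> (LUnit B (ob a) \<star> \<i> Z)"
    using assms by simp
qed (use assms in auto)

lemma pad_RUnit:
  assumes "Z \<in> Obj B"
  shows "pad (Node a One) a (RUnit B (ob a)) Z = \<i> (tp (len a) Z)"
proof (rule pad_eqI)
  show "\<i> (tp (len a) Z) \<cdot> nrm (Node a One) Z = nrm a Z \<cdot> (RUnit B (ob a) \<star> \<i> Z)"
    using assms triangle[of "ob a" Z] by simp
qed (use assms in auto)

text \<open>Conjugation by isomorphisms loses nothing, and neither does tensoring with the unit, so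
  the tail \<open>\<I>\<close> suffices.\<close>

lemma pad_faithful:
  assumes "typed w w' f" "typed w w' g" "pad w w' f \<I> = pad w w' g \<I>"
  shows "f = g"
proof -
  have "nrm w' \<I> \<cdot> (f \<star> \<i> \<I>) = nrm w' \<I> \<cdot> (g \<star> \<i> \<I>)"
    using assms pad_nrm[of w w' f \<I>] pad_nrm[of w w' g \<I>] by simp
  then have "f \<star> \<i> \<I> = g \<star> \<i> \<I>"
    by (rule iso_arrow_cancel_left[rotated 5]) (use assms in auto)
  then show ?thesis
    by (rule tensor_unit_faithful[rotated 4]) (use assms in auto)
qed

subsection \<open>Operators\<close>

text \<open>
  A family of arrows \<open>X \<rightarrow> A\<^sup>k\<close>, one for each \<open>k\<close>, compatible with truncation of the last factors by
  the counit. An arrow \<open>f\<close> between words in \<open>A\<close> acts on such families at every position, with no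
  condition on the number of factors, and coherence isomorphisms act trivially.
\<close>

definition fam :: "(nat \<Rightarrow> 'm) \<Rightarrow> bool" where
  "fam x \<longleftrightarrow> (\<forall>k. x k \<in> Arr B \<and> Dom B (x k) = Dom B (x 0) \<and> Cod B (x k) = tp k \<I>) \<and>
     (\<forall>k j. wh k (eps j) \<cdot> x (k + j) = x k)"

lemma fam_simps [simp]:
  assumes "fam x"
  shows "x k \<in> Arr B" "Cod B (x k) = tp k \<I>" "wh k (eps j) \<cdot> x (k + j) = x k"
  using assms by (auto simp: fam_def)

lemma fam_Dom: "fam x \<Longrightarrow> Dom B (x k) = Dom B (x 0)"
  unfolding fam_def by blast

lemma famI:
  assumes "\<And>k. x k \<in> Arr B" "\<And>k. Dom B (x k) = X" "\<And>k. Cod B (x k) = tp k \<I>"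
    "\<And>k j. wh k (eps j) \<cdot> x (k + j) = x k"
  shows "fam x"
  unfolding fam_def using assms by metis

text \<open>Early members are truncations of later ones, so \<open>N\<close> may be chosen so large
  that the operators involved act without truncation.\<close>

lemma fam_eqI:
  assumes "fam x" "fam y" "\<And>l. x (N + l) = y (N + l)"
  shows "x = y"
proof
  fix k
  have "x k = wh k (eps N) \<cdot> x (N + k)" "y k = wh k (eps N) \<cdot> y (N + k)"
    using assms(1,2) fam_simps(3)[of _ k N] by (simp_all only: add.commute)
  then show "x k = y k"
    using assms(3) by metis
qed

text \<open>Member \<open>k\<close> is computed with \<open>k\<close> spare factors behind
  \<open>f\<close>, after which the \<open>i + len w'\<close> surplus factors are truncated.
  Arguments that are not families are returned unchanged, which frees laws such as
  \<open>op_Comp\<close> from that hypothesis.\<close>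

definition op :: "tree \<Rightarrow> tree \<Rightarrow> 'm \<Rightarrow> nat \<Rightarrow> (nat \<Rightarrow> 'm) \<Rightarrow> nat \<Rightarrow> 'm" where
  "op w w' f i x = (if fam x then
     (\<lambda>k. wh k (eps (i + len w')) \<cdot> wh i (pad w w' f (tp k \<I>)) \<cdot> x (i + len w + k)) else x)"

lemma op_not_fam: "\<not> fam x \<Longrightarrow> op w w' f i x = x"
  by (auto simp: op_def)

lemma tp_tp: "tp m (tp n Z) = tp n (tp m Z)"
  by (metis add.commute tp_add)

text \<open>A truncation of \<open>l'\<close> additional spare factors slides past \<open>f\<close>
  by \<open>pad_nat\<close> and is absorbed by the family.\<close>

lemma op_extend:
  assumes x: "fam x" and f: "typed w w' f" and k: "k + r = i + len w' + l"
  shows "wh k (eps (r + l')) \<cdot> wh i (pad w w' f (tp (l + l') \<I>)) \<cdot> x (i + len w + (l + l'))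
    = wh k (eps r) \<cdot> wh i (pad w w' f (tp l \<I>)) \<cdot> x (i + len w + l)"
proof -
  have tpk: "tp k (tp r Z) = tp i (tp (len w') (tp l Z))" for Z
    by (metis k tp_add)
  have whk: "wh k (wh r h) = wh i (wh (len w') (wh l h))" for h
    by (metis k wh_add)
  have "wh k (eps (r + l')) \<cdot> wh i (pad w w' f (tp (l + l') \<I>)) \<cdot> x (i + len w + (l + l'))
     = wh k (eps r) \<cdot> (wh k (wh r (eps l')) \<cdot> wh i (pad w w' f (tp l (tp l' \<I>)))) \<cdot> x (i + len w + (l + l'))"
    using x f by (simp add: eps_add tpk del: wh_merge_assoc wh_merge add: wh_merge[symmetric])
  also have "wh k (wh r (eps l')) \<cdot> wh i (pad w w' f (tp l (tp l' \<I>)))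
      = wh i (wh (len w') (wh l (eps l')) \<cdot> pad w w' f (tp l (tp l' \<I>)))"
    using x f by (simp add: whk)
  also have "\<dots> = wh i (pad w w' f (tp l \<I>) \<cdot> wh (len w) (wh l (eps l')))"
    using f pad_nat[of w w' f "wh l (eps l')" "tp l \<I>"] by simp
  also have "wh k (eps r) \<cdot> \<dots> \<cdot> x (i + len w + (l + l'))
     = wh k (eps r) \<cdot> wh i (pad w w' f (tp l \<I>)) \<cdot> (wh (i + len w + l) (eps l') \<cdot> x ((i + len w + l) + l'))"
    using x f by (simp add: tpk add.assoc del: wh_merge_assoc wh_merge fam_simps(3) add: wh_merge[symmetric])
  also have "\<dots> = wh k (eps r) \<cdot> wh i (pad w w' f (tp l \<I>)) \<cdot> x (i + len w + l)"
    by (simp only: fam_simps(3)[OF x])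
  finally show ?thesis .
qed

lemma op_value:
  assumes x: "fam x" and f: "typed w w' f" and k: "k + r = i + len w' + l"
  shows "op w w' f i x k = wh k (eps r) \<cdot> wh i (pad w w' f (tp l \<I>)) \<cdot> x (i + len w + l)"
proof -
  have "op w w' f i x k = wh k (eps (i + len w')) \<cdot> wh i (pad w w' f (tp k \<I>)) \<cdot> x (i + len w + k)"
    using x by (simp add: op_def)
  \<comment> \<open>Tails of length \<open>k\<close> and \<open>l\<close> are compared through the
    common length \<open>k + l\<close>.\<close>
  also have "\<dots> = wh k (eps (i + len w' + l)) \<cdot> wh i (pad w w' f (tp (k + l) \<I>)) \<cdot> x (i + len w + (k + l))"
    using op_extend[OF x f, of k "i + len w'" i k l] by (simp add: add.commute)
  also have "\<dots> = wh k (eps (r + k)) \<cdot> wh i (pad w w' f (tp (l + k) \<I>)) \<cdot> x (i + len w + (l + k))"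
    using k by (simp only: add.commute)
  also have "\<dots> = wh k (eps r) \<cdot> wh i (pad w w' f (tp l \<I>)) \<cdot> x (i + len w + l)"
    by (rule op_extend[OF x f k])
  finally show ?thesis .
qed

text \<open>At these indices nothing is truncated; with \<open>fam_eqI\<close> this reduces
  identities of operators to identities of \<open>pad\<close>.\<close>

lemma op_at:
  assumes x: "fam x" and f: "typed w w' f"
  shows "op w w' f i x (i + len w' + l) = wh i (pad w w' f (tp l \<I>)) \<cdot> x (i + len w + l)"
  using op_value[OF x f, of "i + len w' + l" 0 i l] x f by simp

lemma fam_op [simp]:
  assumes x: "fam x" and f: "typed w w' f"
  shows "fam (op w w' f i x)"
proof -
  have tpk: "tp k (tp i (tp (len w') Z)) = tp i (tp (len w') (tp k Z))" for k Z
    by (metis tp_tp)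
  have 1: "op w w' f i x k \<in> Arr B" "Dom B (op w w' f i x k) = Dom B (x 0)"
    "Cod B (op w w' f i x k) = tp k \<I>" for k
    using x f fam_Dom[OF x] by (simp_all add: op_def tpk)
  have "wh k (eps j) \<cdot> op w w' f i x (k + j) = op w w' f i x k" for k j
  proof -
    let ?y = "wh i (pad w w' f (tp (k + j) \<I>)) \<cdot> x (i + len w + (k + j))"
    have tpk: "tp k (tp j (tp i (tp (len w') Z))) = tp i (tp (len w') (tp k (tp j Z)))" for Z
      by (metis tp_tp)
    have "wh k (eps j) \<cdot> op w w' f i x (k + j) = wh k (eps j) \<cdot> wh (k + j) (eps (i + len w')) \<cdot> ?y"
      by (subst op_value[OF x f, of _ "i + len w'" _ "k + j"]) simp_all
    also have "\<dots> = wh k (eps (j + (i + len w'))) \<cdot> ?y"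
      using x f by (simp add: eps_add[of j] tpk)
    also have "\<dots> = op w w' f i x k"
      by (subst op_value[OF x f, of _ "j + (i + len w')" _ "k + j"]) simp_all
    finally show ?thesis .
  qed
  with 1 show ?thesis
    by (rule famI)
qed

lemma op_Ident [simp]: "X = ob w \<Longrightarrow> op w w (\<i> X) i x = x"
proof (cases "fam x")
  case True
  assume "X = ob w"
  with True show ?thesis
    by (intro fam_eqI[of _ _ "i + len w"]) (simp_all add: op_at pad_Ident)
qed (simp add: op_not_fam)

lemma op_eq_self:
  assumes f: "typed w w' f" and "len w' = len w" "\<And>Z. Z \<in> Obj B \<Longrightarrow> pad w w' f Z = \<i> (tp (len w) Z)"
  shows "op w w' f i x = x"
proof (cases "fam x")
  case True
  show ?thesis
  proof (rule fam_eqI[OF fam_op[OF True f] True])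
    fix l
    show "op w w' f i x (i + len w' + l) = x (i + len w' + l)"
      unfolding op_at[OF True f] using True assms by simp
  qed
qed (simp add: op_not_fam)

lemma op_coherence [simp]:
  "\<lbrakk>X = ob a; Y = ob b; Z = ob c\<rbrakk>
    \<Longrightarrow> op (Node (Node a b) c) (Node a (Node b c)) (Assoc B X Y Z) i x = x"
  "X = ob a \<Longrightarrow> op (Node One a) a (LUnit B X) i x = x"
  "X = ob a \<Longrightarrow> op (Node a One) a (RUnit B X) i x = x"
  by (rule op_eq_self; simp add: pad_Assoc pad_LUnit pad_RUnit)+

lemma op_Comp:
  assumes f: "typed w w' f" and g: "typed w' w'' g"
  shows "op w w'' (g \<cdot> f) i x = op w' w'' g i (op w w' f i x)"
proof (cases "fam x")
  case True
  show ?thesis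
  proof (rule fam_eqI[where N = "i + len w''"])
    fix l
    show "op w w'' (g \<cdot> f) i x (i + len w'' + l) = op w' w'' g i (op w w' f i x) (i + len w'' + l)"
      unfolding op_at[OF True typed_Comp[OF f g]] op_at[OF fam_op[OF True f] g] op_at[OF True f]
      using True f g by (simp add: pad_Comp)
  qed (use True f g in auto)
qed (simp add: op_not_fam)

lemma op_TensorArr:
  assumes f: "typed a a' f" and g: "typed b b' g"
  shows "op (Node a b) (Node a' b') (f \<star> g) i x = op b b' g (i + len a') (op a a' f i x)"
proof (cases "fam x")
  case True
  have fg: "typed (Node a b) (Node a' b') (f \<star> g)"
    using f g by simp
  show ?thesis
  proof (rule fam_eqI[where N = "i + len a' + len b'"])
    fix l
    have "op (Node a b) (Node a' b') (f \<star> g) i x (i + len a' + len b' + l)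
        = wh i (pad (Node a b) (Node a' b') (f \<star> g) (tp l \<I>)) \<cdot> x (i + len (Node a b) + l)"
      by (subst op_at[OF True fg, symmetric]) (simp add: add.assoc)
    also have "\<dots> = wh (i + len a') (pad b b' g (tp l \<I>)) \<cdot>
        wh i (pad a a' f (tp (len b + l) \<I>)) \<cdot> x (i + len a + (len b + l))"
      using True f g by (simp add: pad_TensorArr add.assoc)
    also have "\<dots> = wh (i + len a') (pad b b' g (tp l \<I>)) \<cdot> op a a' f i x (i + len a' + (len b + l))"
      unfolding op_at[OF True f] ..
    also have "\<dots> = op b b' g (i + len a') (op a a' f i x) (i + len a' + len b' + l)"
      by (subst op_at[OF fam_op[OF True f] g]) (simp add: add.assoc)
    finally show "op (Node a b) (Node a' b') (f \<star> g) i x (i + len a' + len b' + l)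
        = op b b' g (i + len a') (op a a' f i x) (i + len a' + len b' + l)" .
  qed (use True f g fg in auto)
qed (simp add: op_not_fam)

text \<open>The interchange law. The position of \<open>g\<close> shifts because \<open>f\<close>
  turns \<open>len a\<close> factors into \<open>len a'\<close>; \<open>j\<close> is the gap between
  the two.\<close>

lemma op_exchange:
  assumes f: "typed a a' f" and g: "typed b b' g"
  shows "op b b' g (i + len a' + j) (op a a' f i x) = op a a' f i (op b b' g (i + len a + j) x)"
proof (cases "fam x")
  case True
  show ?thesis
  proof (rule fam_eqI[where N = "i + len a' + j + len b'"])
    fix l
    have "op b b' g (i + len a' + j) (op a a' f i x) (i + len a' + j + len b' + l)
        = wh (i + len a' + j) (pad b b' g (tp l \<I>)) \<cdot> op a a' f i x (i + len a' + (j + len b + l))"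
      by (subst op_at[OF fam_op[OF True f] g]) (simp add: add.assoc)
    also have "\<dots> = wh i (wh (len a') (wh j (pad b b' g (tp l \<I>))) \<cdot> pad a a' f (tp (j + len b + l) \<I>)) \<cdot>
        x (i + len a + (j + len b + l))"
      unfolding op_at[OF True f] using True f g by simp
    also have "wh (len a') (wh j (pad b b' g (tp l \<I>))) \<cdot> pad a a' f (tp (j + len b + l) \<I>)
        = pad a a' f (tp (j + len b' + l) \<I>) \<cdot> wh (len a) (wh j (pad b b' g (tp l \<I>)))"
      using pad_nat[OF f, of "wh j (pad b b' g (tp l \<I>))" "tp (j + len b' + l) \<I>"] g by simp
    also have "wh i (\<dots>) \<cdot> x (i + len a + (j + len b + l))
        = wh i (pad a a' f (tp (j + len b' + l) \<I>)) \<cdot>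
           (wh (i + len a + j) (pad b b' g (tp l \<I>)) \<cdot> x (i + len a + j + len b + l))"
      using True f g by (simp add: add.assoc)
    also have "\<dots> = wh i (pad a a' f (tp (j + len b' + l) \<I>)) \<cdot>
           op b b' g (i + len a + j) x (i + len a + (j + len b' + l))"
      by (subst op_at[OF True g, symmetric]) (simp add: add.assoc)
    also have "\<dots> = op a a' f i (op b b' g (i + len a + j) x) (i + len a' + (j + len b' + l))"
      by (rule op_at[OF fam_op[OF True g] f, symmetric])
    finally show "op b b' g (i + len a' + j) (op a a' f i x) (i + len a' + j + len b' + l)
      = op a a' f i (op b b' g (i + len a + j) x) (i + len a' + j + len b' + l)"
      by (simp add: add.assoc)
  qed (use True f g in auto)
qed (simp add: op_not_fam)

lemma op_faithful:
  assumes f: "typed w w' f" and g: "typed w w' g" and eq: "\<And>x. op w w' f 0 x = op w w' g 0 x"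
  shows "f = g"
proof (rule pad_faithful[OF f g])
  define n where "n = len w"
  \<comment> \<open>Append \<open>k\<close> units to \<open>n\<close> factors and keep the first
    \<open>k\<close> factors. Member \<open>n\<close> is the identity, so \<open>pad\<close> can be
    read off from \<open>op\<close>.\<close>
  define x where "x k = wh k (eps n) \<cdot> wh n (unt k)" for k
  have tpn: "tp k (tp n Z) = tp n (tp k Z)" for k Z
    by (rule tp_tp)
  have whn: "wh k (wh n h) = wh n (wh k h)" for k h
    by (metis add.commute wh_add)
  have "wh k (eps j) \<cdot> x (k + j) = x k" for k j
  proof -
    have "eps j \<cdot> wh j (eps n) = eps n \<cdot> wh n (eps j)"
      by (metis add.commute eps_add)
    moreover have "wh k (eps j) \<cdot> x (k + j) = wh k (eps j \<cdot> wh j (eps n)) \<cdot> wh n (unt (k + j))"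
      by (simp add: x_def tpn)
    ultimately have "wh k (eps j) \<cdot> x (k + j) = wh k (eps n) \<cdot> wh k (wh n (eps j)) \<cdot> wh n (unt (k + j))"
      by (simp add: tpn)
    also have "wh k (wh n (eps j)) \<cdot> wh n (unt (k + j)) = wh n (unt k)"
      by (simp add: unt_add whn tpn eps_unt)
    finally show ?thesis
      by (simp add: x_def)
  qed
  moreover have "x k \<in> Arr B" "Dom B (x k) = tp n \<I>" "Cod B (x k) = tp k \<I>" for k
    by (simp_all add: x_def tpn)
  ultimately have x: "fam x"
    by (intro famI)
  have "x n = \<i> (tp n \<I>)"
    by (simp add: x_def eps_unt)
  then have "pad w w' h \<I> = op w w' h 0 x (len w')" if "typed w w' h" for h
    using op_at[OF x that, of 0 0] that by (simp add: n_def)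
  then show "pad w w' f \<I> = pad w w' g \<I>"
    using f g eq by simp
qed

end

section \<open>Evaluation of formal composites\<close>

text \<open>
  Syntax for composites of given arrows with constraints. Two such composites with the same evaluation
  \<open>run\<close>, which does not see the constraints, are equal, and conversely.
\<close>

datatype 'm arrow_term =
    Gen tree tree 'm
  | Idn tree
  | Cmp "'m arrow_term" "'m arrow_term"
  | Tns "'m arrow_term" "'m arrow_term"
  | Asc tree tree tree
  | AscInv tree tree tree
  | LUn tree
  | LUnInv tree
  | RUn tree
  | RUnInv tree

primrec tdom :: "'m arrow_term \<Rightarrow> tree" where
  "tdom (Gen w w' f) = w"
| "tdom (Idn w) = w"
| "tdom (Cmp t s) = tdom s"
| "tdom (Tns s t) = Node (tdom s) (tdom t)"
| "tdom (Asc a b c) = Node (Node a b) c"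
| "tdom (AscInv a b c) = Node a (Node b c)"
| "tdom (LUn w) = Node One w"
| "tdom (LUnInv w) = w"
| "tdom (RUn w) = Node w One"
| "tdom (RUnInv w) = w"

primrec tcod :: "'m arrow_term \<Rightarrow> tree" where
  "tcod (Gen w w' f) = w'"
| "tcod (Idn w) = w"
| "tcod (Cmp t s) = tcod t"
| "tcod (Tns s t) = Node (tcod s) (tcod t)"
| "tcod (Asc a b c) = Node a (Node b c)"
| "tcod (AscInv a b c) = Node (Node a b) c"
| "tcod (LUn w) = w"
| "tcod (LUnInv w) = Node One w"
| "tcod (RUn w) = w"
| "tcod (RUnInv w) = Node w One"

context pointed_object
begin

abbreviation pw :: "nat \<Rightarrow> tree" where "pw n \<equiv> comb n One"

primrec well_typed :: "'m arrow_term \<Rightarrow> bool" where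
  "well_typed (Gen w w' f) \<longleftrightarrow> typed w w' f"
| "well_typed (Idn w) \<longleftrightarrow> True"
| "well_typed (Cmp t s) \<longleftrightarrow> well_typed t \<and> well_typed s \<and> tcod s = tdom t"
| "well_typed (Tns s t) \<longleftrightarrow> well_typed s \<and> well_typed t"
| "well_typed (Asc a b c) \<longleftrightarrow> True"
| "well_typed (AscInv a b c) \<longleftrightarrow> True"
| "well_typed (LUn w) \<longleftrightarrow> True"
| "well_typed (LUnInv w) \<longleftrightarrow> True"
| "well_typed (RUn w) \<longleftrightarrow> True"
| "well_typed (RUnInv w) \<longleftrightarrow> True"

primrec arr :: "'m arrow_term \<Rightarrow> 'm" where
  "arr (Gen w w' f) = f"
| "arr (Idn w) = \<i> (ob w)"
| "arr (Cmp t s) = arr t \<cdot> arr s"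
| "arr (Tns s t) = arr s \<star> arr t"
| "arr (Asc a b c) = Assoc B (ob a) (ob b) (ob c)"
| "arr (AscInv a b c) = inv_arrow B (Assoc B (ob a) (ob b) (ob c))"
| "arr (LUn w) = LUnit B (ob w)"
| "arr (LUnInv w) = inv_arrow B (LUnit B (ob w))"
| "arr (RUn w) = RUnit B (ob w)"
| "arr (RUnInv w) = inv_arrow B (RUnit B (ob w))"

text \<open>In \<open>Tns s t\<close> the left factor acts first, so \<open>t\<close> finds its
  strands behind the codomain of \<open>s\<close>, not its domain.\<close>

primrec run :: "'m arrow_term \<Rightarrow> nat \<Rightarrow> (nat \<Rightarrow> 'm) \<Rightarrow> nat \<Rightarrow> 'm" where
  "run (Gen w w' f) i x = op w w' f i x"
| "run (Idn w) i x = x"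
| "run (Cmp t s) i x = run t i (run s i x)"
| "run (Tns s t) i x = run t (i + len (tcod s)) (run s i x)"
| "run (Asc a b c) i x = x"
| "run (AscInv a b c) i x = x"
| "run (LUn w) i x = x"
| "run (LUnInv w) i x = x"
| "run (RUn w) i x = x"
| "run (RUnInv w) i x = x"

lemma typed_inv_arrow: "typed w w' f \<Longrightarrow> iso_arrow B f \<Longrightarrow> typed w' w (inv_arrow B f)"
  by (simp add: typed_def del: typedD)

lemma op_inv_arrow:
  assumes f: "typed w w' f" "iso_arrow B f"
  shows "op w' w (inv_arrow B f) i (op w w' f i x) = x"
proof -
  have "op w' w (inv_arrow B f) i (op w w' f i x) = op w w (inv_arrow B f \<cdot> f) i x"
    using typed_inv_arrow[OF f] f by (subst op_Comp) auto
  then show ?thesis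
    using f by simp
qed

lemma op_inv_arrow_trivial:
  assumes "typed w w' f" "iso_arrow B f" "op w w' f i x = x"
  shows "op w' w (inv_arrow B f) i x = x"
  using op_inv_arrow[OF assms(1,2), of i x] assms(3) by simp

lemma typed_arr: "well_typed t \<Longrightarrow> typed (tdom t) (tcod t) (arr t)"
  by (induction t) (auto intro!: typed_inv_arrow simp del: typedD)

lemma op_arr: "well_typed t \<Longrightarrow> op (tdom t) (tcod t) (arr t) i x = run t i x"
proof (induction t arbitrary: i x)
  case (Cmp t s)
  then show ?case
    using typed_arr[of t] typed_arr[of s]
    by (simp add: op_Comp[of "tdom s" "tcod s" "arr s" "tcod t" "arr t"])
next
  case (Tns s t)
  then show ?case
    using typed_arr[of t] typed_arr[of s] by (simp add: op_TensorArr)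
qed (auto intro!: op_inv_arrow_trivial)

lemma run_eqI:
  assumes "arr s = arr t" "well_typed s" "well_typed t" "tdom s = tdom t" "tcod s = tcod t"
  shows "run s i x = run t i x"
  using op_arr assms by metis

lemma arr_eqI:
  assumes "\<And>x. run s 0 x = run t 0 x" "well_typed s" "well_typed t" "tdom s = tdom t" "tcod s = tcod t"
  shows "arr s = arr t"
  using op_faithful[of "tdom s" "tcod s" "arr s" "arr t"] assms typed_arr op_arr by metis

primrec nrm_term :: "tree \<Rightarrow> tree \<Rightarrow> 'm arrow_term" where
  "nrm_term Leaf v = Idn (Node Leaf v)"
| "nrm_term One v = LUn v"
| "nrm_term (Node a b) v =
     Cmp (nrm_term a (comb (len b) v)) (Cmp (Tns (Idn a) (nrm_term b v)) (Asc a b v))"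

lemma comb_add: "comb (m + n) w = comb m (comb n w)"
  by (induction m) auto

lemma nrm_term_props:
  "tdom (nrm_term w v) = Node w v" "tcod (nrm_term w v) = comb (len w) v"
  "well_typed (nrm_term w v)" "arr (nrm_term w v) = nrm w (ob v)" "run (nrm_term w v) i x = x"
  by (induction w arbitrary: v i x) (auto simp: comb_add)

text \<open>A coherence isomorphism whose operator is the identity: naturality along it transfers
  statements between words of equal length.\<close>

definition to_pw :: "tree \<Rightarrow> 'm" where
  "to_pw w = nrm w \<I> \<cdot> inv_arrow B (RUnit B (ob w))"

lemma to_pw: "typed w (pw (len w)) (to_pw w)" "op w (pw (len w)) (to_pw w) i x = x"
proof -
  let ?t = "Cmp (nrm_term w One) (RUnInv w)"
  have "well_typed ?t" "tdom ?t = w" "tcod ?t = pw (len w)" "arr ?t = to_pw w" "run ?t i x = x"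
    by (simp_all add: nrm_term_props to_pw_def)
  then show "typed w (pw (len w)) (to_pw w)" "op w (pw (len w)) (to_pw w) i x = x"
    using typed_arr op_arr by metis+
qed

section \<open>Braiding operators\<close>

definition braid_op :: "tree \<Rightarrow> tree \<Rightarrow> nat \<Rightarrow> (nat \<Rightarrow> 'm) \<Rightarrow> nat \<Rightarrow> 'm" where
  "braid_op a b i x = op (Node a b) (Node b a) (Braid B (ob a) (ob b)) i x"

lemma typed_Braid [simp]: "X = ob a \<Longrightarrow> Y = ob b \<Longrightarrow> typed (Node a b) (Node b a) (Braid B X Y)"
  using Braid_in_hom[of "ob a" "ob b"] by (simp add: typed_def hom_set_def del: typedD)

lemma typed_in_hom: "typed a a' f \<longleftrightarrow> f \<in> hom_set B (ob a) (ob a')"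
  by (simp add: typed_def hom_set_def del: typedD)

lemma braid_op_natural:
  assumes f: "typed a a' f" and g: "typed b b' g"
  shows "braid_op a' b' i (op b b' g (i + len a') (op a a' f i x))
    = op a a' f (i + len b') (op b b' g i (braid_op a b i x))"
  using run_eqI[of "Cmp (Gen (Node a' b') (Node b' a') (Braid B (ob a') (ob b'))) (Tns (Gen a a' f) (Gen b b' g))"
      "Cmp (Tns (Gen b b' g) (Gen a a' f)) (Gen (Node a b) (Node b a) (Braid B (ob a) (ob b)))" i x]
    Braid_natural[of f "ob a" "ob a'" g "ob b" "ob b'"] f g
  by (simp add: braid_op_def typed_in_hom[symmetric])

lemma braid_op_len: "braid_op a b i x = braid_op (pw (len a)) (pw (len b)) i x"
  using braid_op_natural[OF to_pw(1) to_pw(1), of a b i x] by (simp add: to_pw(2))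

lemma braid_op_right: "braid_op a (Node b c) i x = braid_op a c (i + len b) (braid_op a b i x)"
proof -
  let ?X = "ob a" and ?Y = "ob b" and ?Z = "ob c"
  show ?thesis
    using run_eqI[of "Cmp (Asc b c a) (Cmp (Gen (Node a (Node b c)) (Node (Node b c) a) (Braid B ?X (?Y \<boxtimes> ?Z))) (Asc a b c))"
      "Cmp (Tns (Idn b) (Gen (Node a c) (Node c a) (Braid B ?X ?Z)))
        (Cmp (Asc b a c) (Tns (Gen (Node a b) (Node b a) (Braid B ?X ?Y)) (Idn c)))" i x]
      hexagon_right[of ?X ?Y ?Z]
    by (simp add: braid_op_def)
qed

lemma braid_op_left: "braid_op (Node a b) c i x = braid_op a c i (braid_op b c (i + len a) x)"
proof -
  let ?X = "ob a" and ?Y = "ob b" and ?Z = "ob c"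
  show ?thesis
    using run_eqI[of "Cmp (AscInv c a b) (Cmp (Gen (Node (Node a b) c) (Node c (Node a b)) (Braid B (?X \<boxtimes> ?Y) ?Z)) (AscInv a b c))"
      "Cmp (Tns (Gen (Node a c) (Node c a) (Braid B ?X ?Z)) (Idn b))
        (Cmp (AscInv a c b) (Tns (Idn a) (Gen (Node b c) (Node c b) (Braid B ?Y ?Z))))" i x]
      hexagon_left[of ?X ?Y ?Z]
    by (simp add: braid_op_def)
qed

lemma braid_op_cancel: "braid_op a b i x = braid_op a b i y \<Longrightarrow> x = y"
  using op_inv_arrow[of "Node a b" "Node b a" "Braid B (ob a) (ob b)" i]
    Braid_iso[of "ob a" "ob b"]
  unfolding braid_op_def by (metis ob_Obj typed_Braid)

text \<open>The hexagon for \<open>Node One One\<close> makes the operator idempotent, since only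
  the length of a word matters; being cancellable, it is the identity.\<close>

lemma braid_op_One: "braid_op a One i x = x" "braid_op One a i x = x"
proof -
  have "braid_op a One i (braid_op a One i x) = braid_op a One i x"
    using braid_op_right[of a One One i x] braid_op_len[of a "Node One One"] braid_op_len[of a One]
    by simp
  then show "braid_op a One i x = x"
    by (rule braid_op_cancel)
  have "braid_op One a i (braid_op One a i x) = braid_op One a i x"
    using braid_op_left[of One One a i x] braid_op_len[of "Node One One" a] braid_op_len[of One a]
    by simp
  then show "braid_op One a i x = x"
    by (rule braid_op_cancel)
qed

end

locale twisted_pointed_object = pointed_object B A e u + twisted_braided_category B \<theta>
  for B :: "('o, 'm, 'z) braided_category_scheme" (structure) and A e u \<theta>
begin

definition twist_op :: "tree \<Rightarrow> nat \<Rightarrow> (nat \<Rightarrow> 'm) \<Rightarrow> nat \<Rightarrow> 'm" where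
  "twist_op a i x = op a a (\<theta> (ob a)) i x"

lemma typed_twist [simp]: "X = ob a \<Longrightarrow> typed a a (\<theta> X)"
  using twist_in_hom[of "ob a"] by (simp add: typed_in_hom)

lemma twist_op_natural:
  assumes "typed a a' f"
  shows "twist_op a' i (op a a' f i x) = op a a' f i (twist_op a i x)"
  using run_eqI[of "Cmp (Gen a' a' (\<theta> (ob a'))) (Gen a a' f)" "Cmp (Gen a a' f) (Gen a a (\<theta> (ob a)))" i x]
    twist_natural[of f "ob a" "ob a'"] assms
  by (simp add: twist_op_def typed_in_hom[symmetric])

lemma twist_op_len: "twist_op a i x = twist_op (pw (len a)) i x"
  using twist_op_natural[OF to_pw(1), of a i x] by (simp add: to_pw(2))

lemma twist_op_Node:
  "twist_op (Node a b) i x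
    = twist_op b (i + len a) (twist_op a i (braid_op b a i (braid_op a b i x)))"
proof -
  let ?s = "Gen (Node a b) (Node a b) (\<theta> (ob a \<boxtimes> ob b))"
  let ?t = "Cmp (Tns (Gen a a (\<theta> (ob a))) (Gen b b (\<theta> (ob b))))
        (Cmp (Gen (Node b a) (Node a b) (Braid B (ob b) (ob a)))
          (Gen (Node a b) (Node b a) (Braid B (ob a) (ob b))))"
  have "run ?s i x = run ?t i x"
  proof (rule run_eqI)
    show "arr ?s = arr ?t"
      by (simp add: twist_tensor)
  qed simp_all
  then show ?thesis
    by (simp add: twist_op_def braid_op_def)
qed

lemma twist_op_cancel: "twist_op a i x = twist_op a i y \<Longrightarrow> x = y"
  using op_inv_arrow[of a a "\<theta> (ob a)" i] twist_iso[of "ob a"]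
  unfolding twist_op_def by (metis ob_Obj typed_twist)

text \<open>Idempotent and cancellable again: braidings with the unit are trivial, so the twist of
  \<open>Node One One\<close> is the square of that of \<open>One\<close>.\<close>

lemma twist_op_One: "twist_op One i x = x"
proof -
  have "twist_op One i (twist_op One i x) = twist_op One i x"
    using twist_op_Node[of One One i x] twist_op_len[of "Node One One"]
    by (simp add: braid_op_One)
  then show ?thesis
    by (rule twist_op_cancel)
qed

lemma twist_unit: "\<theta> \<I> = \<i> \<I>"
proof -
  have "arr (Gen One One (\<theta> \<I>)) = arr (Idn One)"
  proof (rule arr_eqI)
    show "run (Gen One One (\<theta> \<I>)) 0 x = run (Idn One) 0 x" for x
      using twist_op_One[of 0 x] by (simp add: twist_op_def)
  qed simp_all
  then show ?thesis
    by simp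
qed

end

section \<open>The strand calculus of a Hopf algebra with a modular pair\<close>

text \<open>
  Multiplication, unit, comultiplication, counit, antipode, \<open>\<sigma>\<close>, \<open>\<delta>\<close>, twisted antipode, braiding of
  \<open>a\<close> strands with \<open>b\<close> strands, diagonal action on \<open>n\<close> strands, twist of \<open>n\<close> strands; \<open>src\<close> and \<open>tgt\<close>
  count the strands that enter and leave. Below, \<open>act F i\<close> applies \<open>F\<close> to the strands from \<open>i\<close> on.
\<close>

datatype gen = Mu | Ut | De | Ep | An | Sg | Dl | St | Br nat nat | La nat | Tw nat

primrec src :: "gen \<Rightarrow> nat" where
  "src Mu = Suc (Suc 0)"
| "src Ut = 0"
| "src De = Suc 0"
| "src Ep = Suc 0"
| "src An = Suc 0"
| "src Sg = 0"
| "src Dl = Suc 0"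
| "src St = Suc 0"
| "src (Br a b) = a + b"
| "src (La n) = Suc n"
| "src (Tw n) = n"

primrec tgt :: "gen \<Rightarrow> nat" where
  "tgt Mu = Suc 0"
| "tgt Ut = Suc 0"
| "tgt De = Suc (Suc 0)"
| "tgt Ep = 0"
| "tgt An = Suc 0"
| "tgt Sg = Suc 0"
| "tgt Dl = 0"
| "tgt St = Suc 0"
| "tgt (Br a b) = a + b"
| "tgt (La n) = n"
| "tgt (Tw n) = n"

locale twisted_hopf_algebra = hopf_algebra B H + twisted_braided_category B \<theta>
  for B :: "('o, 'm, 'z) braided_category_scheme" (structure) and H \<theta> +
  fixes \<delta> \<sigma> :: 'm
  assumes involution: "twisted_modular_pair_in_involution B H \<theta> \<delta> \<sigma>"
begin

sublocale alg: algebra_object B "HObj H" "HMult H" "HUnit H"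
  by (rule algebra)

sublocale coalg: coalgebra_object B "HObj H" "HComult H" "HCounit H"
  by (rule coalgebra)

sublocale twisted_pointed_object B "HObj H" "HCounit H" "HUnit H" \<theta>
  by unfold_locales
    (rule alg.algebra_Obj coalg.counit_in_hom alg.unit_in_hom counit_unit)+

abbreviation "A \<equiv> HObj H"

lemma modular:
  "\<delta> \<in> hom_set B A \<I>" "\<delta> \<cdot> HMult H = LUnit B \<I> \<cdot> (\<delta> \<star> \<delta>)" "\<delta> \<cdot> HUnit H = \<i> \<I>"
  "\<sigma> \<in> hom_set B \<I> A" "HComult H \<cdot> \<sigma> = (\<sigma> \<star> \<sigma>) \<cdot> inv_arrow B (LUnit B \<I>)"
  "HCounit H \<cdot> \<sigma> = \<i> \<I>" "\<delta> \<cdot> \<sigma> = \<i> \<I>"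
  using involution
  by (auto simp: twisted_modular_pair_in_involution_def modular_pair_def
      algebra_morphism_def coalgebra_morphism_def)

lemma typed_structure [simp]:
  "typed (Node Leaf Leaf) Leaf (HMult H)" "typed One Leaf (HUnit H)"
  "typed Leaf (Node Leaf Leaf) (HComult H)" "typed Leaf One (HCounit H)"
  "typed Leaf Leaf (HAntipode H)" "typed Leaf One \<delta>" "typed One Leaf \<sigma>"
  using alg.mult_in_hom alg.unit_in_hom coalg.comult_in_hom coalg.counit_in_hom
    antipode_in_hom modular(1,4)
  by (simp_all add: typed_in_hom)

abbreviation "tMu \<equiv> Gen (Node Leaf Leaf) Leaf (HMult H)"
abbreviation "tUt \<equiv> Gen One Leaf (HUnit H)"
abbreviation "tDe \<equiv> Gen Leaf (Node Leaf Leaf) (HComult H)"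
abbreviation "tEp \<equiv> Gen Leaf One (HCounit H)"
abbreviation "tAn \<equiv> Gen Leaf Leaf (HAntipode H)"
abbreviation "tDl \<equiv> Gen Leaf One \<delta>"
abbreviation "tSg \<equiv> Gen One Leaf \<sigma>"
abbreviation "tSt \<equiv> Cmp (LUn Leaf) (Cmp (Tns tDl tAn) tDe)"
abbreviation "tBr a b \<equiv> Gen (Node a b) (Node b a) (Braid B (ob a) (ob b))"

definition middle_braid_term :: "tree \<Rightarrow> tree \<Rightarrow> tree \<Rightarrow> tree \<Rightarrow> 'm arrow_term" where
  "middle_braid_term a b c d =
     Cmp (AscInv a c (Node b d))
       (Cmp (Tns (Idn a) (Cmp (Asc c b d) (Cmp (Tns (tBr b c) (Idn d)) (AscInv b c d))))
         (Asc a b (Node c d)))"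

lemma middle_braid_term [simp]:
  "tdom (middle_braid_term a b c d) = Node (Node a b) (Node c d)"
  "tcod (middle_braid_term a b c d) = Node (Node a c) (Node b d)"
  "well_typed (middle_braid_term a b c d)"
  "arr (middle_braid_term a b c d) = middle_braid B (ob a) (ob b) (ob c) (ob d)"
  "run (middle_braid_term a b c d) i x = braid_op b c (i + len a) x"
  by (simp_all add: middle_braid_term_def middle_braid_def braid_op_def)

primrec action_term :: "nat \<Rightarrow> 'm arrow_term" where
  "action_term 0 = Cmp tEp (RUn Leaf)"
| "action_term (Suc n) =
     Cmp (Tns tMu (action_term n))
       (Cmp (middle_braid_term Leaf Leaf Leaf (pw n)) (Tns tDe (Idn (pw (Suc n)))))"

lemma CM_eq: "CM B H n = tp n \<I>"
  unfolding CM_def by (induction n) auto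

lemma action_term [simp]:
  "tdom (action_term n) = Node Leaf (pw n)" "tcod (action_term n) = pw n"
  "well_typed (action_term n)" "arr (action_term n) = left_diagonal_action B H n"
  by (induction n) (auto simp: CM_eq)

primrec gterm :: "gen \<Rightarrow> 'm arrow_term" where
  "gterm Mu = tMu"
| "gterm Ut = tUt"
| "gterm De = tDe"
| "gterm Ep = tEp"
| "gterm An = tAn"
| "gterm Sg = tSg"
| "gterm Dl = tDl"
| "gterm St = tSt"
| "gterm (Br a b) = tBr (pw a) (pw b)"
| "gterm (La n) = action_term n"
| "gterm (Tw n) = Gen (pw n) (pw n) (\<theta> (ob (pw n)))"

text \<open>Naming the generators by a datatype lets \<open>exchange\<close> compute shifts of
  positions from \<open>src\<close> and \<open>tgt\<close>.\<close>

definition act :: "gen \<Rightarrow> nat \<Rightarrow> (nat \<Rightarrow> 'm) \<Rightarrow> nat \<Rightarrow> 'm" where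
  "act F = run (gterm F)"

lemma well_typed_gterm: "well_typed (gterm F)"
  by (cases F) auto

lemma act_op: "act F = op (tdom (gterm F)) (tcod (gterm F)) (arr (gterm F))"
  unfolding act_def by (rule ext, rule ext, rule op_arr[OF well_typed_gterm, symmetric])

lemma len_gterm: "len (tdom (gterm F)) = src F" "len (tcod (gterm F)) = tgt F"
  by (cases F; simp)+

lemma exchange:
  assumes "i + tgt F \<le> k"
  shows "act G k (act F i x) = act F i (act G (k - tgt F + src F) x)"
proof -
  obtain j where "k = i + tgt F + j"
    using assms le_Suc_ex by blast
  then show ?thesis
    using op_exchange[OF typed_arr typed_arr, of "gterm F" "gterm G" i j x]
    by (simp add: well_typed_gterm act_op len_gterm add.commute add.left_commute)
qed

section \<open>Naturality and additivity of braidings and twists in strand notation\<close>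

lemma braid_op_Br: "braid_op a b i x = act (Br (len a) (len b)) i x"
  by (subst braid_op_len) (simp add: act_def braid_op_def)

lemma twist_op_Tw: "twist_op a i x = act (Tw (len a)) i x"
  by (subst twist_op_len) (simp add: act_def twist_op_def)

lemma Br_left:
  assumes "tgt F = a"
  shows "act (Br a b) i (act F i x) = act F (i + b) (act (Br (src F) b) i x)"
  using braid_op_natural[OF typed_arr[OF well_typed_gterm[of F]] typed_Ident[of "ob (pw b)" "pw b", OF refl], of i x] assms
  by (simp add: braid_op_Br len_gterm act_op[symmetric])

lemma Br_right:
  assumes "tgt F = b"
  shows "act (Br a b) i (act F (i + a) x) = act F i (act (Br a (src F)) i x)"
  using braid_op_natural[OF typed_Ident[of "ob (pw a)" "pw a", OF refl] typed_arr[OF well_typed_gterm[of F]], of i x] assms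
  by (simp add: braid_op_Br len_gterm act_op[symmetric])

lemma Br_add_right: "act (Br a (b + c)) i x = act (Br a c) (i + b) (act (Br a b) i x)"
  using braid_op_right[of "pw a" "pw b" "pw c" i x] by (simp add: braid_op_Br)

lemma Br_add_left: "act (Br (a + b) c) i x = act (Br a c) i (act (Br b c) (i + a) x)"
  using braid_op_left[of "pw a" "pw b" "pw c" i x] by (simp add: braid_op_Br)

lemma Br_0 [simp]: "act (Br a 0) i x = x" "act (Br 0 a) i x = x"
  using braid_op_One[of "pw a" i x] by (simp_all add: braid_op_Br)

lemma Tw_add: "act (Tw (a + b)) i x = act (Tw b) (i + a) (act (Tw a) i (act (Br b a) i (act (Br a b) i x)))"
  using twist_op_Node[of "pw a" "pw b" i x] by (simp add: twist_op_Tw braid_op_Br)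

lemma Tw_natural: "tgt F = n \<Longrightarrow> act (Tw n) i (act F i x) = act F i (act (Tw (src F)) i x)"
  using twist_op_natural[OF typed_arr[OF well_typed_gterm[of F]], of i x]
  by (simp add: twist_op_Tw len_gterm act_op[symmetric])

lemma Tw_0 [simp]: "act (Tw 0) i x = x"
  using twist_op_One[of i x] by (simp add: twist_op_Tw)

abbreviation "C \<equiv> act (Br (Suc 0) (Suc 0))"
abbreviation "T \<equiv> act (Tw (Suc 0))"

lemma La_0: "act (La 0) i x = act Ep i x"
  by (simp add: act_def)

text \<open>Stated in the normal form of \<open>exchange\<close>, with the generator furthest to the
  right acting first; \<open>De_Mu\<close>, \<open>De_Ut\<close> and \<open>De_Sg\<close> are turned
  round for the same reason.\<close>

lemma La_Suc: "act (La (Suc n)) i x = act Mu i (act (La n) (Suc (Suc i)) (C (Suc i) (act De i x)))"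
proof -
  have "act (La (Suc n)) i x = act (La n) (Suc i) (act Mu i (C (Suc i) (act De i x)))"
    by (simp add: act_def braid_op_Br)
  then show ?thesis
    by (simp add: exchange)
qed

lemma St_eq: "act St i x = act An i (act Dl i (act De i x))"
  by (simp add: act_def)

section \<open>The axioms of a Hopf algebra and of a modular pair as operator identities\<close>

lemma Mu_Mu: "act Mu i (act Mu (Suc i) x) = act Mu i (act Mu i x)"
  using run_eqI[of "Cmp tMu (Tns tMu (Idn Leaf))" "Cmp tMu (Cmp (Tns (Idn Leaf) tMu) (Asc Leaf Leaf Leaf))" i x]
    alg.mult_assoc
  by (simp add: act_def)

lemma Mu_Ut: "act Mu i (act Ut i x) = x" "act Mu i (act Ut (Suc i) x) = x"
  using run_eqI[of "Cmp tMu (Tns tUt (Idn Leaf))" "LUn Leaf" i x] alg.mult_unit_left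
    run_eqI[of "Cmp tMu (Tns (Idn Leaf) tUt)" "RUn Leaf" i x] alg.mult_unit_right
  by (simp_all add: act_def)

lemma De_De: "act De (Suc i) (act De i x) = act De i (act De i x)"
  using run_eqI[of "Cmp (Asc Leaf Leaf Leaf) (Cmp (Tns tDe (Idn Leaf)) tDe)" "Cmp (Tns (Idn Leaf) tDe) tDe" i x]
    coalg.comult_coassoc
  by (simp add: act_def)

lemma Ep_De: "act Ep i (act De i x) = x" "act Ep (Suc i) (act De i x) = x"
  using run_eqI[of "Cmp (LUn Leaf) (Cmp (Tns tEp (Idn Leaf)) tDe)" "Idn Leaf" i x]
    coalg.comult_counit_left
    run_eqI[of "Cmp (RUn Leaf) (Cmp (Tns (Idn Leaf) tEp) tDe)" "Idn Leaf" i x]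
    coalg.comult_counit_right
  by (simp_all add: act_def)

lemma De_Mu: "act De i (act Mu i x)
    = act Mu i (act Mu (Suc (Suc i)) (C (Suc i) (act De i (act De (Suc i) x))))"
proof -
  have "act De i (act Mu i x) = act Mu (Suc i) (act Mu i (C (Suc i) (act De (Suc (Suc i)) (act De i x))))"
    using run_eqI[of "Cmp tDe tMu" "Cmp (Tns tMu tMu) (Cmp (middle_braid_term Leaf Leaf Leaf Leaf) (Tns tDe tDe))" i x]
      comult_mult
    by (simp add: act_def braid_op_Br)
  then show ?thesis
    by (simp add: exchange)
qed

lemma De_Ut: "act De i (act Ut i x) = act Ut i (act Ut i x)"
proof -
  have "act De i (act Ut i x) = act Ut (Suc i) (act Ut i x)"
    using run_eqI[of "Cmp tDe tUt" "Cmp (Tns tUt tUt) (LUnInv One)" i x] comult_unit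
    by (simp add: act_def)
  then show ?thesis
    by (simp add: exchange)
qed

lemma Ep_Mu: "act Ep i (act Mu i x) = act Ep i (act Ep i x)"
  using run_eqI[of "Cmp tEp tMu" "Cmp (LUn One) (Tns tEp tEp)" i x] counit_mult
  by (simp add: act_def)

lemma Ep_Ut: "act Ep i (act Ut i x) = x"
  using run_eqI[of "Cmp tEp tUt" "Idn One" i x] counit_unit
  by (simp add: act_def)

lemma Mu_An_De: "act Mu i (act An i (act De i x)) = act Ut i (act Ep i x)"
  "act Mu i (act An (Suc i) (act De i x)) = act Ut i (act Ep i x)"
  using run_eqI[of "Cmp tMu (Cmp (Tns tAn (Idn Leaf)) tDe)" "Cmp tUt tEp" i x] antipode_left
    run_eqI[of "Cmp tMu (Cmp (Tns (Idn Leaf) tAn) tDe)" "Cmp tUt tEp" i x] antipode_right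
  by (simp_all add: act_def)

lemma Dl_Mu: "act Dl i (act Mu i x) = act Dl i (act Dl i x)"
  using run_eqI[of "Cmp tDl tMu" "Cmp (LUn One) (Tns tDl tDl)" i x] modular(2)
  by (simp add: act_def)

lemma Dl_Ut: "act Dl i (act Ut i x) = x"
  using run_eqI[of "Cmp tDl tUt" "Idn One" i x] modular(3)
  by (simp add: act_def)

lemma De_Sg: "act De i (act Sg i x) = act Sg i (act Sg i x)"
proof -
  have "act De i (act Sg i x) = act Sg (Suc i) (act Sg i x)"
    using run_eqI[of "Cmp tDe tSg" "Cmp (Tns tSg tSg) (LUnInv One)" i x] modular(5)
    by (simp add: act_def)
  then show ?thesis
    by (simp add: exchange)
qed

lemma Ep_Sg: "act Ep i (act Sg i x) = x"
  using run_eqI[of "Cmp tEp tSg" "Idn One" i x] modular(6)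
  by (simp add: act_def)

lemma Dl_Sg: "act Dl i (act Sg i x) = x"
  using run_eqI[of "Cmp tDl tSg" "Idn One" i x] modular(7)
  by (simp add: act_def)

lemma An_An: "act An i (act An i x) = act Mu i (act Mu i (act An (Suc (Suc i)) (act Sg (Suc (Suc i))
    (T (Suc i) (act Sg i (act Dl (Suc i) (act Dl i (act An i (act De i (act De i x))))))))))"
proof -
  let ?tw = "Gen Leaf Leaf (\<theta> A)"
  have *: "HAntipode H \<cdot> HAntipode H =
       (HMult H \<cdot> (HMult H \<star> \<i> A) \<cdot> ((\<sigma> \<star> \<theta> A) \<star> (HAntipode H \<cdot> \<sigma>))) \<cdot>
       (((\<delta> \<cdot> HAntipode H) \<star> \<i> A) \<star> \<delta>) \<cdot> (HComult H \<star> \<i> A) \<cdot> HComult H"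
    using involution by (simp add: twisted_modular_pair_in_involution_def)
  have "run (Cmp tAn tAn) i x
     = run (Cmp (Cmp tMu (Cmp (Tns tMu (Idn Leaf)) (Tns (Tns tSg ?tw) (Cmp tAn tSg))))
         (Cmp (Tns (Tns (Cmp tDl tAn) (Idn Leaf)) tDl) (Cmp (Tns tDe (Idn Leaf)) tDe))) i x"
    by (rule run_eqI) (simp_all only: arr.simps ob.simps *, simp_all)
  then show ?thesis
    using twist_op_Tw[of Leaf "Suc i"] by (simp add: act_def twist_op_def)
qed

end

context twisted_hopf_algebra
begin

subsection \<open>Braid naturality for single strands\<close>

lemma Br_Suc_Suc_0:
  "act (Br (Suc (Suc 0)) b) i x = act (Br (Suc 0) b) i (act (Br (Suc 0) b) (Suc i) x)"
  "act (Br b (Suc (Suc 0))) i x = act (Br b (Suc 0)) (Suc i) (act (Br b (Suc 0)) i x)"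
  using Br_add_left[of "Suc 0" "Suc 0" b i x] Br_add_right[of b "Suc 0" "Suc 0" i x] by simp_all

lemma C_Mu: "C i (act Mu i x) = act Mu (Suc i) (C i (C (Suc i) x))"
  "C i (act Mu (Suc i) x) = act Mu i (C (Suc i) (C i x))"
  using Br_left[of Mu "Suc 0" "Suc 0" i x] Br_right[of Mu "Suc 0" "Suc 0" i x]
  by (simp_all add: Br_Suc_Suc_0)

lemma De_C: "act De (Suc i) (C i x) = C i (C (Suc i) (act De i x))"
  "act De i (C i x) = C (Suc i) (C i (act De (Suc i) x))"
  using Br_left[of De "Suc (Suc 0)" "Suc 0" i x] Br_right[of De "Suc (Suc 0)" "Suc 0" i x]
  by (simp_all add: Br_Suc_Suc_0)

text \<open>A generator without input can be created on either side of a strand, because braiding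
  with no strands is trivial.\<close>

lemma C_point:
  assumes "src F = 0" "tgt F = Suc 0"
  shows "C i (act F i x) = act F (Suc i) x" "C i (act F (Suc i) x) = act F i x"
  using Br_left[of F "Suc 0" "Suc 0" i x] Br_right[of F "Suc 0" "Suc 0" i x] assms by simp_all

lemma copoint_C:
  assumes "src F = Suc 0" "tgt F = 0"
  shows "act F (Suc i) (C i x) = act F i x" "act F i (C i x) = act F (Suc i) x"
  using Br_left[of F 0 "Suc 0" i x] Br_right[of F 0 "Suc 0" i x] assms by simp_all

lemma C_endo:
  assumes "src F = Suc 0" "tgt F = Suc 0"
  shows "C i (act F i x) = act F (Suc i) (C i x)" "C i (act F (Suc i) x) = act F i (C i x)"
  using Br_left[of F "Suc 0" "Suc 0" i x] Br_right[of F "Suc 0" "Suc 0" i x] assms by simp_all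

lemma exchange':
  "i + src F \<le> k \<Longrightarrow> act F i (act G k x) = act G (k - src F + tgt F) (act F i x)"
  by (simp add: exchange[of i F])

text \<open>
  Three orientations of the exchange law: the rightmost generator acts first in \<open>exchange\<close>, the
  leftmost one in \<open>exchange'\<close>; \<open>float\<close> is like \<open>exchange\<close> except that generators without output act
  as early and generators without input as late as possible.
\<close>

lemma float:
  "\<lbrakk>0 < src G; 0 < tgt F; i + tgt F \<le> k\<rbrakk>
    \<Longrightarrow> act G k (act F i x) = act F i (act G (k - tgt F + src F) x)"
  "\<lbrakk>src G = 0; i + src F \<le> k\<rbrakk> \<Longrightarrow> act F i (act G k x) = act G (k - src F + tgt F) (act F i x)"
  "\<lbrakk>tgt F = 0; i + src F \<le> k\<rbrakk> \<Longrightarrow> act F i (act G k x) = act G (k - src F) (act F i x)"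
  by (rule exchange; simp) (simp_all add: exchange[of i F])

subsection \<open>The antipode\<close>

text \<open>Coproduct and product of the braided tensor square of \<open>H\<close>, which define the
  two convolution products below.\<close>

abbreviation "De2 i x \<equiv> C (Suc i) (act De i (act De (Suc i) x))"
abbreviation "Mu2 i x \<equiv> act Mu i (act Mu (Suc (Suc i)) (C (Suc i) x))"

lemma De2_coassoc: "De2 (Suc (Suc i)) (De2 i x) = De2 i (De2 i x)"
  by (simp add: exchange De_C De_De)

text \<open>
  The antipode reverses products and coproducts because, for the convolution product, both sides of
  \<open>An_Mu\<close> are inverse to the multiplication, and both sides of \<open>De_An\<close> to the comultiplication.
\<close>

lemma convolution_inverse_Mu:
  "act Mu i (act Mu (Suc i) (act An (Suc i) (act An (Suc (Suc i)) (C (Suc i) (act Mu i (De2 i x))))))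
    = act Ut i (act Ep i (act Ep i x))" (is "?l = _")
proof -
  let ?v = "act An (Suc (Suc i)) (C (Suc i) (act De i x))"
  have *: "C (Suc (Suc i)) (De2 i x) = act De (Suc i) (C (Suc i) (act De i x))"
    by (simp add: De_C exchange)
  have "?l = act Mu i (act Mu i (act Mu (Suc (Suc i)) (act An (Suc (Suc i)) (act An (Suc (Suc (Suc i)))
      (C (Suc (Suc i)) (De2 i x))))))"
    by (simp add: exchange)
  also have "\<dots> = act Mu i (act Mu (Suc i) (act Mu (Suc i) (act An (Suc (Suc i)) (act De (Suc i) ?v))))"
    unfolding * Mu_Mu[symmetric, of i] Mu_Mu[symmetric, of "Suc i"] by (simp add: exchange)
  also have "\<dots> = act Ut i (act Ep i (act Ep i x))"
    unfolding Mu_An_De by (simp add: float Mu_Ut Mu_An_De copoint_C)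
  finally show ?thesis .
qed

lemma An_Mu: "act An i (act Mu i x) = act Mu i (act An i (act An (Suc i) (C i x)))"
proof -
  let ?k = "Suc (Suc i)"
  let ?g = "\<lambda>i y. act Mu i (act An i (act An (Suc i) (C i y)))"
  \<comment> \<open>With \<open>f = S m\<close> and \<open>g\<close> the right-hand side,
    convolution gives \<open>f = f * (m * g) = (f * m) * g = g\<close>. This line inserts the
    convolution unit as second factor.\<close>
  have "act An i (act Mu i x) = act Mu i (act An i (act Mu i (act Ut ?k (act Ep ?k (act Ep ?k (De2 i x))))))"
    by (simp add: float Mu_Ut copoint_C Ep_De)
  also have "\<dots> = act Mu i (act An i (act Mu i (act Mu ?k (?g (Suc ?k) (act Mu ?k (De2 ?k (De2 i x)))))))"
    unfolding convolution_inverse_Mu ..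
  also have "\<dots> = act Mu i (act Mu (Suc i) (act An i (act Mu i (?g (Suc ?k) (act Mu ?k (De2 ?k (De2 i x)))))))"
    by (simp add: exchange)
  also have "\<dots> = act Mu i (act Mu i (act An i (act Mu i (?g (Suc ?k) (act Mu ?k (De2 ?k (De2 i x)))))))"
    by (rule Mu_Mu)
  also have "\<dots> = act Mu i (?g (Suc i) (act Mu i (act An i (act Mu i (act Mu ?k (De2 i (De2 i x)))))))"
    unfolding De2_coassoc by (simp add: exchange)
  also have "act Mu i (act Mu ?k (De2 i (De2 i x))) = act De i (act Mu i (De2 i x))"
    by (simp add: De_Mu)
  also have "act Mu i (?g (Suc i) (act Mu i (act An i (act De i (act Mu i (De2 i x))))))
      = ?g i (act Ep i (act Ep i (De2 i x)))"
    unfolding Mu_An_De by (simp add: float Mu_Ut Ep_Mu)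
  also have "act Ep i (act Ep i (De2 i x)) = x"
    by (simp add: exchange copoint_C Ep_De)
  finally show ?thesis .
qed

lemma Mu2_assoc: "Mu2 i (Mu2 (Suc (Suc i)) x) = Mu2 i (Mu2 i x)"
proof -
  let ?k = "Suc (Suc (Suc i))"
  have "Mu2 i (Mu2 (Suc (Suc i)) x)
      = act Mu i (act Mu (Suc i) (act Mu ?k (act Mu (Suc ?k) (C (Suc (Suc i)) (C (Suc i) (C ?k x))))))"
    by (simp add: exchange C_Mu)
  also have "\<dots> = Mu2 i (Mu2 i x)"
    unfolding Mu_Mu by (simp add: exchange C_Mu)
  finally show ?thesis .
qed

lemma Mu2_De: "Mu2 i (act De i (act De (Suc i) x)) = act De i (act Mu i x)"
  by (simp add: De_Mu)

abbreviation "rev_An i x \<equiv> act An i (act An (Suc i) (C i (act De i x)))"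

lemma convolution_inverse_De:
  "Mu2 i (act De i (rev_An (Suc i) (act De i x))) = act Ut i (act Ut i (act Ep i x))"
proof -
  \<comment> \<open>\<open>h_4\<close> crosses \<open>h_2\<close> and \<open>h_3\<close> together,
    so these remain neighbours and \<open>h_2 S(h_3)\<close> collapses, after which
    \<open>h_1 S(h_4)\<close> does.\<close>
  have *: "C (Suc i) (C (Suc (Suc i)) (act De i (act De i (act De i x))))
      = act De (Suc (Suc i)) (C (Suc i) (act De i (act De i x)))"
    by (simp add: De_C De_De)
  have 1: "act De i (rev_An (Suc i) (act De i x)) = rev_An (Suc (Suc i)) (act De i (act De i x))"
    by (simp add: exchange)
  have 2: "Mu2 i (rev_An (Suc (Suc i)) y)
      = act Mu i (act An (Suc i) (act Mu (Suc (Suc i)) (act An (Suc (Suc (Suc i)))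
          (C (Suc i) (C (Suc (Suc i)) (act De (Suc (Suc i)) y))))))" for y
    by (simp add: exchange C_endo)
  have 3: "act De (Suc (Suc i)) (act De i (act De i x)) = act De i (act De i (act De i x))"
    by (simp add: exchange De_De)
  have "Mu2 i (act De i (rev_An (Suc i) (act De i x)))
      = act Mu i (act An (Suc i) (act Mu (Suc (Suc i)) (act An (Suc (Suc (Suc i)))
          (C (Suc i) (C (Suc (Suc i)) (act De i (act De i (act De i x))))))))"
    unfolding 1 unfolding 2 unfolding 3 ..
  also have "\<dots> = act Ut i (act Ut i (act Ep i x))"
    unfolding * Mu_An_De by (simp add: float copoint_C Ep_De Mu_An_De)
  finally show ?thesis .
qed

lemma De_An: "act De i (act An i x) = rev_An i x"
proof -
  let ?k = "Suc i"
  \<comment> \<open>The same scheme for maps from \<open>H\<close> to its tensor square, multiplied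
    by \<open>Mu2\<close>: \<open>\<Delta> S\<close> and \<open>rev_An\<close> are both inverse to
    \<open>\<Delta>\<close>.\<close>
  have "act De i (act An i x) = Mu2 i (act De i (act An i (act Ut ?k (act Ut ?k (act Ep ?k (act De i x))))))"
    by (simp add: float Mu_Ut C_point Ep_De)
  also have "\<dots> = Mu2 i (act De i (act An i (Mu2 ?k (act De ?k (rev_An (Suc ?k) (act De ?k (act De i x)))))))"
    unfolding convolution_inverse_De ..
  also have "\<dots> = Mu2 i (Mu2 (Suc (Suc i)) (act De i (act De (Suc i) (act An i (rev_An (Suc ?k) (act De ?k (act De i x)))))))"
    by (simp add: exchange)
  also have "\<dots> = Mu2 i (Mu2 i (act De i (act De (Suc i) (act An i (rev_An (Suc ?k) (act De ?k (act De i x)))))))"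
    by (rule Mu2_assoc)
  also have "\<dots> = Mu2 i (act De i (rev_An (Suc i) (act Mu i (act An i (act De i (act De i x))))))"
    unfolding Mu2_De by (simp add: exchange De_De)
  also have "\<dots> = rev_An i x"
    unfolding Mu_An_De by (simp add: float De_Ut Mu_Ut C_point Ep_De)
  finally show ?thesis .
qed

lemma An_Ut: "act An i (act Ut i x) = act Ut i x"
  using Mu_An_De(1)[of i "act Ut i x"] by (simp add: De_Ut Ep_Ut float Mu_Ut)

lemma Mu_An_Sg: "act Mu i (act An i (act Sg i (act Sg i x))) = act Ut i x"
  using Mu_An_De(1)[of i "act Sg i x"] by (simp add: De_Sg Ep_Sg)

text \<open>Apply the counit to \<open>S(h_1) h_2 = \<epsilon>(h)\<close>.\<close>

lemma Ep_An: "act Ep i (act An i x) = act Ep i x"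
proof -
  have "act Ep i (act An i x) = act Ep i (act Ep i (act An i (act De i x)))"
    by (simp add: exchange Ep_De)
  also have "\<dots> = act Ep i (act Ut i (act Ep i x))"
    unfolding Mu_An_De(1)[symmetric] Ep_Mu ..
  finally show ?thesis
    by (simp add: Ep_Ut)
qed

subsection \<open>The twisted antipode\<close>

lemma St_Mu: "act St i (act Mu i x) = act Mu i (act St i (act St (Suc i) (C i x)))"
proof -
  have *: "act St i (act St (Suc i) y)
      = act An i (act An (Suc i) (act Dl i (act Dl (Suc (Suc i)) (act De i (act De (Suc i) y)))))" for y
    by (simp add: St_eq exchange)
  have "act St i (act Mu i x)
    = act Mu i (act An i (act An (Suc i) (C i (act Dl i (act Dl (Suc i) (De2 i x))))))"
    by (simp add: St_eq De_Mu float Dl_Mu An_Mu)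
  also have "\<dots> = act Mu i (act St i (act St (Suc i) (C i x)))"
    unfolding * by (simp add: float copoint_C De_C, simp add: exchange)
  finally show ?thesis .
qed

text \<open>\<open>S\<close> reverses the coproduct, so the tensor factor that carries
  \<open>\<delta>\<close> ends up last.\<close>

lemma De_St: "act De i (act St i x) = act An i (act St (Suc i) (C i (act De i x)))"
  by (simp add: St_eq De_An exchange De_De copoint_C De_C)

text \<open>\<open>S'(h_1) h_2 = \<delta>(h_1) S(h_2) h_3 = \<delta>(h)\<close>.\<close>

lemma Mu_St_De: "act Mu i (act St i (act De i x)) = act Ut i (act Dl i x)"
proof -
  have "act Mu i (act St i (act De i x)) = act Dl i (act Mu (Suc i) (act An (Suc i) (act De (Suc i) (act De i x))))"
    by (simp add: St_eq exchange De_De)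
  then show ?thesis
    unfolding Mu_An_De by (simp add: float Ep_De)
qed

lemma St_Ut: "act St i (act Ut i x) = act Ut i x"
  by (simp add: St_eq De_Ut Dl_Ut An_Ut)

lemma St_Sg: "act St i (act Sg i x) = act An i (act Sg i x)"
  by (simp add: St_eq De_Sg Dl_Sg)

lemma Ep_St: "act Ep i (act St i x) = act Dl i x"
  by (simp add: St_eq Ep_An exchange Ep_De)

text \<open>
  The square of the twisted antipode is the twist conjugated by \<open>\<sigma>\<close>: the two evaluations of \<open>\<delta>\<close> in
  the involution condition cancel against those in the two twisted antipodes.
\<close>

lemma St_St: "act Mu i (act St i (act St i (act Sg (Suc i) x))) = act Mu i (act Sg i (T i x))"
proof -
  \<comment> \<open>Evaluation of \<open>\<delta>\<close>, or of \<open>\<delta>\<close> after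
    \<open>S\<close> (primed), on the left or right factor of the coproduct. The primed versions are
    inverse to the others because \<open>\<delta> S\<close> is the convolution inverse of
    \<open>\<delta>\<close>.\<close>
  let ?l = "\<lambda>x. act Dl i (act De i x)" and ?l' = "\<lambda>x. act Dl i (act An i (act De i x))"
  let ?r = "\<lambda>x. act Dl (Suc i) (act De i x)" and ?r' = "\<lambda>x. act Dl (Suc i) (act An (Suc i) (act De i x))"
  have "?l' (?l x) = act Dl i (act Mu i (act An (Suc i) (act De i (act De i x))))" for x
    by (simp add: Dl_Mu exchange De_De)
  then have l: "?l' (?l x) = x" for x
    unfolding Mu_An_De by (simp add: float Dl_Ut Ep_De)
  have "?r (?r' x) = act Dl (Suc i) (act Mu (Suc i) (act An (Suc (Suc i)) (act De (Suc i) (act De i x))))" for x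
    by (simp add: Dl_Mu exchange De_De)
  then have r: "?r (?r' x) = x" for x
    unfolding Mu_An_De by (simp add: float Dl_Ut Ep_De)
  have "act De j (act An j x) = C j (act An j (act An (Suc j) (act De j x)))" for j x
    by (simp add: De_An C_endo exchange)
  \<comment> \<open>The outer \<open>S'\<close> meets a reversed coproduct, so its
    \<open>\<delta>\<close> reads the last factor:
    \<open>S'(S'(h)) = \<delta>(h_1) \<delta>(S(h_3)) S(S(h_2))\<close>.\<close>
  then have 1: "act St i (act St i x) = act An i (act An i (?l (?r' x)))" for x
    by (simp add: St_eq exchange De_De copoint_C)
  have 2: "act An i (act An i y) = act Mu i (act Mu i (act An (Suc (Suc i)) (act Sg (Suc (Suc i))
      (T (Suc i) (act Sg i (?l' (?r y)))))))" for y
    unfolding An_An by (simp add: exchange)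
  have 3: "?r (?l (?r' x)) = ?l (?r (?r' x))" for x
    by (simp add: exchange De_De)
  have 4: "act St i (act St i x) = act Mu i (act Mu i (act An (Suc (Suc i)) (act Sg (Suc (Suc i))
      (T (Suc i) (act Sg i x)))))" for x
    unfolding 1 2 unfolding 3 r l ..
  \<comment> \<open>Reassociation that brings \<open>S(\<sigma>)\<close> next to the
    \<open>\<sigma>\<close> multiplied on from the right; the two cancel.\<close>
  have 5: "act Mu i (act Mu i (act Mu i z)) = act Mu i (act Mu i (act Mu (Suc (Suc i)) z))" for z
    using Mu_Mu[of i "act Mu i z"] by (simp add: exchange)
  have "act Mu i (act St i (act St i (act Sg (Suc i) x)))
     = act Mu i (act Mu i (act Mu (Suc (Suc i)) (act An (Suc (Suc i)) (act Sg (Suc (Suc i)) (act Sg (Suc (Suc i))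
         (T (Suc i) (act Sg i x)))))))"
    unfolding 4 5 by (simp add: exchange)
  then show ?thesis
    unfolding Mu_An_Sg by (simp add: float Mu_Ut)
qed

subsection \<open>The diagonal action\<close>

lemma La_Mu: "act (La n) i (act Mu i x) = act (La n) i (act (La n) (Suc i) x)"
proof (induction n arbitrary: i x)
  case 0
  then show ?case
    by (simp add: La_0 Ep_Mu exchange)
next
  case (Suc n)
  then show ?case
    by (simp add: La_Suc De_Mu C_Mu Mu_Mu exchange')
qed

lemma La_Ut: "act (La n) i (act Ut i x) = x"
  by (induction n arbitrary: i x) (simp_all add: La_0 Ep_Ut La_Suc De_Ut C_point Mu_Ut exchange)

lemma Br_1_Suc: "act (Br (Suc 0) (Suc n)) i x = act (Br (Suc 0) n) (Suc i) (C i x)"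
  using Br_add_right[of "Suc 0" "Suc 0" n i x] by simp

text \<open>By coassociativity the diagonal action can peel off the last strand, where
  \<open>La_Suc\<close> peels off the first; the last strand is the one that receives
  \<open>\<sigma>\<close>.\<close>

lemma La_split: "act (La (Suc n)) i x
    = act (La n) i (act Mu (Suc (i + n)) (act (Br (Suc 0) n) (Suc i) (act De i x)))"
proof (induction n arbitrary: i x)
  case 0
  then show ?case
    by (simp add: La_0 La_Suc copoint_C float Ep_De)
next
  case (Suc n)
  show ?case
    unfolding La_Suc[of "Suc n" i x] Suc.IH[of "Suc (Suc i)"]
    unfolding La_Suc[of n i] Br_1_Suc[of n]
    by (simp add: De_C De_De exchange)
qed

text \<open>In Sweedler notation, with \<open>S'\<close> for \<open>St\<close>: \<open>S'(h\<^sub>1) (h\<^sub>2 y, w) = (y, S'(h) w)\<close>.\<close>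

lemma La_St_La_De: "act (La (Suc n)) i (act St i (act (La n) (Suc i) (act De i x)))
    = act Mu (i + n) (act (Br (Suc 0) n) i (act St i x))"
proof -
  let ?z = "act Mu (Suc (i + n)) (act (Br (Suc 0) n) (Suc i) (act St (Suc i) (C i (act De i x))))"
  \<comment> \<open>By \<open>La_split\<close> and \<open>De_St\<close> the left side is
    \<open>(S(h_2) h_3 y, S'(h_1) w)\<close>, and \<open>S(h_2) h_3\<close> collapses. The numbered
    facts move strands into place by coassociativity, naturality and exchange.\<close>
  have 1: "act De i (act (La n) (Suc i) (act De i x)) = act (La n) (Suc (Suc i)) (act De (Suc i) (act De i x))"
    by (simp add: exchange De_De)
  have 2: "act (Br (Suc 0) n) (Suc i) (act (La n) (Suc (Suc i)) y)
      = act (La n) (Suc i) (act (Br (Suc 0) n) (Suc (Suc i)) (C (Suc i) y))" for y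
    using Br_right[of "La n" n "Suc 0" "Suc i" y] by (simp add: Br_1_Suc[of n])
  have 3: "act Mu (Suc (i + n)) (act (La n) (Suc i) y) = act (La n) (Suc i) (act Mu (Suc (Suc (i + n))) y)" for y
    by (simp add: exchange)
  have 4: "act An i (act St (Suc i) (C i (act (La n) (Suc (Suc i)) y)))
      = act (La n) (Suc (Suc i)) (act An i (act St (Suc i) (C i y)))" for y
    by (simp add: exchange)
  have 5: "act Mu (Suc (Suc (i + n))) (act (Br (Suc 0) n) (Suc (Suc i)) (C (Suc i)
       (act An i (act St (Suc i) (C i (act De (Suc i) (act De i x)))))))
    = act An i (act Mu (Suc (Suc (i + n))) (act (Br (Suc 0) n) (Suc (Suc i)) (act St (Suc (Suc i))
        (C (Suc i) (C i (act De (Suc i) (act De i x)))))))"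
    by (simp add: exchange C_endo)
  have 6: "act An i (act Mu (Suc (Suc (i + n))) (act (Br (Suc 0) n) (Suc (Suc i)) (act St (Suc (Suc i))
        (act De i y))))
     = act An i (act De i (act Mu (Suc (i + n)) (act (Br (Suc 0) n) (Suc i) (act St (Suc i) y))))" for y
    by (simp add: exchange)
  have "act (La (Suc n)) i (act St i (act (La n) (Suc i) (act De i x)))
      = act (La n) i (act Mu i (act An i (act De i ?z)))"
    unfolding La_split unfolding De_St unfolding 1 unfolding 4 unfolding 2 unfolding 3 unfolding 5
    unfolding La_Mu[symmetric] De_C(2)[symmetric] unfolding 6 ..
  also have "\<dots> = act Ep i ?z"
    unfolding Mu_An_De La_Ut ..
  also have "\<dots> = act Mu (i + n) (act (Br (Suc 0) n) i (act St i x))"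
    by (simp add: float copoint_C Ep_De)
  finally show ?thesis .
qed

text \<open>The coproduct of a factor commutes with the diagonal action because
  \<open>\<Delta>\<close> is multiplicative. This yields \<open>cyc_De\<close> and
  \<open>cyc_Sg\<close>.\<close>

lemma La_De: "j < n \<Longrightarrow> act (La (Suc n)) i (act De (Suc (i + j)) x) = act De (i + j) (act (La n) i x)"
proof (induction n arbitrary: i j x)
  case (Suc n)
  show ?case
  proof (cases j)
    case 0
    then show ?thesis
      by (simp add: La_Suc De_Mu De_C De_De exchange')
  next
    case (Suc k)
    with Suc.IH[of k "Suc (Suc i)"] Suc.prems show ?thesis
      by (simp add: La_Suc exchange')
  qed
qed simp

lemma La_Ep: "j \<le> n \<Longrightarrow> act (La n) i (act Ep (Suc (i + j)) x) = act Ep (i + j) (act (La (Suc n)) i x)"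
proof (induction n arbitrary: i j x)
  case (Suc n)
  show ?case
  proof (cases j)
    case 0
    then show ?thesis
      by (simp add: La_Suc Ep_Mu float copoint_C Ep_De)
  next
    case (Suc k)
    with Suc.IH[of k "Suc (Suc i)"] Suc.prems show ?thesis
      by (simp add: La_Suc exchange')
  qed
qed (simp add: La_0 La_Suc Ep_Mu float copoint_C Ep_De)


text \<open>\<open>prj\<close>, \<open>cyc\<close> and \<open>rot\<close> are the maps
  \<open>p_n\<close>, \<open>t_n\<close> and \<open>r_n\<close> of the overview, applied to the
  strands from position \<open>i\<close> on.\<close>

abbreviation "prj n i x \<equiv> act (La n) i (act St i x)"

text \<open>Up to braidings,
  \<open>S'(h_1 x_0) h_2 = S'(x_0) S'(h_1) h_2 = \<delta>(h) S'(x_0)\<close>.\<close>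

lemma prj_La: "prj n i (act (La (Suc n)) i x) = prj n i (act Dl i x)"
proof -
  have *: "C i (C (Suc i) (act De i x)) = act De (Suc i) (C i x)"
    by (rule De_C(1)[symmetric])
  have "prj n i (act (La (Suc n)) i x)
      = act (La n) i (act (La n) (Suc i) (act St i (act St (Suc i) (C i
          (act (La n) (Suc (Suc i)) (C (Suc i) (act De i x)))))))"
    unfolding La_Suc St_Mu La_Mu ..
  also have "\<dots> = act (La n) i (act St i (act (La n) (Suc i) (act (La n) (Suc (Suc i))
      (act St (Suc i) (C i (C (Suc i) (act De i x)))))))"
    by (simp add: exchange)
  also have "\<dots> = prj n i (act (La n) (Suc i) (act Mu (Suc i) (act St (Suc i) (act De (Suc i) (C i x)))))"
    unfolding * La_Mu ..
  also have "\<dots> = prj n i (act Dl i x)"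
    unfolding Mu_St_De La_Ut by (simp add: copoint_C)
  finally show ?thesis .
qed

definition cyc :: "nat \<Rightarrow> nat \<Rightarrow> (nat \<Rightarrow> 'm) \<Rightarrow> nat \<Rightarrow> 'm" where
  "cyc n i x = prj n i (act Sg (i + n) x)"

abbreviation "rot n i x \<equiv> act Mu (i + n) (act Sg (i + n) (T (i + n) (act (Br (Suc 0) n) i x)))"

text \<open>For \<open>h = S'(x_0)\<close>, \<open>La_St_La_De\<close> turns
  \<open>S'(h_1 x_1).(h_2.(x_2, ..., x_n), \<sigma>)\<close> into
  \<open>S'(x_1).(x_2, ..., x_n, S'(h) \<sigma>)\<close>, and \<open>St_St\<close> evaluates the
  last entry. The computation uses a factor \<open>x_1\<close>, hence \<open>Suc k\<close>.\<close>

lemma cyc_prj: "cyc (Suc k) i (prj (Suc k) i x) = prj (Suc k) i (rot (Suc k) i x)"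
proof -
  let ?n = "Suc k" and ?j = "Suc (i + k)"
  let ?y = "act Sg (Suc ?j) x"
  have "cyc ?n i (prj ?n i x) = prj ?n i (act (La ?n) i (act St i ?y))"
    by (simp add: cyc_def exchange)
  also have "\<dots> = act (La ?n) i (act (La ?n) (Suc i) (act St i (act St (Suc i) (C i
          (act (La k) (Suc (Suc i)) (C (Suc i) (act De i (act St i ?y))))))))"
    unfolding La_Suc[of k i "act St i ?y"] St_Mu La_Mu ..
  also have "\<dots> = prj ?n i (act (La ?n) (Suc i) (act St (Suc i) (act (La k) (Suc (Suc i))
      (C i (C (Suc i) (act De i (act St i ?y)))))))"
    by (simp add: exchange)
  also have "\<dots> = prj ?n i (act Mu ?j (act (Br (Suc 0) k) (Suc i) (act St (Suc i) (C i (act St i ?y)))))"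
    unfolding De_C(1)[symmetric] La_St_La_De by simp
  also have "\<dots> = prj ?n i (act Mu ?j (act St ?j (act St ?j (act (Br (Suc 0) k) (Suc i) (C i ?y)))))"
    using Br_left[of St "Suc 0" k "Suc i"] by (simp add: C_endo)
  also have "act (Br (Suc 0) k) (Suc i) (C i ?y) = act Sg (Suc ?j) (act (Br (Suc 0) ?n) i x)"
    by (simp add: Br_1_Suc[of k] float)
  finally show ?thesis
    unfolding St_St by simp
qed

lemma prj_Ut: "prj n i (act Ut i x) = x"
  by (simp add: St_Ut La_Ut)

text \<open>\<open>\<sigma>\<close> is grouplike. In \<open>rot_pow\<close> this merges a newly
  appended \<open>\<sigma>\<close> with its action on the strands moved earlier.\<close>

lemma La_Sg_last: "act (La (Suc n)) i (act Sg i x)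
    = act (La n) i (act Sg i (act Mu (i + n) (act Sg (i + n) x)))"
proof -
  have "act (Br (Suc 0) n) j (act Sg j x) = act Sg (j + n) x" for j x
    using Br_left[of Sg "Suc 0" n j x] by simp
  then show ?thesis
    unfolding La_split De_Sg by (simp add: exchange)
qed

lemma Tw_prj: "act (Tw n) i (prj n i x) = prj n i (act (Tw (Suc n)) i x)"
proof -
  let ?t = "Cmp (gterm (La n)) (Tns (gterm St) (Idn (pw n)))"
  have "well_typed ?t" "tdom ?t = Node Leaf (pw n)" "tcod ?t = pw n"
    by simp_all
  moreover have "run ?t i x = prj n i x" for x
    by (simp add: act_def)
  ultimately show ?thesis
    using twist_op_natural[OF typed_arr[of ?t], of i x] op_arr[of ?t i] by (simp add: twist_op_Tw)
qed

text \<open>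
  After \<open>k\<close> rotations the first \<open>k\<close> strands have crossed the other \<open>l\<close>; each pair among them has crossed
  twice, which together with the single twists makes up the twist of \<open>k\<close> strands.
\<close>

lemma rot_pow: "k + l = Suc n \<Longrightarrow> (rot n i ^^ k) x
    = act (La k) (i + l) (act Sg (i + l) (act (Tw k) (i + l) (act (Br k l) i x)))"
proof (induction k arbitrary: l)
  case 0
  then show ?case
    by (simp add: La_0 Ep_Sg)
next
  case (Suc k)
  let ?j = "i + l"
  let ?b = "act (Br (Suc 0) k)"
  from Suc.prems have n: "n = k + l"
    by simp
  define y where "y = act (Br (Suc 0) l) i (act (Br k (Suc l)) i x)"
  \<comment> \<open>By naturality the crossing of the first \<open>k\<close> strands with the next
    one is pulled through the other \<open>l\<close>. Together with \<open>?b\<close> it forms the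
    double braiding required by \<open>Tw_add\<close>.\<close>
  have y: "y = act (Br k (Suc 0)) ?j (act (Br (Suc k) l) i x)"
  proof -
    have "y = act (Br (Suc k) l) i (act (Br k (Suc 0)) i x)"
      using Br_add_right[of k "Suc 0" l i x] Br_add_left[of "Suc 0" k l i "act (Br k (Suc 0)) i x"]
      by (simp add: y_def)
    then show ?thesis
      using Br_left[of "Br k (Suc 0)" "Suc k" l i x] by simp
  qed
  have La: "?b ?j (act (La k) (Suc ?j) z) = act (La k) ?j (?b (Suc ?j) (C ?j z))" for z
    using Br_right[of "La k" k "Suc 0" ?j z] by (simp add: Br_1_Suc[of k])
  have Tw: "?b ?j (act (Tw k) (Suc ?j) z) = act (Tw k) ?j (?b ?j z)" for z
    using Br_right[of "Tw k" k "Suc 0" ?j z] by simp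
  have "act (Br (Suc 0) n) i ((rot n i ^^ k) x)
      = ?b ?j (act (La k) (Suc ?j) (act Sg (Suc ?j) (act (Tw k) (Suc ?j) y)))"
    using Suc.IH[of "Suc l"] Br_add_right[of "Suc 0" l k i] n
    by (simp add: exchange add.commute y_def)
  also have "\<dots> = act (La k) ?j (act Sg ?j (act (Tw k) ?j (?b ?j y)))"
    unfolding La by (simp add: C_point exchange Tw)
  finally have "(rot n i ^^ Suc k) x = act Mu (?j + k) (act Sg (?j + k) (T (?j + k)
      (act (La k) ?j (act Sg ?j (act (Tw k) ?j (?b ?j y))))))"
    using n by (simp add: add.commute add.left_commute)
  also have "\<dots> = act (La (Suc k)) ?j (act Sg ?j (T (?j + k) (act (Tw k) ?j (?b ?j y))))"
    unfolding La_Sg_last by (simp add: exchange)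
  also have "T (?j + k) (act (Tw k) ?j (?b ?j y)) = act (Tw (Suc k)) ?j (act (Br (Suc k) l) i x)"
    using Tw_add[of k "Suc 0" ?j "act (Br (Suc k) l) i x"] by (simp add: y)
  finally show ?case .
qed

lemma rot_pow_full: "(rot n i ^^ Suc n) x = act (La (Suc n)) i (act Sg i (act (Tw (Suc n)) i x))"
  using rot_pow[of "Suc n" 0 n i x] by simp

lemma cyc_pow: "(cyc n i ^^ Suc n) x = act (Tw n) i x"
proof (cases n)
  case 0
  then show ?thesis
    by (simp add: cyc_def La_0 Ep_St Dl_Sg)
next
  case (Suc k)
  have *: "(cyc n i ^^ j) (prj n i y) = prj n i ((rot n i ^^ j) y)" for j y
    by (induction j) (simp_all add: Suc cyc_prj)
  \<comment> \<open>A unit inserted in front exhibits \<open>x\<close> as a value of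
    \<open>prj\<close>; the action of \<open>\<sigma>\<close> from \<open>rot_pow_full\<close> turns
    into \<open>\<delta>(\<sigma>) = 1\<close> by \<open>prj_La\<close>.\<close>
  have "(cyc n i ^^ Suc n) (prj n i (act Ut i x)) = prj n i (act (Tw (Suc n)) i (act Ut i x))"
    unfolding * rot_pow_full prj_La Dl_Sg ..
  then show ?thesis
    unfolding Tw_prj[symmetric] prj_Ut .
qed

subsection \<open>The relations between the cyclic operator and the cosimplicial structure\<close>

lemma cyc_0: "cyc 0 i x = x"
  by (simp add: cyc_def La_0 Ep_St Dl_Sg)

lemma cyc_Ut: "cyc (Suc n) 0 (act Ut 0 x) = act Sg n x"
  by (simp add: cyc_def exchange St_Ut La_Ut)

text \<open>\<open>S'(h_1).(h_2, w) = (S(h_2) h_3, S'(h_1).w) = (1, S'(h).w)\<close>.\<close>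

lemma cyc_De_0: "cyc (Suc (Suc n)) 0 (act De 0 x) = act Ut 0 (cyc (Suc n) 0 x)"
proof -
  let ?y = "act Sg (Suc n) x"
  have "cyc (Suc (Suc n)) 0 (act De 0 x) = act (La (Suc n)) (Suc 0) (act Mu 0 (C (Suc 0) (act An 0
      (act St (Suc 0) (C 0 (act De (Suc 0) (act De 0 ?y)))))))"
    by (simp add: cyc_def La_Suc[of "Suc n"] De_St exchange De_De)
  also have "C (Suc 0) (act An 0 (act St (Suc 0) (C 0 (act De (Suc 0) (act De 0 ?y)))))
      = act An 0 (act St (Suc (Suc 0)) (act De 0 (C 0 (act De 0 ?y))))"
    unfolding De_C(2) by (simp add: exchange C_endo)
  also have "\<dots> = act An 0 (act De 0 (act St (Suc 0) (C 0 (act De 0 ?y))))"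
    by (simp add: exchange)
  also have "act Mu 0 (act An 0 (act De 0 (act St (Suc 0) (C 0 (act De 0 ?y))))) = act Ut 0 (act St 0 ?y)"
    unfolding Mu_An_De by (simp add: float copoint_C Ep_De)
  also have "act (La (Suc n)) (Suc 0) (act Ut 0 (act St 0 ?y)) = act Ut 0 (cyc (Suc n) 0 x)"
    by (simp add: cyc_def exchange)
  finally show ?thesis .
qed

text \<open>\<open>S'(\<sigma>) \<sigma> = S(\<sigma>) \<sigma> = 1\<close>. In degree one there is
  no inner coface, so this case stands alone.\<close>

lemma cyc_Sg_0: "cyc (Suc 0) 0 (act Sg 0 x) = act Ut 0 x"
proof -
  have "act (La (Suc 0)) i y = act Mu i y" for i y
    by (simp add: La_0 La_Suc copoint_C float Ep_De)
  then show ?thesis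
    by (simp add: cyc_def exchange St_Sg Mu_An_Sg)
qed

lemma cyc_De:
  assumes "j < n"
  shows "cyc (Suc (Suc n)) 0 (act De (Suc j) x) = act De j (cyc (Suc n) 0 x)"
proof -
  have "cyc (Suc (Suc n)) 0 (act De (Suc j) x)
      = act (La (Suc (Suc n))) 0 (act De (Suc (0 + j)) (act St 0 (act Sg (Suc n) x)))"
    using assms by (simp add: cyc_def exchange)
  then show ?thesis
    using assms by (subst (asm) La_De) (simp_all add: cyc_def)
qed

text \<open>The two final copies of \<open>\<sigma>\<close> are \<open>\<Delta>(\<sigma>)\<close>,
  so \<open>La_De\<close> applies to the last factor.\<close>

lemma cyc_Sg: "cyc (Suc (Suc n)) 0 (act Sg (Suc n) x) = act De n (cyc (Suc n) 0 x)"
  using La_De[of n "Suc n" 0, symmetric] by (simp add: cyc_def exchange De_Sg)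

lemma cyc_Ep:
  assumes "j \<le> n"
  shows "cyc (Suc n) 0 (act Ep (Suc j) x) = act Ep j (cyc (Suc (Suc n)) 0 x)"
proof -
  have "cyc (Suc n) 0 (act Ep (Suc j) x)
      = act (La (Suc n)) 0 (act Ep (Suc (0 + j)) (act St 0 (act Sg (Suc (Suc n)) x)))"
    using assms by (simp add: cyc_def exchange)
  then show ?thesis
    using assms by (subst (asm) La_Ep) (simp_all add: cyc_def)
qed

text \<open>The first application of \<open>cyc\<close> gives a value of \<open>prj\<close>, so
  \<open>cyc_prj\<close> computes the second. The last entry is then
  \<open>\<sigma> \<theta>(x_0)\<close>, which the counit reduces to
  \<open>\<epsilon>(x_0)\<close>.\<close>

lemma cyc_Ep_0: "cyc n 0 (act Ep 0 x) = act Ep n (cyc (Suc n) 0 (cyc (Suc n) 0 x))"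
proof -
  have "act Ep n (cyc (Suc n) 0 (cyc (Suc n) 0 x))
      = act Ep n (act (La (Suc n)) 0 (act St 0 (rot (Suc n) 0 (act Sg (Suc n) x))))"
    unfolding cyc_def[of "Suc n" 0 x] cyc_prj by simp
  also have "\<dots> = act (La n) 0 (act Ep (Suc n) (act St 0 (rot (Suc n) 0 (act Sg (Suc n) x))))"
    using La_Ep[of n n 0] by simp
  also have "\<dots> = prj n 0 (act Ep (Suc n) (T (Suc n) (act (Br (Suc 0) (Suc n)) 0 (act Sg (Suc n) x))))"
    by (simp add: float Ep_Mu Ep_Sg)
  also have "act Ep (Suc n) (T (Suc n) y) = act Ep (Suc n) y" for y
    using Tw_natural[of Ep 0 "Suc n" y] by simp
  also have "act Ep (Suc n) (act (Br (Suc 0) (Suc n)) 0 y) = act Ep 0 y" for y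
    using Br_left[of Ep 0 "Suc n" 0 y] by simp
  also have "act Ep 0 (act Sg (Suc n) x) = act Sg n (act Ep 0 x)"
    by (simp add: float)
  finally show ?thesis
    by (simp add: cyc_def)
qed

end

section \<open>The paracocyclic object\<close>

context category
begin

lemma arrow_pow_in_hom: "f \<in> hom_set C X X \<Longrightarrow> arrow_pow C f n \<in> hom_set C X X"
  by (induction n) (auto simp: hom_set_def)

lemma arrow_pow_Suc_right: "f \<in> hom_set C X X \<Longrightarrow> arrow_pow C f (Suc n) = arrow_pow C f n \<cdot> f"
proof (induction n)
  case 0
  then show ?case
    by (auto simp: hom_set_def)
next
  case (Suc n)
  then have "arrow_pow C f (Suc (Suc n)) = f \<cdot> (arrow_pow C f n \<cdot> f)"
    by simp
  also have "\<dots> = (f \<cdot> arrow_pow C f n) \<cdot> f"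
    using Suc.prems arrow_pow_in_hom[OF Suc.prems, of n] by (auto simp: hom_set_def)
  finally show ?case
    by simp
qed

text \<open>An inverse of the power yields a left and a right inverse of \<open>f\<close>, which
  coincide. It applies to \<open>t_n\<close>, one of whose powers is a twist.\<close>

lemma iso_arrow_of_pow:
  assumes f: "f \<in> hom_set C X X" and iso: "iso_arrow C (arrow_pow C f (Suc n))"
  shows "iso_arrow C f"
proof -
  let ?p = "arrow_pow C f n"
  define q where "q = inv_arrow C (arrow_pow C f (Suc n))"
  have fp: "f \<in> Arr C" "Dom C f = X" "Cod C f = X" "?p \<in> Arr C" "Dom C ?p = X" "Cod C ?p = X"
    using hom_setD[OF f] hom_setD[OF arrow_pow_in_hom[OF f, of n]] by auto
  have q: "q \<in> Arr C" "Dom C q = X" "Cod C q = X"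
    using inv_arrow_simps(1-3)[OF iso] fp by (auto simp: q_def)
  have right: "f \<cdot> (?p \<cdot> q) = Ident C X"
    using inv_arrow_simps(5)[OF iso, folded q_def] fp q by simp
  have left: "(q \<cdot> ?p) \<cdot> f = Ident C X"
    using inv_arrow_simps(4)[OF iso, folded q_def] fp q
    unfolding arrow_pow_Suc_right[OF f] by simp
  have "q \<cdot> ?p = (q \<cdot> ?p) \<cdot> (f \<cdot> (?p \<cdot> q))"
    unfolding right using fp q by simp
  also have "\<dots> = ((q \<cdot> ?p) \<cdot> f) \<cdot> (?p \<cdot> q)"
    using fp q by simp
  also have "\<dots> = ?p \<cdot> q"
    unfolding left using fp q by simp
  finally have "(?p \<cdot> q) \<cdot> f = Ident C X"
    using left by simp
  then show ?thesis
    using fp q right by (intro iso_arrowI[where g = "?p \<cdot> q"]) auto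
qed

end

context twisted_hopf_algebra
begin

text \<open>Ties an arrow between tensor powers to its operator; by \<open>acts_eqI\<close> the
  relations of a paracocyclic object are checked on operators.\<close>

definition acts :: "nat \<Rightarrow> nat \<Rightarrow> 'm \<Rightarrow> ((nat \<Rightarrow> 'm) \<Rightarrow> nat \<Rightarrow> 'm) \<Rightarrow> bool" where
  "acts a b f F \<longleftrightarrow> typed (pw a) (pw b) f \<and> (\<forall>x. op (pw a) (pw b) f 0 x = F x)"

lemma acts_in_hom: "acts a b f F \<Longrightarrow> f \<in> hom_set B (CM B H a) (CM B H b)"
  by (simp add: acts_def typed_in_hom CM_eq)

lemma acts_Comp: "acts a b f F \<Longrightarrow> acts b c g G \<Longrightarrow> acts a c (g \<cdot> f) (\<lambda>x. G (F x))"
  unfolding acts_def by (auto simp: op_Comp[of "pw a" "pw b" f "pw c" g])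

lemma acts_Ident: "acts a a (\<i> (CM B H a)) (\<lambda>x. x)"
  by (simp add: acts_def CM_eq)

lemma acts_eqI: "acts a b f F \<Longrightarrow> acts a b g G \<Longrightarrow> (\<And>x. F x = G x) \<Longrightarrow> f = g"
  unfolding acts_def by (metis op_faithful)

lemma acts_arr:
  assumes "well_typed t" "tdom t = pw a" "tcod t = pw b" "\<And>x. run t 0 x = F x"
  shows "acts a b (arr t) F"
  using assms typed_arr[of t] op_arr[of t 0] by (simp add: acts_def)

lemma acts_pow: "acts n n f F \<Longrightarrow> acts n n (arrow_pow B f k) (F ^^ k)"
proof (induction k)
  case 0
  then show ?case
    using acts_Ident[of n] acts_in_hom[OF 0] by (simp add: hom_set_def id_def)
next
  case (Suc k)
  then show ?case
    using acts_Comp[of n n "arrow_pow B f k" "F ^^ k" n f F] by (simp add: comp_def)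
qed

primrec whisker_term :: "nat \<Rightarrow> 'm arrow_term \<Rightarrow> 'm arrow_term" where
  "whisker_term 0 t = t"
| "whisker_term (Suc k) t = Tns (Idn Leaf) (whisker_term k t)"

lemma whisker_term [simp]:
  "tdom (whisker_term k t) = comb k (tdom t)" "tcod (whisker_term k t) = comb k (tcod t)"
  "well_typed (whisker_term k t) = well_typed t" "arr (whisker_term k t) = wh k (arr t)"
  "run (whisker_term k t) i x = run t (i + k) x"
  by (induction k arbitrary: i) auto

lemma comb_Node: "comb k (Node Leaf w) = Node Leaf (comb k w)"
  by (induction k) auto

definition coface_op :: "nat \<Rightarrow> nat \<Rightarrow> (nat \<Rightarrow> 'm) \<Rightarrow> nat \<Rightarrow> 'm" where
  "coface_op n i x =
     (if i = 0 then act Ut 0 x else if i < n then act De (i - 1) x else act Sg (n - 1) x)"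

abbreviation "append_term n \<equiv> whisker_term n (Cmp (RUnInv Leaf) tSg)"

lemma append_term: "arr (append_term n) = CM_append B H \<sigma> n"
  by (simp add: CM_append_def)

lemma acts_coface:
  assumes "i \<le> Suc n"
  shows "acts n (Suc n) (CM_coface B H \<sigma> (Suc n) i) (coface_op (Suc n) i)"
proof -
  consider "i = 0" | k l where "i = Suc k" "n = Suc (k + l)" | "i = Suc n"
    using assms by (metis Suc_le_mono add_Suc le_Suc_eq le_Suc_ex not0_implies_Suc)
  then show ?thesis
  proof cases
    case 1
    let ?t = "Cmp (Tns tUt (Idn (pw n))) (LUnInv (pw n))"
    have "arr ?t = CM_coface B H \<sigma> (Suc n) i"
      using 1 by (simp add: CM_coface_def CM_eq)
    then show ?thesis
      using acts_arr[of ?t n "Suc n"] 1 by (simp add: coface_op_def act_def)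
  next
    case 2
    let ?t = "whisker_term k (Cmp (Asc Leaf Leaf (pw l)) (Tns tDe (Idn (pw l))))"
    have "arr ?t = CM_coface B H \<sigma> (Suc n) i"
      using 2 by (simp add: CM_coface_def CM_eq)
    then show ?thesis
      using acts_arr[of ?t n "Suc n"] 2 by (simp add: coface_op_def act_def comb_add comb_Node)
  next
    case 3
    then have "arr (append_term n) = CM_coface B H \<sigma> (Suc n) i"
      unfolding append_term by (simp add: CM_coface_def)
    then show ?thesis
      using acts_arr[of "append_term n" n "Suc n"] 3 by (simp add: coface_op_def act_def comb_Node)
  qed
qed

lemma acts_codegeneracy:
  assumes "j \<le> n"
  shows "acts (Suc n) n (CM_codegeneracy B H n j) (act Ep j)"
proof -
  obtain l where n: "n = j + l"
    using assms le_Suc_ex by blast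
  let ?t = "whisker_term j (Cmp (LUn (pw l)) (Tns tEp (Idn (pw l))))"
  have "arr ?t = CM_codegeneracy B H n j"
    using n by (simp add: CM_codegeneracy_def CM_eq)
  then show ?thesis
    using acts_arr[of ?t "Suc n" n] n by (simp add: act_def comb_add comb_Node)
qed

lemma acts_paracocyclic_operator: "acts n n (CM_paracocyclic_operator B H \<delta> \<sigma> n) (cyc n 0)"
proof (cases n)
  case 0
  then show ?thesis
    using acts_Ident[of 0] by (simp add: CM_paracocyclic_operator_def cyc_0 CM_eq fun_eq_iff acts_def)
next
  case (Suc k)
  let ?t = "Cmp (action_term n) (Tns tSt (append_term k))"
  have "arr ?t = CM_paracocyclic_operator B H \<delta> \<sigma> n"
    using Suc by (simp add: CM_paracocyclic_operator_def twisted_antipode_def CM_append_def CM_eq)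
  moreover have "run ?t 0 x = cyc n 0 x" for x
  proof -
    have "run ?t 0 x = act (La n) 0 (act Sg n (act St 0 x))"
      using Suc by (simp add: act_def)
    then show ?thesis
      using Suc by (simp add: cyc_def exchange)
  qed
  ultimately show ?thesis
    using acts_arr[of ?t n n "cyc n 0"] Suc by (simp add: comb_Node)
qed

lemma coface_coface_op:
  assumes "1 \<le> n" "i < j" "j \<le> Suc n"
  shows "coface_op (Suc n) j (coface_op n i x) = coface_op (Suc n) i (coface_op n (j - 1) x)"
proof -
  obtain m k where m: "n = Suc m" "j = Suc k"
    using assms by (cases n; cases j) auto
  \<comment> \<open>Only neighbouring cofaces need an axiom (\<open>De_Ut\<close>,
    \<open>De_De\<close>, \<open>De_Sg\<close>); the others commute by
    \<open>exchange\<close>.\<close>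
  consider "i = 0" "k = 0" | "i = 0" "0 < k" | l where "i = Suc l" "k = Suc l" "l < m"
    | l where "i = Suc l" "Suc l < k" | "i = n" "k = n"
    using assms m by (cases i) (auto simp: less_Suc_eq le_less)
  then show ?thesis
    by cases (use assms m in \<open>auto simp: coface_op_def exchange De_Ut De_De De_Sg Suc_diff_Suc\<close>)
qed

lemma codegeneracy_coface_op:
  "1 \<le> n \<Longrightarrow> i < j \<Longrightarrow> j \<le> n \<Longrightarrow> act Ep j (coface_op (Suc n) i x) = coface_op n i (act Ep (j - 1) x)"
  "j \<le> n \<Longrightarrow> i = j \<or> i = Suc j \<Longrightarrow> act Ep j (coface_op (Suc n) i x) = x"
  "1 \<le> n \<Longrightarrow> Suc j < i \<Longrightarrow> i \<le> Suc n \<Longrightarrow> act Ep j (coface_op (Suc n) i x) = coface_op n (i - 1) (act Ep j x)"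
proof -
  show "act Ep j (coface_op (Suc n) i x) = coface_op n i (act Ep (j - 1) x)" if asm: "1 \<le> n" "i < j" "j \<le> n"
  proof -
    obtain k where k: "j = Suc k"
      using asm by (cases j) auto
    consider "i = 0" | l m where "i = Suc l" "k = Suc (l + m)"
      using asm k by (cases i) (auto simp: less_iff_Suc_add)
    then show ?thesis
      by cases (use asm k in \<open>auto simp: coface_op_def exchange\<close>)
  qed
  show "act Ep j (coface_op (Suc n) i x) = x" if "j \<le> n" "i = j \<or> i = Suc j"
    using that by (cases j) (auto simp: coface_op_def Ep_Ut Ep_De Ep_Sg)
  show "act Ep j (coface_op (Suc n) i x) = coface_op n (i - 1) (act Ep j x)"
    if asm: "1 \<le> n" "Suc j < i" "i \<le> Suc n"
  proof -
    obtain l where "i = Suc (Suc (j + l))"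
      using asm by (auto simp: less_iff_Suc_add)
    then show ?thesis
      using asm by (auto simp: coface_op_def exchange)
  qed
qed

lemma cyc_coface_op:
  assumes "1 \<le> i" "i \<le> n"
  shows "cyc n 0 (coface_op n i x) = coface_op n (i - 1) (cyc (n - 1) 0 x)"
proof -
  consider "n = Suc 0" "i = Suc 0" | m where "n = Suc (Suc m)" "i = Suc 0"
    | m k where "n = Suc (Suc m)" "i = Suc (Suc k)" "k < m" | m where "n = Suc (Suc m)" "i = n"
    using assms by (cases n; cases "n - 1"; cases i; cases "i - 1") (auto simp: le_Suc_eq)
  then show ?thesis
    by cases (auto simp: coface_op_def cyc_0 cyc_Sg_0 cyc_De_0 cyc_De cyc_Sg)
qed

lemma paracocyclic_operator_pow:
  "arrow_pow B (CM_paracocyclic_operator B H \<delta> \<sigma> n) (Suc n) = \<theta> (CM B H n)"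
proof (rule acts_eqI[OF acts_pow[OF acts_paracocyclic_operator]])
  show "acts n n (\<theta> (CM B H n)) (act (Tw n) 0)"
    by (simp add: acts_def CM_eq act_def)
qed (rule cyc_pow)

lemma acts_coface': "1 \<le> n \<Longrightarrow> i \<le> n \<Longrightarrow> acts (n - 1) n (CM_coface B H \<sigma> n i) (coface_op n i)"
  using acts_coface[of i "n - 1"] by simp

lemma acts_codegeneracy': "1 \<le> n \<Longrightarrow> j \<le> n - 1 \<Longrightarrow> acts n (n - 1) (CM_codegeneracy B H (n - 1) j) (act Ep j)"
  using acts_codegeneracy[of j "n - 1"] by simp

lemma paracocyclic_CM:
  "paracocyclic_object B (CM B H) (CM_coface B H \<sigma>) (CM_codegeneracy B H)
     (CM_paracocyclic_operator B H \<delta> \<sigma>)"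
proof unfold_locales
  let ?d = "CM_coface B H \<sigma>" and ?s = "CM_codegeneracy B H" and ?t = "CM_paracocyclic_operator B H \<delta> \<sigma>"
  show "CM B H n \<in> Obj B" for n
    by (simp add: CM_eq)
  show "?d (Suc n) i \<in> hom_set B (CM B H n) (CM B H (Suc n))" if "i \<le> Suc n" for i n
    using acts_coface[OF that] by (rule acts_in_hom)
  show "?s n j \<in> hom_set B (CM B H (Suc n)) (CM B H n)" if "j \<le> n" for j n
    using acts_codegeneracy[OF that] by (rule acts_in_hom)
  show "?t n \<in> hom_set B (CM B H n) (CM B H n)" for n
    using acts_paracocyclic_operator by (rule acts_in_hom)
  then show "iso_arrow B (?t n)" for n
    by (rule iso_arrow_of_pow[of _ _ n]) (simp add: paracocyclic_operator_pow twist_iso CM_eq del: arrow_pow.simps)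
  show "?d (Suc n) j \<cdot> ?d n i = ?d (Suc n) i \<cdot> ?d n (j - 1)" if "n \<ge> 1" "i < j" "j \<le> Suc n" for n i j
    by (rule acts_eqI[OF acts_Comp[OF acts_coface' acts_coface] acts_Comp[OF acts_coface' acts_coface] coface_coface_op])
      (use that in auto)
  show "?s n j \<cdot> ?s (Suc n) i = ?s n i \<cdot> ?s (Suc n) (Suc j)" if "i \<le> j" "j \<le> n" for i j n
    by (rule acts_eqI[OF acts_Comp[OF acts_codegeneracy acts_codegeneracy] acts_Comp[OF acts_codegeneracy acts_codegeneracy]])
      (use that in \<open>auto simp: exchange\<close>)
  show "?s n j \<cdot> ?d (Suc n) i = ?d n i \<cdot> ?s (n - 1) (j - 1)" if "n \<ge> 1" "i < j" "j \<le> n" for n i j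
    by (rule acts_eqI[OF acts_Comp[OF acts_coface acts_codegeneracy]
          acts_Comp[OF acts_codegeneracy' acts_coface'] codegeneracy_coface_op(1)])
      (use that in auto)
  show "?s n j \<cdot> ?d (Suc n) i = \<i> (CM B H n)" if "j \<le> n" "i = j \<or> i = Suc j" for n i j
    by (rule acts_eqI[OF acts_Comp[OF acts_coface acts_codegeneracy] acts_Ident codegeneracy_coface_op(2)])
      (use that in auto)
  show "?s n j \<cdot> ?d (Suc n) i = ?d n (i - 1) \<cdot> ?s (n - 1) j" if "n \<ge> 1" "Suc j < i" "i \<le> Suc n" for n i j
    by (rule acts_eqI[OF acts_Comp[OF acts_coface acts_codegeneracy]
          acts_Comp[OF acts_codegeneracy' acts_coface'] codegeneracy_coface_op(3)])
      (use that in auto)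
  show "?t n \<cdot> ?d n i = ?d n (i - 1) \<cdot> ?t (n - 1)" if "1 \<le> i" "i \<le> n" for n i
    by (rule acts_eqI[OF acts_Comp[OF acts_coface' acts_paracocyclic_operator]
          acts_Comp[OF acts_paracocyclic_operator acts_coface'] cyc_coface_op])
      (use that in auto)
  show "?t n \<cdot> ?s n i = ?s n (i - 1) \<cdot> ?t (Suc n)" if "1 \<le> i" "i \<le> n" for n i
  proof (rule acts_eqI[OF acts_Comp[OF acts_codegeneracy acts_paracocyclic_operator]
        acts_Comp[OF acts_paracocyclic_operator acts_codegeneracy]])
    show "cyc n 0 (act Ep i x) = act Ep (i - 1) (cyc (Suc n) 0 x)" for x
      using cyc_Ep[of "i - 1" "n - 1" x] that by simp
  qed (use that in auto)
  show "?t n \<cdot> ?d n 0 = ?d n n" if "n \<ge> 1" for n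
  proof (rule acts_eqI[OF acts_Comp[OF acts_coface' acts_paracocyclic_operator] acts_coface'])
    show "cyc n 0 (coface_op n 0 x) = coface_op n n x" for x
      using cyc_Ut[of "n - 1" x] that by (simp add: coface_op_def)
  qed (use that in auto)
  show "?t n \<cdot> ?s n 0 = ?s n n \<cdot> arrow_pow B (?t (Suc n)) 2" for n
    by (rule acts_eqI[OF acts_Comp[OF acts_codegeneracy acts_paracocyclic_operator]
          acts_Comp[OF acts_pow[OF acts_paracocyclic_operator] acts_codegeneracy]])
      (simp_all add: cyc_Ep_0 numeral_2_eq_2)
qed

end

section \<open>Functors into modules\<close>

lemma category_opposite:
  assumes "category C"
  shows "category (opposite_category C)"
proof -
  interpret category C by fact
  show ?thesis
    by unfold_locales (auto simp: opposite_category_def hom_set_def)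
qed

lemma hom_set_opposite: "hom_set (opposite_category C) X Y = hom_set C Y X"
  by (auto simp: opposite_category_def hom_set_def)

lemma linear_maps_restrict_id: "module K M \<Longrightarrow> (\<lambda>x \<in> carrier M. x) \<in> linear_maps K M M"
  by (auto simp: linear_maps_def module.smult_closed abelian_monoid.a_closed
      abelian_group.axioms(1) module.axioms(2))

lemma linear_maps_compose:
  assumes "f \<in> linear_maps K M N" "g \<in> linear_maps K N P" "module K M"
  shows "compose (carrier M) g f \<in> linear_maps K M P"
  using assms(1,2) abelian_monoid.a_closed[OF abelian_group.axioms(1)[OF module.axioms(2)[OF assms(3)]]]
    module.smult_closed[OF assms(3)]
  by (auto simp: linear_maps_def compose_def PiE_iff)

lemma category_module_category: "category (module_category K)"
proof unfold_locales
qed (auto simp: module_category_def hom_set_def linear_maps_compose linear_maps_restrict_id,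
    auto simp: linear_maps_def compose_def PiE_iff extensional_def fun_eq_iff restrict_def)

text \<open>The condition on powers concerns their images under \<open>F\<close> alone, as
  \<open>t_n^(n+1)\<close> is only a twist in the source. Contravariant functors are covered by
  taking an opposite category as target.\<close>

lemma cocyclic_image:
  fixes C :: "('o, 'm, 'z) category_scheme" and D :: "('p, 'n, 'y) category_scheme"
  assumes Y: "paracocyclic_object C Y d s t" and D: "category D"
    and hom: "\<And>f X Z. f \<in> hom_set C X Z \<Longrightarrow> F f \<in> hom_set D (G X) (G Z)"
    and Comp: "\<And>f g X Z W. f \<in> hom_set C X Z \<Longrightarrow> g \<in> hom_set C Z W \<Longrightarrow> F (Comp C g f) = Comp D (F g) (F f)"
    and Ident: "\<And>X. X \<in> Obj C \<Longrightarrow> F (Ident C X) = Ident D (G X)"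
    and pow: "\<And>n. F (arrow_pow C (t n) (Suc n)) = Ident D (G (Y n))"
  shows "cocyclic_object D (\<lambda>n. G (Y n)) (\<lambda>n i. F (d n i)) (\<lambda>n i. F (s n i)) (\<lambda>n. F (t n))"
proof -
  interpret paracocyclic_object C Y d s t by fact
  interpret D: category D by fact
  have d': "1 \<le> n \<Longrightarrow> i \<le> n \<Longrightarrow> d n i \<in> hom_set C (Y (n - 1)) (Y n)" for n i
    using coface_in_hom[of i "n - 1"] by simp
  have s': "1 \<le> n \<Longrightarrow> j \<le> n - 1 \<Longrightarrow> s (n - 1) j \<in> hom_set C (Y n) (Y (n - 1))" for n j
    using codegeneracy_in_hom[of j "n - 1"] by simp
  note c = Comp[symmetric]
  have pow_image: "f \<in> hom_set C X X \<Longrightarrow> F (arrow_pow C f n) = arrow_pow D (F f) n" for f X n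
  proof (induction n)
    case 0
    then show ?case
      using hom_setD[OF 0] D.hom_setD[OF hom[OF 0]] by (simp add: Ident)
  next
    case (Suc n)
    then show ?case
      using Comp[OF arrow_pow_in_hom[OF Suc.prems] Suc.prems] by simp
  qed
  have iso: "iso_arrow D (F f)" if f: "f \<in> hom_set C X Z" and inv: "iso_arrow C f" for f X Z
  proof -
    obtain g where g: "inverse_arrows C f g"
      using inv by (auto simp: iso_arrow_def)
    then have gh: "g \<in> hom_set C Z X" "Comp C g f = Ident C X" "Comp C f g = Ident C Z"
      using hom_setD[OF f] by (auto simp: inverse_arrows_def)
    then have "inverse_arrows D (F f) (F g)"
      using hom[OF f] hom[OF gh(1)] Comp[OF f gh(1)] Comp[OF gh(1) f] hom_setD[OF f]
      by (auto simp: inverse_arrows_def hom_set_def Ident)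
    then show ?thesis
      by (auto simp: iso_arrow_def)
  qed
  show ?thesis
  proof unfold_locales
    show "G (Y n) \<in> Obj D" for n
      using D.hom_setD(4)[OF hom[OF Ident_in_hom[OF Y_in_Obj]]] .
    show "F (d (Suc n) i) \<in> hom_set D (G (Y n)) (G (Y (Suc n)))" if "i \<le> Suc n" for n i
      by (rule hom[OF coface_in_hom[OF that]])
    show "F (s n j) \<in> hom_set D (G (Y (Suc n))) (G (Y n))" if "j \<le> n" for n j
      by (rule hom[OF codegeneracy_in_hom[OF that]])
    show "F (t n) \<in> hom_set D (G (Y n)) (G (Y n))" for n
      by (rule hom[OF paracocyclic_in_hom])
    show "iso_arrow D (F (t n))" for n
      by (rule iso[OF paracocyclic_in_hom paracocyclic_iso])
    show "Comp D (F (d (Suc n) j)) (F (d n i)) = Comp D (F (d (Suc n) i)) (F (d n (j - 1)))"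
      if "n \<ge> 1" "i < j" "j \<le> Suc n" for n i j
      using that coface_coface[OF that] by (simp add: c[OF d' coface_in_hom])
    show "Comp D (F (s n j)) (F (s (Suc n) i)) = Comp D (F (s n i)) (F (s (Suc n) (Suc j)))"
      if "i \<le> j" "j \<le> n" for n i j
      using that codegeneracy_codegeneracy[OF that] by (simp add: c[OF codegeneracy_in_hom codegeneracy_in_hom])
    show "Comp D (F (s n j)) (F (d (Suc n) i)) = Comp D (F (d n i)) (F (s (n - 1) (j - 1)))"
      if "n \<ge> 1" "i < j" "j \<le> n" for n i j
    proof -
      have "F (Comp C (d n i) (s (n - 1) (j - 1))) = Comp D (F (d n i)) (F (s (n - 1) (j - 1)))"
        by (rule Comp[OF s' d']) (use that in auto)
      then show ?thesis
        using that codegeneracy_coface_less[OF that] by (simp add: c[OF coface_in_hom codegeneracy_in_hom])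
    qed
    show "Comp D (F (s n j)) (F (d (Suc n) i)) = Ident D (G (Y n))" if "j \<le> n" "i = j \<or> i = Suc j" for n i j
      using that codegeneracy_coface_eq[OF that] c[OF coface_in_hom codegeneracy_in_hom, of i n j]
      by (auto simp: Ident Y_in_Obj)
    show "Comp D (F (s n j)) (F (d (Suc n) i)) = Comp D (F (d n (i - 1))) (F (s (n - 1) j))"
      if "n \<ge> 1" "Suc j < i" "i \<le> Suc n" for n i j
    proof -
      have "F (Comp C (d n (i - 1)) (s (n - 1) j)) = Comp D (F (d n (i - 1))) (F (s (n - 1) j))"
        by (rule Comp[OF s' d']) (use that in auto)
      then show ?thesis
        using that codegeneracy_coface_greater[OF that] by (simp add: c[OF coface_in_hom codegeneracy_in_hom])
    qed
    show "Comp D (F (t n)) (F (d n i)) = Comp D (F (d n (i - 1))) (F (t (n - 1)))"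
      if "1 \<le> i" "i \<le> n" for n i
    proof -
      have "F (Comp C (d n (i - 1)) (t (n - 1))) = Comp D (F (d n (i - 1))) (F (t (n - 1)))"
        by (rule Comp[OF paracocyclic_in_hom d']) (use that in auto)
      then show ?thesis
        using that paracocyclic_coface[OF that] by (simp add: c[OF d' paracocyclic_in_hom])
    qed
    show "Comp D (F (t n)) (F (s n i)) = Comp D (F (s n (i - 1))) (F (t (Suc n)))"
      if "1 \<le> i" "i \<le> n" for n i
      using that paracocyclic_codegeneracy[OF that]
      by (simp add: c[OF codegeneracy_in_hom paracocyclic_in_hom] c[OF paracocyclic_in_hom codegeneracy_in_hom])
    show "Comp D (F (t n)) (F (d n 0)) = F (d n n)" if "n \<ge> 1" for n
      using that paracocyclic_coface_0[OF that] by (simp add: c[OF d' paracocyclic_in_hom])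
    show "Comp D (F (t n)) (F (s n 0)) = Comp D (F (s n n)) (arrow_pow D (F (t (Suc n))) 2)" for n
      using paracocyclic_codegeneracy_0[of n]
      by (simp add: pow_image[OF paracocyclic_in_hom, symmetric] c[OF codegeneracy_in_hom paracocyclic_in_hom]
          c[OF arrow_pow_in_hom[OF paracocyclic_in_hom] codegeneracy_in_hom])
    show "arrow_pow D (F (t n)) (Suc n) = Ident D (G (Y n))" for n
      using pow[of n] pow_image[OF paracocyclic_in_hom, of n "Suc n"] by simp
  qed
qed

context linear_braided_category
begin

lemma hom_functor_in_hom:
  assumes "X \<in> Obj B" "f \<in> hom_set B Y Z"
  shows "hom_functor B X f \<in> hom_set (module_category K) (hom_module B X Y) (hom_module B X Z)"
  using assms Comp_linear_right[OF assms] hom_module hom_setD[OF assms(2)]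
  by (simp add: hom_set_def module_category_def hom_functor_def)

lemma contra_hom_functor_in_hom:
  assumes "X \<in> Obj B" "f \<in> hom_set B Y Z"
  shows "contra_hom_functor B X f \<in> hom_set (module_category K) (hom_module B Z X) (hom_module B Y X)"
  using assms Comp_linear_left[OF assms] hom_module hom_setD[OF assms(2)]
  by (simp add: hom_set_def module_category_def contra_hom_functor_def)

lemma hom_functor_Comp:
  assumes "f \<in> hom_set B Y Z" "g \<in> hom_set B Z W"
  shows "hom_functor B X (g \<cdot> f) = Comp (module_category K) (hom_functor B X g) (hom_functor B X f)"
  using assms
  by (auto simp: hom_set_def module_category_def hom_functor_def compose_def hom_module_def fun_eq_iff restrict_def)

lemma contra_hom_functor_Comp:
  assumes "f \<in> hom_set B Y Z" "g \<in> hom_set B Z W"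
  shows "contra_hom_functor B X (g \<cdot> f)
    = Comp (module_category K) (contra_hom_functor B X f) (contra_hom_functor B X g)"
  using assms
  by (auto simp: hom_set_def module_category_def contra_hom_functor_def compose_def hom_module_def fun_eq_iff restrict_def)

text \<open>Applied to the twist of \<open>CM B H n\<close>, which need not be an identity but fixes
  all arrows from the unit object.\<close>

lemma hom_functor_trivial:
  assumes "f \<in> hom_set B Y Y" "\<And>g. g \<in> hom_set B X Y \<Longrightarrow> f \<cdot> g = g"
  shows "hom_functor B X f = Ident (module_category K) (hom_module B X Y)"
  using assms by (auto simp: hom_set_def module_category_def hom_functor_def hom_module_def restrict_def)

lemma contra_hom_functor_trivial:
  assumes "f \<in> hom_set B Y Y" "\<And>g. g \<in> hom_set B Y X \<Longrightarrow> g \<cdot> f = g"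
  shows "contra_hom_functor B X f = Ident (module_category K) (hom_module B Y X)"
  using assms by (auto simp: hom_set_def module_category_def contra_hom_functor_def hom_module_def restrict_def)

end

theorem corollary6:
  fixes K :: "('k, 'a) ring_scheme"
    and B :: "('o, 'm, 'k, 'z) linear_braided_category_scheme"
    and \<theta> :: "'o \<Rightarrow> 'm"
    and H :: "('o, 'm) hopf_data"
    and \<delta> \<sigma> :: 'm
  assumes "linear_braided_category K B"
    and "twisted_braided_category B \<theta>"
    and "hopf_algebra B H"
    and "twisted_modular_pair_in_involution B H \<theta> \<delta> \<sigma>"
  shows
    "cocyclic_object (module_category K)
       (\<lambda>n. hom_module B (TensorUnit B) (CM B H n))
       (\<lambda>n i. hom_functor B (TensorUnit B) (CM_coface B H \<sigma> n i))
       (\<lambda>n j. hom_functor B (TensorUnit B) (CM_codegeneracy B H n j))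
       (\<lambda>n. hom_functor B (TensorUnit B) (CM_paracocyclic_operator B H \<delta> \<sigma> n)) \<and>
     cyclic_object (module_category K)
       (\<lambda>n. hom_module B (CM B H n) (TensorUnit B))
       (\<lambda>n i. contra_hom_functor B (TensorUnit B) (CM_coface B H \<sigma> n i))
       (\<lambda>n j. contra_hom_functor B (TensorUnit B) (CM_codegeneracy B H n j))
       (\<lambda>n. contra_hom_functor B (TensorUnit B) (CM_paracocyclic_operator B H \<delta> \<sigma> n))"
proof -
  interpret linear_braided_category K B by fact
  interpret twisted_hopf_algebra B H \<theta> \<delta> \<sigma>
    using assms(2-4) by (simp add: twisted_hopf_algebra_def twisted_hopf_algebra_axioms_def)
  have CM: "CM B H n \<in> Obj B" for n
    by (simp add: CM_eq)
  have \<theta>: "\<theta> (CM B H n) \<in> hom_set B (CM B H n) (CM B H n)" for n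
    by (rule twist_in_hom[OF CM])
  have "cocyclic_object (module_category K)
       (\<lambda>n. hom_module B (TensorUnit B) (CM B H n))
       (\<lambda>n i. hom_functor B (TensorUnit B) (CM_coface B H \<sigma> n i))
       (\<lambda>n j. hom_functor B (TensorUnit B) (CM_codegeneracy B H n j))
       (\<lambda>n. hom_functor B (TensorUnit B) (CM_paracocyclic_operator B H \<delta> \<sigma> n))"
  proof (rule cocyclic_image[OF paracocyclic_CM category_module_category,
        where F = "hom_functor B (TensorUnit B)" and G = "hom_module B (TensorUnit B)"])
    show "hom_functor B (TensorUnit B) (arrow_pow B (CM_paracocyclic_operator B H \<delta> \<sigma> n) (Suc n))
        = Ident (module_category K) (hom_module B (TensorUnit B) (CM B H n))" for n
      unfolding paracocyclic_operator_pow
    proof (rule hom_functor_trivial[OF \<theta>])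
      show "\<theta> (CM B H n) \<cdot>\<^bsub>B\<^esub> g = g" if "g \<in> hom_set B (TensorUnit B) (CM B H n)" for g
        using twist_natural[OF that] that by (simp add: twist_unit hom_set_def)
    qed
    show "hom_functor B (TensorUnit B) (Ident B X) = Ident (module_category K) (hom_module B (TensorUnit B) X)" if "X \<in> Obj B" for X
      by (rule hom_functor_trivial[OF Ident_in_hom[OF that]]) (simp add: hom_set_def)
  qed (auto intro: hom_functor_in_hom hom_functor_Comp)
  moreover have "cyclic_object (module_category K)
       (\<lambda>n. hom_module B (CM B H n) (TensorUnit B))
       (\<lambda>n i. contra_hom_functor B (TensorUnit B) (CM_coface B H \<sigma> n i))
       (\<lambda>n j. contra_hom_functor B (TensorUnit B) (CM_codegeneracy B H n j))
       (\<lambda>n. contra_hom_functor B (TensorUnit B) (CM_paracocyclic_operator B H \<delta> \<sigma> n))"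
    unfolding cyclic_object_def
  proof (rule cocyclic_image[OF paracocyclic_CM category_opposite[OF category_module_category],
        where F = "contra_hom_functor B (TensorUnit B)" and G = "\<lambda>X. hom_module B X (TensorUnit B)"])
    show "contra_hom_functor B (TensorUnit B) (arrow_pow B (CM_paracocyclic_operator B H \<delta> \<sigma> n) (Suc n))
        = Ident (opposite_category (module_category K)) (hom_module B (CM B H n) (TensorUnit B))" for n
      unfolding paracocyclic_operator_pow opposite_category_def category.simps
    proof (rule contra_hom_functor_trivial[OF \<theta>])
      show "g \<cdot>\<^bsub>B\<^esub> \<theta> (CM B H n) = g" if "g \<in> hom_set B (CM B H n) (TensorUnit B)" for g
        using twist_natural[OF that] that by (simp add: twist_unit hom_set_def)
    qed
    show "contra_hom_functor B (TensorUnit B) (Ident B X) = Ident (opposite_category (module_category K)) (hom_module B X (TensorUnit B))"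
      if "X \<in> Obj B" for X
      unfolding opposite_category_def category.simps
      by (rule contra_hom_functor_trivial[OF Ident_in_hom[OF that]]) (simp add: hom_set_def)
    show "contra_hom_functor B (TensorUnit B) f
        \<in> hom_set (opposite_category (module_category K)) (hom_module B X (TensorUnit B)) (hom_module B Z (TensorUnit B))"
      if "f \<in> hom_set B X Z" for f X Z
      unfolding hom_set_opposite by (rule contra_hom_functor_in_hom[OF _ that]) simp
  qed (simp add: opposite_category_def contra_hom_functor_Comp)
  ultimately show ?thesis ..
qed

end
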